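(* In $\mathbb{R}^3$, the only minimizers of $b_2$ are $3$-simplices. That is: if $K\subset\mathbb{R}^3$ is a convex body which minimizes $b_2$ among all convex bodies in $\mathbb{R}^3$, i.e. $b_2(K)=1$, then $K$ is a $3$-simplex.
   Context: A convex body in $\mathbb{R}^3$ is a compact convex set with non-empty interior. For compact convex sets $K_1,K_2,K_3\subset\mathbb{R}^3$, $V_3(K_1,K_2,K_3)$ denotes their mixed volume: the symmetric functional, Minkowski-multilinear in each argument, normalized by $V_3(K,K,K)=\mathrm{Vol}_3(K)$. For a convex body $K\subset\mathbb{R}^3$ define $$b_2(K)=\sup_{A,B}\frac{V_3(A,B,K)\,\mathrm{Vol}_3(K)}{V_3(A,K,K)\,V_3(B,K,K)},$$ the supremum being over all pairs $(A,B)$ of compact convex sets in $\mathbb{R}^3$, neither of which is a single point. Taking $A=B=K$ shows $b_2(K)\ge 1$ for every $K$; it is known that $b_2(\Delta)=1$ for every $3$-simplex $\Delta$, so the minimum value of $b_2$ is $1$. A $3$-simplex is the convex hull of $4$ affinely independent points. *)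

theory Defs
  imports "HOL-Analysis.Analysis"
begin

definition convex_body :: "(real ^ 3) set \<Rightarrow> bool" where
  "convex_body K \<longleftrightarrow> compact K \<and> convex K \<and> interior K \<noteq> {}"

definition compact_convex :: "(real ^ 3) set \<Rightarrow> bool" where
  "compact_convex A \<longleftrightarrow> A \<noteq> {} \<and> compact A \<and> convex A"

text \<open>
  The mixed volume is the symmetric functional on triples of (nonempty) compact convex sets that is
  Minkowski-multilinear and restricts to the volume on the diagonal.  Addition of sets is Minkowski
  addition.  The last clause only fixes the value of the total function outside its intended
  domain, so that a definite description can be used.
\<close>

definition mixed_volume_functional ::
    "((real ^ 3) set \<Rightarrow> (real ^ 3) set \<Rightarrow> (real ^ 3) set \<Rightarrow> real) \<Rightarrow> bool" where
  "mixed_volume_functional V \<longleftrightarrow>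
     (\<forall>A B C. compact_convex A \<and> compact_convex B \<and> compact_convex C \<longrightarrow>
        V A B C = V B A C \<and> V A B C = V A C B) \<and>
     (\<forall>A A' B C s t. compact_convex A \<and> compact_convex A' \<and> compact_convex B \<and> compact_convex C \<and>
          0 \<le> s \<and> 0 \<le> t \<longrightarrow>
        V ((*\<^sub>R) s ` A + (*\<^sub>R) t ` A') B C = s * V A B C + t * V A' B C) \<and>
     (\<forall>A. compact_convex A \<longrightarrow> V A A A = measure lebesgue A) \<and>
     (\<forall>A B C. \<not> (compact_convex A \<and> compact_convex B \<and> compact_convex C) \<longrightarrow> V A B C = 0)"

definition mixed_volume ::
    "(real ^ 3) set \<Rightarrow> (real ^ 3) set \<Rightarrow> (real ^ 3) set \<Rightarrow> real" where
  "mixed_volume = (THE V. mixed_volume_functional V)"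

lemma compact_convex_plus:
  assumes "compact_convex A" "compact_convex B"
  shows "compact_convex (A + B)"
proof -
  have "A + B = {x + y |x y. x \<in> A \<and> y \<in> B}"
    by (auto simp: set_plus_def)
  then show ?thesis
    using assms compact_sums[of A B] convex_set_plus[of A B]
    by (auto simp: compact_convex_def)
qed

text \<open>
  By polarization there is at most one such functional, so the definite description above denotes
  it; existence is Minkowski's theorem on mixed volumes.
\<close>

lemma mixed_volume_functional_polarization:
  assumes V: "mixed_volume_functional V"
    and A: "compact_convex A" and B: "compact_convex B" and C: "compact_convex C"
  shows "6 * V A B C =
    measure lebesgue (A + B + C)
    - measure lebesgue (A + B) - measure lebesgue (A + C) - measure lebesgue (B + C)
    + measure lebesgue A + measure lebesgue B + measure lebesgue C"
proof -
  have sym1: "V X Y Z = V Y X Z" and sym2: "V X Y Z = V X Z Y"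
    if "compact_convex X" "compact_convex Y" "compact_convex Z" for X Y Z
    using V that unfolding mixed_volume_functional_def by blast+
  have vol: "measure lebesgue X = V X X X" if "compact_convex X" for X
    using V that unfolding mixed_volume_functional_def by simp
  have add1: "V (X + X') Y Z = V X Y Z + V X' Y Z"
    if "compact_convex X" "compact_convex X'" "compact_convex Y" "compact_convex Z" for X X' Y Z
  proof -
    have "V ((*\<^sub>R) 1 ` X + (*\<^sub>R) 1 ` X') Y Z = 1 * V X Y Z + 1 * V X' Y Z"
      using V that unfolding mixed_volume_functional_def by (meson zero_le_one)
    then show ?thesis by (simp add: image_def)
  qed
  have add2: "V Y (X + X') Z = V Y X Z + V Y X' Z"
    if "compact_convex X" "compact_convex X'" "compact_convex Y" "compact_convex Z" for X X' Y Z
    using that by (simp add: sym1[of Y] add1 compact_convex_plus)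
  have add3: "V Y Z (X + X') = V Y Z X + V Y Z X'"
    if "compact_convex X" "compact_convex X'" "compact_convex Y" "compact_convex Z" for X X' Y Z
    using that by (simp add: sym2[of Y Z] add2 compact_convex_plus)
  have BA: "V B A Z = V A B Z" "V Z B A = V Z A B"
      "V C A Z = V A C Z" "V Z C A = V Z A C" "V C B Z = V B C Z" "V Z C B = V Z B C"
    if "compact_convex Z" for Z
    using that A B C sym1 sym2 by blast+
  show ?thesis
    using A B C by (simp add: vol add1 add2 add3 compact_convex_plus BA)
qed

lemma mixed_volume_functional_unique:
  assumes V: "mixed_volume_functional V" and W: "mixed_volume_functional W"
  shows "V = W"
proof (intro ext)
  fix A B C
  show "V A B C = W A B C"
  proof (cases "compact_convex A \<and> compact_convex B \<and> compact_convex C")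
    case True
    then show ?thesis
      using mixed_volume_functional_polarization[OF V, of A B C]
        mixed_volume_functional_polarization[OF W, of A B C] by simp
  next
    case False
    then show ?thesis
      using V W unfolding mixed_volume_functional_def by metis
  qed
qed

text \<open>The supremum is taken in the extended reals, so no boundedness is presupposed.\<close>

definition b2 :: "(real ^ 3) set \<Rightarrow> ereal" where
  "b2 K = (SUP (A, B) \<in> {(A, B). compact_convex A \<and> compact_convex B \<and>
                                  \<not> is_singleton A \<and> \<not> is_singleton B}.
     ereal (mixed_volume A B K * measure lebesgue K /
            (mixed_volume A K K * mixed_volume B K K)))"

end

theory Submission
  imports Defs
begin

text \<open>
  If \<open>K\<close> is a minimizer then \<open>b2 K \<le> b2 \<Delta> \<le> 1\<close> for a simplex \<open>\<Delta>\<close>, which is the inequality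
  \<open>V(A,B,K) V(K) \<le> V(A,K,K) V(B,K,K)\<close> for all \<open>A\<close> and \<open>B\<close>. Call a face of \<open>K\<close> regular if a ball
  inside \<open>K\<close> touches it; \<open>K\<close> is the intersection of the half spaces of its regular faces, and
  perturbing \<open>K\<close> near a regular face changes \<open>V(\<cdot>,K,K)\<close> strictly.

  Perturbations of \<open>K\<close> near two disjoint faces do not interact, so \<open>V(A,B,K)\<close> is the sum of the two
  linear terms, and cutting off one face while raising the other contradicts the inequality. Hence
  any two regular faces meet. Raising one facet and cutting the other shows moreover that two
  facets cannot meet in a single point. If all regular faces are facets, then any two share an
  edge; five of them are impossible because the linear dependency between their affine functions,
  evaluated in the midpoints of the edges, is trivial. If some regular face is a segment or a point,
  then all regular faces except one turn out to share a point, and in such a cone the lateral faces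
  meet along edges, so there are at most three of them. A body with at most four regular faces is a
  simplex because an extreme point lies on three of them.
\<close>

text \<open>The map X -> V(X,K,K) is integration of \<open>supp X\<close> against the surface area
  measure of K, and strict inequalities would call for the support of that measure. It is never
  constructed: regular normals replace it. They are rich enough to determine K, and at each of them
  \<open>mixed_volume_strict_mono\<close> obtains strictness directly from volumes. Inequalities
  between mixed volumes are extracted from inclusions of Minkowski sums with a free scaling
  parameter: both volumes are cubic polynomials in it, and letting the parameter tend to 0 or to
  infinity isolates one coefficient. In a cone all lateral faces contain the apex, so the
  disjointness argument for K says nothing about them. The base Q satisfies V(Q,X,K) = V(X,K,K) for
  all X, hence can replace K as the unperturbed set, and lateral faces that do not meet in Q are
  separated there. Because the mixed volume is a definite description, its existence has to be
  proved as well; Hessians of smoothed support functions turn its multilinearity into a pointwise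
  identity of determinants.\<close>

abbreviation scaled :: "real \<Rightarrow> (real ^ 3) set \<Rightarrow> (real ^ 3) set" (infixr "\<cdot>" 75) where
  "s \<cdot> A \<equiv> (*\<^sub>R) s ` A"

lemma compact_convex_scaled: "compact_convex A \<Longrightarrow> compact_convex (s \<cdot> A)"
  by (auto simp: compact_convex_def intro: compact_scaling convex_scaling)

lemma compact_convex_comb:
  "compact_convex A \<Longrightarrow> compact_convex B \<Longrightarrow> compact_convex (s \<cdot> A + t \<cdot> B)"
  by (simp add: compact_convex_plus compact_convex_scaled)

lemma compact_convex_singleton: "compact_convex {x}"
  by (simp add: compact_convex_def)

lemma compact_convexD:
  assumes "compact_convex A"
  shows "A \<noteq> {}" "compact A" "convex A" "bounded A" "closed A" "A \<in> lmeasurable"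
  using assms by (auto simp: compact_convex_def compact_imp_bounded compact_imp_closed lmeasurable_compact)

section \<open>Support functions of compact convex sets\<close>

definition supp :: "(real ^ 3) set \<Rightarrow> real ^ 3 \<Rightarrow> real" where
  "supp A v = (SUP a\<in>A. v \<bullet> a)"

lemma supp_attained:
  assumes "compact_convex A"
  obtains a where "a \<in> A" "v \<bullet> a = supp A v" "\<And>b. b \<in> A \<Longrightarrow> v \<bullet> b \<le> v \<bullet> a"
proof -
  have "\<exists>a\<in>A. \<forall>b\<in>A. v \<bullet> b \<le> v \<bullet> a"
    using assms by (intro continuous_attains_sup) (auto simp: compact_convex_def intro!: continuous_intros)
  then obtain a where a: "a \<in> A" "\<And>b. b \<in> A \<Longrightarrow> v \<bullet> b \<le> v \<bullet> a" by blast
  moreover have "v \<bullet> a = supp A v"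
    unfolding supp_def using a by (intro cSup_eq_maximum[symmetric]) auto
  ultimately show ?thesis using that by blast
qed

lemma supp_ge: "compact_convex A \<Longrightarrow> a \<in> A \<Longrightarrow> v \<bullet> a \<le> supp A v"
  by (metis supp_attained)

lemma supp_le: "compact_convex A \<Longrightarrow> (\<And>a. a \<in> A \<Longrightarrow> v \<bullet> a \<le> c) \<Longrightarrow> supp A v \<le> c"
  by (metis supp_attained)

lemma mem_iff_supp:
  assumes A: "compact_convex A"
  shows "z \<in> A \<longleftrightarrow> (\<forall>v. v \<bullet> z \<le> supp A v)"
proof
  assume r: "\<forall>v. v \<bullet> z \<le> supp A v"
  show "z \<in> A"
  proof (rule ccontr)
    assume "z \<notin> A"
    then obtain a b where ab: "a \<bullet> z < b" "\<forall>x\<in>A. b < a \<bullet> x"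
      using separating_hyperplane_closed_point[of A z] compact_convexD[OF A] by blast
    have "supp A (- a) \<le> - b"
      using ab(2) by (intro supp_le[OF A]) (auto simp: inner_minus_left less_imp_le)
    moreover have "(- a) \<bullet> z \<le> supp A (- a)" using r by blast
    ultimately show False using ab(1) by (simp add: inner_minus_left)
  qed
qed (use supp_ge[OF A] in blast)

lemma subset_iff_supp:
  assumes "compact_convex A" "compact_convex B"
  shows "A \<subseteq> B \<longleftrightarrow> (\<forall>v. supp A v \<le> supp B v)"
proof
  assume "A \<subseteq> B"
  then show "\<forall>v. supp A v \<le> supp B v"
    using assms by (meson subsetD supp_ge supp_le)
next
  assume "\<forall>v. supp A v \<le> supp B v"
  then show "A \<subseteq> B"
    using mem_iff_supp[OF assms(1)] mem_iff_supp[OF assms(2)] by (meson order_trans subsetI)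
qed

lemma compact_convex_eqI:
  "compact_convex A \<Longrightarrow> compact_convex B \<Longrightarrow> (\<And>v. supp A v = supp B v) \<Longrightarrow> A = B"
  by (simp add: set_eq_subset subset_iff_supp)

lemma supp_plus:
  assumes A: "compact_convex A" and B: "compact_convex B"
  shows "supp (A + B) v = supp A v + supp B v"
proof (rule antisym)
  show "supp (A + B) v \<le> supp A v + supp B v"
    using A B compact_convex_plus[OF A B]
    by (intro supp_le) (auto simp: set_plus_def inner_add_right intro!: add_mono supp_ge)
  obtain a b where "a \<in> A" "v \<bullet> a = supp A v" "b \<in> B" "v \<bullet> b = supp B v"
    using supp_attained[OF A] supp_attained[OF B] by metis
  then show "supp A v + supp B v \<le> supp (A + B) v"
    using supp_ge[OF compact_convex_plus[OF A B], of "a + b" v] by (auto simp: inner_add_right)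
qed

lemma supp_scaled:
  assumes A: "compact_convex A" and "0 \<le> s"
  shows "supp (s \<cdot> A) v = s * supp A v"
proof (rule antisym)
  show "supp (s \<cdot> A) v \<le> s * supp A v"
    using assms compact_convex_scaled[OF A]
    by (intro supp_le) (auto intro!: mult_left_mono supp_ge)
  obtain a where "a \<in> A" "v \<bullet> a = supp A v"
    using supp_attained[OF A] by metis
  then show "s * supp A v \<le> supp (s \<cdot> A) v"
    using supp_ge[OF compact_convex_scaled[OF A], of "s *\<^sub>R a" s v] by auto
qed

lemma supp_singleton: "supp {x} v = v \<bullet> x"
  by (simp add: supp_def)

lemmas compact_convex_intros =
  compact_convex_plus compact_convex_scaled compact_convex_singleton

lemmas supp_simps = supp_plus supp_scaled supp_singleton

lemma scaled_add:
  assumes A: "compact_convex A" and "0 \<le> s" "0 \<le> t"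
  shows "s \<cdot> A + t \<cdot> A = (s + t) \<cdot> A"
  by (rule compact_convex_eqI)
     (use assms in \<open>simp_all add: compact_convex_intros supp_simps distrib_right\<close>)

lemma supp_add_le:
  assumes A: "compact_convex A"
  shows "supp A (v + w) \<le> supp A v + supp A w"
  using A by (intro supp_le) (auto simp: inner_add_left intro!: add_mono supp_ge)

lemma supp_scaleR:
  assumes A: "compact_convex A" and "0 \<le> t"
  shows "supp A (t *\<^sub>R v) = t * supp A v"
proof -
  obtain a where a: "a \<in> A" "v \<bullet> a = supp A v" "\<And>b. b \<in> A \<Longrightarrow> v \<bullet> b \<le> v \<bullet> a"
    using supp_attained[OF A] by metis
  have "supp A (t *\<^sub>R v) = (t *\<^sub>R v) \<bullet> a"
    using a assms by (intro antisym supp_le supp_ge) (auto intro: mult_left_mono)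
  then show ?thesis using a by simp
qed

lemma supp_zero: "compact_convex A \<Longrightarrow> supp A 0 = 0"
  using supp_scaleR[of A 0 0] by simp

lemma compact_convex_norm_bound:
  assumes A: "compact_convex A"
  obtains R where "0 < R" "\<And>a. a \<in> A \<Longrightarrow> norm a \<le> R"
  using compact_convexD(4)[OF A] by (metis bounded_pos)

lemma supp_abs_le:
  assumes A: "compact_convex A" and R: "\<And>a. a \<in> A \<Longrightarrow> norm a \<le> R"
  shows "\<bar>supp A v\<bar> \<le> R * norm v"
proof -
  obtain a where a: "a \<in> A" "v \<bullet> a = supp A v"
    using supp_attained[OF A] by metis
  have "\<bar>v \<bullet> a\<bar> \<le> norm v * norm a" by (rule Cauchy_Schwarz_ineq2)
  also have "\<dots> \<le> norm v * R" using R a by (simp add: mult_left_mono)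
  finally show ?thesis using a by (simp add: mult.commute)
qed

lemma supp_diff_le:
  assumes A: "compact_convex A" and R: "\<And>a. a \<in> A \<Longrightarrow> norm a \<le> R"
  shows "\<bar>supp A v - supp A w\<bar> \<le> R * norm (v - w)"
proof -
  have "supp A v \<le> supp A w + supp A (v - w)" "supp A w \<le> supp A v + supp A (w - v)"
    using supp_add_le[OF A, of w "v - w"] supp_add_le[OF A, of v "w - v"] by simp_all
  moreover have "\<bar>supp A (v - w)\<bar> \<le> R * norm (v - w)" "\<bar>supp A (w - v)\<bar> \<le> R * norm (v - w)"
    using supp_abs_le[OF A R, of "v - w"] supp_abs_le[OF A R, of "w - v"] by (auto simp: norm_minus_commute)
  ultimately show ?thesis by linarith
qed

lemma continuous_on_supp:
  assumes A: "compact_convex A"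
  shows "continuous_on S (supp A)"
proof -
  obtain R where R: "0 < R" "\<And>a. a \<in> A \<Longrightarrow> norm a \<le> R"
    using compact_convex_norm_bound[OF A] by metis
  have "R-lipschitz_on S (supp A)"
    using supp_diff_le[OF A R(2)] R(1) by (intro lipschitz_onI) (auto simp: dist_norm)
  then show ?thesis by (rule lipschitz_on_continuous_on)
qed

section \<open>Volumes as Jacobian integrals\<close>

text \<open>
  The gradient of such a \<open>\<phi>\<close> maps the space onto \<open>A\<close> up to a null set, so that \<open>det H\<close> integrates to
  the volume of \<open>A\<close>. Potentials add up under Minkowski addition, hence the volume inherits the
  polynomial behaviour of the determinant.
\<close>

definition potential :: "(real ^ 3) set \<Rightarrow> (real ^ 3 \<Rightarrow> real ^ 3 ^ 3) \<Rightarrow> bool" where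
  "potential A H \<longleftrightarrow> (\<exists>\<phi> g c.
     (\<forall>x. (\<phi> has_derivative (\<lambda>w. g x \<bullet> w)) (at x)) \<and>
     (\<forall>x. (g has_derivative (\<lambda>w. H x *v w)) (at x)) \<and>
     (\<forall>x. g x \<in> A) \<and> (\<forall>x. supp A x - c \<le> \<phi> x) \<and> convex_on UNIV \<phi>)"

lemma potential_comb:
  assumes A: "compact_convex A" and B: "compact_convex B"
    and HA: "potential A H" and HB: "potential B H'" and st: "0 \<le> s" "0 \<le> t"
  shows "potential (s \<cdot> A + t \<cdot> B) (\<lambda>x. s *\<^sub>R H x + t *\<^sub>R H' x)"
proof -
  obtain \<phi> g c where 1: "\<And>x. (\<phi> has_derivative (\<lambda>w. g x \<bullet> w)) (at x)"
    "\<And>x. (g has_derivative (\<lambda>w. H x *v w)) (at x)" "\<And>x. g x \<in> A"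
    "\<And>x. supp A x - c \<le> \<phi> x" "convex_on UNIV \<phi>"
    using HA unfolding potential_def by blast
  obtain \<phi>' g' c' where 2: "\<And>x. (\<phi>' has_derivative (\<lambda>w. g' x \<bullet> w)) (at x)"
    "\<And>x. (g' has_derivative (\<lambda>w. H' x *v w)) (at x)" "\<And>x. g' x \<in> B"
    "\<And>x. supp B x - c' \<le> \<phi>' x" "convex_on UNIV \<phi>'"
    using HB unfolding potential_def by blast
  show ?thesis unfolding potential_def
  proof (intro exI conjI allI)
    show "((\<lambda>x. s * \<phi> x + t * \<phi>' x) has_derivative
        (\<lambda>w. (s *\<^sub>R g x + t *\<^sub>R g' x) \<bullet> w)) (at x)" for x
      by (rule has_derivative_eq_rhs)
         (auto intro!: derivative_eq_intros 1(1) 2(1) simp: inner_add_left)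
    show "((\<lambda>x. s *\<^sub>R g x + t *\<^sub>R g' x) has_derivative
        (\<lambda>w. (s *\<^sub>R H x + t *\<^sub>R H' x) *v w)) (at x)" for x
      by (rule has_derivative_eq_rhs)
         (auto intro!: derivative_eq_intros 1(2) 2(2)
            simp: matrix_vector_mult_add_rdistrib scaleR_matrix_vector_assoc)
    show "s *\<^sub>R g x + t *\<^sub>R g' x \<in> s \<cdot> A + t \<cdot> B" for x
      using 1(3) 2(3) by auto
    show "supp (s \<cdot> A + t \<cdot> B) x - (s * c + t * c') \<le> s * \<phi> x + t * \<phi>' x" for x
      using mult_left_mono[OF 1(4)[of x] st(1)] mult_left_mono[OF 2(4)[of x] st(2)] A B st
      by (simp add: supp_simps compact_convex_intros algebra_simps)
    show "convex_on UNIV (\<lambda>x. s * \<phi> x + t * \<phi>' x)"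
      using 1(5) 2(5) st by (intro convex_on_add convex_on_cmul)
  qed
qed

text \<open>If det M were negative, the determinant would vanish somewhere on the segment from M to
  the identity, away from M; there the quadratic form is positive definite.\<close>

lemma det_nonneg_of_monotone:
  fixes M :: "real ^ 3 ^ 3"
  assumes M: "\<And>w. 0 \<le> w \<bullet> (M *v w)"
  shows "0 \<le> det M"
proof (rule ccontr)
  assume "\<not> 0 \<le> det M"
  define f where "f t = det ((1 - t) *\<^sub>R M + t *\<^sub>R mat 1)" for t :: real
  have "\<exists>t. 0 \<le> t \<and> t \<le> 1 \<and> f t = 0"
    using \<open>\<not> 0 \<le> det M\<close>
    by (intro IVT') (auto simp: f_def det_3 mat_def intro!: continuous_intros)
  then obtain t where t: "0 \<le> t" "t \<le> 1" "f t = 0" by blast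
  have "t \<noteq> 0" using t \<open>\<not> 0 \<le> det M\<close> by (auto simp: f_def)
  let ?N = "(1 - t) *\<^sub>R M + t *\<^sub>R mat 1"
  obtain w where w: "w \<noteq> 0" "?N *v w = 0"
    using t(3) unfolding f_def by (metis invertible_det_nz matrix_left_invertible_ker
        invertible_left_inverse)
  have "0 = w \<bullet> (?N *v w)" using w by simp
  also have "\<dots> = (1 - t) * (w \<bullet> (M *v w)) + t * (w \<bullet> w)"
    by (simp add: matrix_vector_mult_add_rdistrib inner_add_right flip: scaleR_matrix_vector_assoc)
  finally show False
    using M[of w] t \<open>t \<noteq> 0\<close> w(1) by (smt (verit) inner_gt_zero_iff mult_nonneg_nonneg mult_pos_pos)
qed

lemma convex_on_gradient_le:
  fixes \<phi> :: "real ^ 3 \<Rightarrow> real"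
  assumes c: "convex_on UNIV \<phi>" and d: "(\<phi> has_derivative (\<lambda>w. p \<bullet> w)) (at x)"
  shows "\<phi> x + p \<bullet> (y - x) \<le> \<phi> y"
proof -
  define f where "f t = \<phi> (x + t *\<^sub>R (y - x))" for t :: real
  have cf: "convex_on UNIV f"
  proof (rule convex_onI)
    fix t a b :: real assume t: "0 < t" "t < 1"
    have "x + ((1 - t) *\<^sub>R a + t *\<^sub>R b) *\<^sub>R (y - x)
       = (1 - t) *\<^sub>R (x + a *\<^sub>R (y - x)) + t *\<^sub>R (x + b *\<^sub>R (y - x))"
      by (simp add: algebra_simps)
    then show "f ((1 - t) *\<^sub>R a + t *\<^sub>R b) \<le> (1 - t) * f a + t * f b"
      unfolding f_def using convex_onD[OF c, of t] t by simp
  qed simp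
  have "((\<lambda>t. \<phi> (x + t *\<^sub>R (y - x))) has_derivative (\<lambda>t. p \<bullet> (t *\<^sub>R (y - x)))) (at 0)"
    by (rule has_derivative_compose[of "\<lambda>t. x + t *\<^sub>R (y - x)" "\<lambda>t. t *\<^sub>R (y - x)" 0 UNIV \<phi> "\<lambda>w. p \<bullet> w"])
       (use d in \<open>auto intro!: derivative_eq_intros\<close>)
  then have "(f has_real_derivative p \<bullet> (y - x)) (at 0)"
    unfolding f_def has_field_derivative_def
    by (rule has_derivative_eq_rhs) (simp add: fun_eq_iff mult.commute)
  then have "(f has_real_derivative p \<bullet> (y - x)) (at 0 within UNIV)" by simp
  from convex_on_imp_above_tangent[OF cf _ _ _ this, of 1]
  show ?thesis by (simp add: f_def)
qed

text \<open>Change of variables for the gradient map on the set \<open>S\<close> where its Jacobian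
  is nonzero: the map is injective on \<open>S\<close>, the image of the complement is null by
  Sard's theorem, and the range lies between the interior of A and A, which differ only inside the
  null set \<open>frontier A\<close>.\<close>

lemma potential_det_has_integral:
  assumes A: "compact_convex A" and H: "potential A H"
  shows "((\<lambda>x. det (H x)) has_integral measure lebesgue A) UNIV"
proof -
  obtain \<phi> g c where d\<phi>: "\<And>x. (\<phi> has_derivative (\<lambda>w. g x \<bullet> w)) (at x)"
    and dg: "\<And>x. (g has_derivative (\<lambda>w. H x *v w)) (at x)" and gA: "\<And>x. g x \<in> A"
    and low: "\<And>x. supp A x - c \<le> \<phi> x" and conv: "convex_on UNIV \<phi>"
    using H unfolding potential_def by blast
  have tangent: "\<phi> x + g x \<bullet> (y - x) \<le> \<phi> y" for x y
    by (rule convex_on_gradient_le[OF conv d\<phi>])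
  have line: "((\<lambda>t. g (x + t *\<^sub>R w)) has_vector_derivative H x *v w) (at 0)" for x w
  proof -
    have "((\<lambda>t. g (x + t *\<^sub>R w)) has_derivative (\<lambda>t. H x *v (t *\<^sub>R w))) (at 0)"
      by (rule has_derivative_compose[of "\<lambda>t. x + t *\<^sub>R w" "\<lambda>t. t *\<^sub>R w" 0 UNIV g "\<lambda>w. H x *v w"])
         (use dg[of x] in \<open>auto intro!: derivative_eq_intros\<close>)
    then show ?thesis
      by (simp add: has_vector_derivative_def matrix_vector_mult_scaleR)
  qed
  have psd: "0 \<le> w \<bullet> (H x *v w)" for x w
  proof -
    have "((\<lambda>t. w \<bullet> g (x + t *\<^sub>R w)) has_vector_derivative w \<bullet> (H x *v w)) (at 0)"
      using bounded_linear.has_vector_derivative[OF bounded_linear_inner_right line] .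
    then have d: "((\<lambda>t. w \<bullet> g (x + t *\<^sub>R w)) has_real_derivative w \<bullet> (H x *v w)) (at 0)"
      by (simp add: has_real_derivative_iff_has_vector_derivative)
    have "mono_on UNIV (\<lambda>t. w \<bullet> g (x + t *\<^sub>R w))"
    proof (rule mono_onI)
      fix a b :: real assume "a \<le> b"
      show "w \<bullet> g (x + a *\<^sub>R w) \<le> w \<bullet> g (x + b *\<^sub>R w)"
      proof (cases "a = b")
        case False
        have *: "(x + b *\<^sub>R w) - (x + a *\<^sub>R w) = (b - a) *\<^sub>R w"
          "(x + a *\<^sub>R w) - (x + b *\<^sub>R w) = - ((b - a) *\<^sub>R w)"
          by (simp_all add: algebra_simps)
        have "(b - a) * (w \<bullet> g (x + a *\<^sub>R w)) \<le> (b - a) * (w \<bullet> g (x + b *\<^sub>R w))"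
          using tangent[of "x + a *\<^sub>R w" "x + b *\<^sub>R w"] tangent[of "x + b *\<^sub>R w" "x + a *\<^sub>R w"]
          unfolding * by (simp add: inner_commute)
        then show ?thesis using False \<open>a \<le> b\<close> by simp
      qed simp
    qed
    from mono_on_imp_deriv_nonneg[OF this d] show ?thesis by simp
  qed
  define S where "S = {x. det (H x) \<noteq> 0}"
  have mat_H: "matrix (\<lambda>w. H x *v w) = H x" for x
    by (simp add: matrix_of_matrix_vector_mul)
  have "(\<lambda>x. det (matrix (\<lambda>w. H x *v w))) \<in> borel_measurable (lebesgue_on UNIV)"
    using dg by (intro borel_measurable_det_Jacobian) auto
  then have "(\<lambda>x. det (H x)) \<in> borel_measurable lebesgue"
    by (simp add: mat_H lebesgue_on_UNIV_eq)
  then have "{x \<in> space lebesgue. det (H x) \<noteq> 0} \<in> sets lebesgue"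
    by measurable
  then have S: "S \<in> sets lebesgue"
    by (simp add: S_def)
  have critical: "g z = p" if "\<And>u. \<phi> z - p \<bullet> z \<le> \<phi> u - p \<bullet> u" for z p
  proof -
    have "((\<lambda>u. \<phi> u - p \<bullet> u) has_derivative (\<lambda>w. g z \<bullet> w - p \<bullet> w)) (at z)"
      by (auto intro!: derivative_eq_intros d\<phi>)
    then have "(\<lambda>w. g z \<bullet> w - p \<bullet> w) = (\<lambda>w. 0)"
      using that by (intro differential_zero_maxmin[of z UNIV]) auto
    then have "(g z - p) \<bullet> (g z - p) = 0" by (metis inner_diff_left)
    then show ?thesis by simp
  qed
  \<comment> \<open>A common gradient p at x and y makes both of them minima of
    \<open>\<phi> u - p \<bullet> u\<close>. By convexity the whole segment between them consists of
    minima, so \<open>g\<close> is constant on it and \<open>H x\<close> annihilates y - x.\<close>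
  have inj: "inj_on g S"
  proof (rule inj_onI, rule ccontr)
    fix x y assume x: "x \<in> S" and eq: "g x = g y" and ne: "x \<noteq> y"
    define p where "p = g x"
    have gp: "g (x + t *\<^sub>R (y - x)) = p" if t: "t \<in> {0..1}" for t
    proof (rule critical)
      fix u
      let ?z = "x + t *\<^sub>R (y - x)"
      have z: "?z = (1 - t) *\<^sub>R x + t *\<^sub>R y" by (simp add: algebra_simps)
      have "\<phi> ?z \<le> (1 - t) * \<phi> x + t * \<phi> y"
        unfolding z using convex_onD[OF conv, of t x y] t by simp
      moreover have "\<phi> x - p \<bullet> x \<le> \<phi> u - p \<bullet> u" "\<phi> y - p \<bullet> y \<le> \<phi> u - p \<bullet> u"
        using tangent[of x u] tangent[of y u] eq by (simp_all add: p_def inner_diff_right)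
      then have "(1 - t) * (\<phi> x - p \<bullet> x) + t * (\<phi> y - p \<bullet> y) \<le> (1 - t) * (\<phi> u - p \<bullet> u) + t * (\<phi> u - p \<bullet> u)"
        using t by (intro add_mono mult_left_mono) auto
      ultimately show "\<phi> ?z - p \<bullet> ?z \<le> \<phi> u - p \<bullet> u"
        unfolding z by (simp add: inner_add_right algebra_simps)
    qed
    have "((\<lambda>t. g (x + t *\<^sub>R (y - x))) has_vector_derivative H x *v (y - x)) (at 0 within {0..1})"
      using line by (rule has_vector_derivative_at_within)
    moreover have "((\<lambda>t. g (x + t *\<^sub>R (y - x))) has_vector_derivative 0) (at 0 within {0..1})"
      by (rule has_vector_derivative_transform[where f = "\<lambda>t. p"]) (auto simp: gp)
    moreover have "at (0::real) within {0..1} \<noteq> bot"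
      by (simp add: trivial_limit_within islimpt_Icc)
    ultimately have "H x *v (y - x) = 0"
      using vector_derivative_unique_within by blast
    then have "det (H x) = 0"
      using ne by (metis invertible_det_nz matrix_left_invertible_ker invertible_left_inverse
          right_minus_eq)
    then show False using x by (simp add: S_def)
  qed
  have sard: "negligible (g ` (- S))"
  proof (rule baby_Sard[where f' = "\<lambda>x w. H x *v w"])
    fix x assume "x \<in> - S"
    then have "det (H x) = 0" by (simp add: S_def)
    then have "\<not> inj ((*v) (H x))"
      by (metis invertible_det_nz invertible_left_inverse matrix_left_invertible_injective)
    then show "rank (matrix (\<lambda>w. H x *v w)) < CARD(3)"
      using less_rank_noninjective[of "H x"] by (simp add: mat_H)
  qed (use dg in \<open>auto intro: has_derivative_at_withinI\<close>)
  \<comment> \<open>For y in the interior, \<open>\<phi> x - y \<bullet> x\<close> grows at least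
    linearly in \<open>norm x\<close>, so it attains its minimum, and there \<open>g\<close> takes
    the value y.\<close>
  have int_range: "interior A \<subseteq> range g"
  proof
    fix y assume "y \<in> interior A"
    then obtain r where r: "0 < r" "cball y r \<subseteq> A" by (auto simp: mem_interior_cball)
    have grow: "r * norm x - c \<le> \<phi> x - y \<bullet> x" for x
    proof (cases "x = 0")
      case True then show ?thesis using low[of 0] by (simp add: supp_zero[OF A])
    next
      case False
      have "y + (r / norm x) *\<^sub>R x \<in> A"
        using r by (intro subsetD[OF r(2)]) (auto simp: dist_norm False)
      from supp_ge[OF A this, of x] have "x \<bullet> y + r * norm x \<le> supp A x"
        using False by (simp add: inner_add_right dot_square_norm power2_eq_square)
      then show ?thesis using low[of x] by (simp add: inner_commute)
    qed
    \<comment> \<open>Beyond this radius the growth bound is at least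
      \<open>\<bar>\<phi> 0\<bar>\<close>, so a minimum over the ball is global.\<close>
    define R where "R = (\<bar>\<phi> 0\<bar> + \<bar>c\<bar>) / r"
    have R: "0 \<le> R" using r by (simp add: R_def)
    have "continuous_on (cball 0 R) (\<lambda>x. \<phi> x - y \<bullet> x)"
      using d\<phi> by (intro continuous_intros has_derivative_continuous_on[of _ \<phi>])
         (auto intro: has_derivative_at_withinI)
    then obtain x where x: "x \<in> cball 0 R" "\<And>u. u \<in> cball 0 R \<Longrightarrow> \<phi> x - y \<bullet> x \<le> \<phi> u - y \<bullet> u"
      using continuous_attains_inf[of "cball (0 :: real ^ 3) R" "\<lambda>x. \<phi> x - y \<bullet> x"] R by auto
    have "\<phi> x - y \<bullet> x \<le> \<phi> u - y \<bullet> u" for u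
    proof (cases "u \<in> cball 0 R")
      case False
      then have "r * R \<le> r * norm u" using r by simp
      then have "\<bar>\<phi> 0\<bar> \<le> \<phi> u - y \<bullet> u" using grow[of u] r by (simp add: R_def)
      moreover have "\<phi> x - y \<bullet> x \<le> \<phi> 0" using x(2)[of 0] R by simp
      ultimately show ?thesis by simp
    qed (use x in auto)
    then have "g x = y" by (rule critical)
    then show "y \<in> range g" by blast
  qed
  have "negligible (A - g ` S \<union> (g ` S - A))"
  proof (rule negligible_subset)
    show "negligible (frontier A \<union> g ` (- S))"
      using sard negligible_convex_frontier compact_convexD(3)[OF A] by (simp add: negligible_Un)
    show "A - g ` S \<union> (g ` S - A) \<subseteq> frontier A \<union> g ` (- S)"
      using int_range gA closure_subset[of A] by (auto simp: frontier_def)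
  qed
  then have "g ` S \<in> lmeasurable \<and> measure lebesgue (g ` S) = measure lebesgue A"
    using compact_convexD(6)[OF A] lmeasurable_negligible_symdiff measure_negligible_symdiff by blast
  then have "((\<lambda>x. \<bar>det (matrix (\<lambda>w. H x *v w))\<bar>) has_integral measure lebesgue A) S"
    using has_measure_differentiable_image[OF S _ inj, of "\<lambda>x w. H x *v w"] dg
    by (auto intro: has_derivative_at_withinI)
  then have "((\<lambda>x. det (H x)) has_integral measure lebesgue A) S"
    using det_nonneg_of_monotone[OF psd] by (simp add: mat_H)
  then show ?thesis
    by (rule has_integral_on_superset) (auto simp: S_def)
qed

section \<open>Smoothing a support function by a compactly supported kernel\<close>

lemma DERIV_max_0_power:
  "((\<lambda>t::real. (max 0 t) ^ Suc (Suc k)) has_real_derivative real (Suc (Suc k)) * (max 0 t) ^ Suc k) (at t)"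
proof (cases t "0::real" rule: linorder_cases)
  case less
  have "((\<lambda>t::real. 0) has_real_derivative 0) (at t)" by simp
  then have "((\<lambda>t::real. (max 0 t) ^ Suc (Suc k)) has_real_derivative 0) (at t)"
    by (rule has_field_derivative_transform_within_open[where S = "{..<0}"]) (use less in auto)
  then show ?thesis using less by simp
next
  case equal
  have "((\<lambda>h::real. (max 0 h) ^ Suc k) \<longlongrightarrow> (max 0 0) ^ Suc k) (at 0)"
    by (intro tendsto_intros)
  moreover have "\<forall>\<^sub>F h::real in at 0. (max 0 h) ^ Suc k
      = (max 0 (0 + h) ^ Suc (Suc k) - max 0 0 ^ Suc (Suc k)) / h"
    by (auto simp: eventually_at_filter max_def)
  ultimately have "((\<lambda>h::real. (max 0 (0 + h) ^ Suc (Suc k) - max 0 0 ^ Suc (Suc k)) / h) \<longlongrightarrow> 0) (at 0)"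
    using tendsto_cong by force
  then show ?thesis using equal by (simp add: DERIV_def)
next
  case greater
  have "((\<lambda>t::real. t ^ Suc (Suc k)) has_real_derivative real (Suc (Suc k)) * t ^ Suc k) (at t)"
    using DERIV_pow[of "Suc (Suc k)" t] by simp
  then have "((\<lambda>t::real. (max 0 t) ^ Suc (Suc k)) has_real_derivative real (Suc (Suc k)) * t ^ Suc k)
      (at t)"
    by (rule has_field_derivative_transform_within_open[where S = "{0<..}"]) (use greater in auto)
  then show ?thesis using greater by simp
qed

lemma integral_UNIV_eq_if_zero_outside:
  fixes f :: "real ^ 3 \<Rightarrow> 'c::euclidean_space"
  assumes "\<And>z. z \<notin> S \<Longrightarrow> f z = 0"
  shows "integral UNIV f = integral S f"
proof -
  have "f = (\<lambda>z. if z \<in> S then f z else 0)" using assms by auto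
  then show ?thesis by (metis integral_restrict_UNIV)
qed

text \<open>The kernel and its derivative vanish outside the unit ball, so for x within distance 1
  of \<open>x0\<close> the integral over the space is one over a fixed box, where the Leibniz rule
  applies.\<close>

lemma convolution_has_derivative:
  fixes k :: "real ^ 3 \<Rightarrow> 'c::euclidean_space" and k' :: "real ^ 3 \<Rightarrow> ((real ^ 3) \<Rightarrow>\<^sub>L 'c)"
    and h :: "real ^ 3 \<Rightarrow> real"
  assumes h: "continuous_on UNIV h" and k: "\<And>z. (k has_derivative k' z) (at z)"
    and ck': "continuous_on UNIV k'" and k0: "\<And>z. 1 \<le> norm z \<Longrightarrow> k z = 0"
    and k'0: "\<And>z. 1 \<le> norm z \<Longrightarrow> k' z = 0"
  shows "((\<lambda>x. integral UNIV (\<lambda>z. h z *\<^sub>R k (x - z))) has_derivative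
     (\<lambda>w. integral UNIV (\<lambda>z. h z *\<^sub>R k' (x0 - z) w))) (at x0)"
proof -
  obtain a where a: "ball x0 2 \<subseteq> cbox (- a) a"
    using bounded_subset_cbox_symmetric[OF bounded_ball] by blast
  have out: "1 \<le> norm (x - z)" if "x \<in> ball x0 1" "z \<notin> cbox (- a) a" for x z
  proof -
    have "z \<notin> ball x0 2" using a that(2) by blast
    then have "2 \<le> dist x0 z" by simp
    then show ?thesis using that(1) dist_triangle[of x0 z x] by (simp add: dist_norm)
  qed
  have ck: "continuous_on UNIV k"
    using k by (meson has_derivative_at_withinI has_derivative_continuous_on)
  have 1: "((\<lambda>x. integral (cbox (- a) a) (\<lambda>t. h t *\<^sub>R k (x - t))) has_derivative
      integral (cbox (- a) a) (\<lambda>t. h t *\<^sub>R k' (x0 - t))) (at x0 within ball x0 1)"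
  proof (rule leibniz_rule)
    fix x t assume "x \<in> ball x0 1" "t \<in> cbox (- a) a"
    have "((\<lambda>x. k (x - t)) has_derivative k' (x - t)) (at x within ball x0 1)"
      by (rule has_derivative_at_withinI)
         (rule has_derivative_compose[of "\<lambda>x. x - t" "\<lambda>x. x" x UNIV k], auto intro!: derivative_eq_intros k)
    then show "((\<lambda>x. h t *\<^sub>R k (x - t)) has_derivative
        blinfun_apply (h t *\<^sub>R k' (x - t))) (at x within ball x0 1)"
      by (auto intro!: derivative_eq_intros simp: blinfun.scaleR_left)
  next
    fix x
    show "(\<lambda>t. h t *\<^sub>R k (x - t)) integrable_on cbox (- a) a"
      by (intro integrable_continuous continuous_intros continuous_on_subset[OF h]
            continuous_on_compose2[OF ck]) auto
  next
    show "continuous_on (ball x0 1 \<times> cbox (- a) a) (\<lambda>(x, t). h t *\<^sub>R k' (x - t))"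
      unfolding case_prod_beta
      by (intro continuous_intros continuous_on_compose2[OF h] continuous_on_compose2[OF ck']) auto
  qed auto
  have int: "(\<lambda>t. h t *\<^sub>R k' (x0 - t)) integrable_on cbox (- a) a"
    by (intro integrable_continuous continuous_intros continuous_on_subset[OF h]
            continuous_on_compose2[OF ck']) auto
  have 2: "integral (cbox (- a) a) (\<lambda>t. h t *\<^sub>R k' (x0 - t)) w
      = integral UNIV (\<lambda>z. h z *\<^sub>R k' (x0 - z) w)" for w
  proof -
    have "integral UNIV (\<lambda>z. h z *\<^sub>R k' (x0 - z) w) = integral (cbox (- a) a) (\<lambda>z. h z *\<^sub>R k' (x0 - z) w)"
      using k'0[OF out[of x0]] by (intro integral_UNIV_eq_if_zero_outside) auto
    also have "\<dots> = integral (cbox (- a) a) ((\<lambda>L. blinfun_apply L w) \<circ> (\<lambda>t. h t *\<^sub>R k' (x0 - t)))"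
      by (simp add: o_def blinfun.scaleR_left)
    also have "\<dots> = integral (cbox (- a) a) (\<lambda>t. h t *\<^sub>R k' (x0 - t)) w"
      by (rule integral_linear[OF int]) (rule blinfun.bounded_linear_left)
    finally show ?thesis by simp
  qed
  have 3: "((\<lambda>x. integral (cbox (- a) a) (\<lambda>t. h t *\<^sub>R k (x - t))) has_derivative
      (\<lambda>w. integral UNIV (\<lambda>z. h z *\<^sub>R k' (x0 - z) w))) (at x0)"
    using 1 by (simp add: 2[symmetric] at_within_open[of _ "ball x0 1"])
  show ?thesis
  proof (rule has_derivative_transform_within_open[OF 3])
    fix x assume x: "x \<in> ball x0 1"
    show "integral (cbox (- a) a) (\<lambda>t. h t *\<^sub>R k (x - t)) = integral UNIV (\<lambda>z. h z *\<^sub>R k (x - z))"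
      using k0[OF out[OF x]] by (intro integral_UNIV_eq_if_zero_outside[symmetric]) auto
  qed auto
qed

text \<open>The third power makes the kernel twice continuously differentiable across the unit
  sphere. It is not normalised; its mass is the \<open>\<kappa>\<close> of
  \<open>potential_exists\<close>.\<close>

definition bump :: "real ^ 3 \<Rightarrow> real" where
  "bump z = (max 0 (1 - z \<bullet> z)) ^ 3"

definition bump_grad :: "real ^ 3 \<Rightarrow> real ^ 3" where
  "bump_grad z = (- 6 * (max 0 (1 - z \<bullet> z)) ^ 2) *\<^sub>R z"

definition bump_hess :: "real ^ 3 \<Rightarrow> real ^ 3 \<Rightarrow> real ^ 3" where
  "bump_hess z w = (- 6 * (max 0 (1 - z \<bullet> z)) ^ 2) *\<^sub>R w + (24 * max 0 (1 - z \<bullet> z) * (z \<bullet> w)) *\<^sub>R z"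

lemma has_derivative_max_0_power_inner:
  fixes z :: "real ^ 3"
  shows "((\<lambda>z. (max 0 (1 - z \<bullet> z)) ^ Suc (Suc k)) has_derivative
    (\<lambda>w. real (Suc (Suc k)) * (max 0 (1 - z \<bullet> z)) ^ Suc k * (- 2 * (z \<bullet> w)))) (at z)"
  by (rule has_derivative_compose[of "\<lambda>z. 1 - z \<bullet> z" "\<lambda>w. - 2 * (z \<bullet> w)" z UNIV
        "\<lambda>t. max 0 t ^ Suc (Suc k)", OF _ DERIV_max_0_power[unfolded has_field_derivative_def]])
     (auto intro!: derivative_eq_intros simp: inner_commute)

lemma bump_has_derivative: "(bump has_derivative (\<lambda>w. bump_grad z \<bullet> w)) (at z)"
  using has_derivative_max_0_power_inner[of 1 z]
  by (simp add: bump_def[abs_def] bump_grad_def numeral_eq_Suc algebra_simps)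

lemma bump_grad_has_derivative: "(bump_grad has_derivative bump_hess z) (at z)"
proof -
  have d: "((\<lambda>z. (max 0 (1 - z \<bullet> z))\<^sup>2) has_derivative
      (\<lambda>w. 2 * max 0 (1 - z \<bullet> z) * (- 2 * (z \<bullet> w)))) (at z)"
    using has_derivative_max_0_power_inner[of 0 z] by (simp add: numeral_eq_Suc)
  show ?thesis
    unfolding bump_grad_def[abs_def] bump_hess_def[abs_def]
    by (rule has_derivative_eq_rhs[OF has_derivative_scaleR[OF has_derivative_mult_right[OF d]
        has_derivative_ident]])
       (simp add: fun_eq_iff algebra_simps)
qed

lemma bump_base_eq_0: "1 \<le> norm z \<Longrightarrow> max 0 (1 - z \<bullet> z) = 0" for z :: "real ^ 3"
  by (simp add: dot_square_norm)

lemma bounded_linear_bump_hess: "bounded_linear (bump_hess z)"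
  using bump_grad_has_derivative by (rule has_derivative_bounded_linear)

lemma continuous_on_bump: "continuous_on S bump"
  unfolding bump_def[abs_def] by (intro continuous_intros)

lemma bump_nonneg: "0 \<le> bump z"
  by (simp add: bump_def)

lemma bump_convolution_twice_differentiable:
  fixes h :: "real ^ 3 \<Rightarrow> real"
  assumes h: "continuous_on UNIV h"
  obtains g H where "\<And>x. ((\<lambda>x. integral UNIV (\<lambda>z. h z * bump (x - z))) has_derivative (\<lambda>w. g x \<bullet> w)) (at x)"
    "\<And>x. (g has_derivative (\<lambda>w. H x *v w)) (at x)"
proof -
  define g where "g x = integral UNIV (\<lambda>z. h z *\<^sub>R bump_grad (x - z))" for x
  have b1: "blinfun_apply (blinfun_inner_right (bump_grad z)) w = bump_grad z \<bullet> w" for z w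
    by simp
  have int: "(\<lambda>z. h z *\<^sub>R bump_grad (x - z)) integrable_on UNIV" for x
  proof -
    obtain a where a: "ball x 2 \<subseteq> cbox (- a) a"
      using bounded_subset_cbox_symmetric[OF bounded_ball] by blast
    have "(\<lambda>z. h z *\<^sub>R bump_grad (x - z)) integrable_on cbox (- a) a"
      unfolding bump_grad_def
      by (intro integrable_continuous continuous_intros continuous_on_subset[OF h]) auto
    moreover have "h z *\<^sub>R bump_grad (x - z) = 0" if "z \<notin> cbox (- a) a" for z
    proof -
      have "z \<notin> ball x 2" using a that by blast
      then have "2 \<le> dist x z" by simp
      then have "max 0 (1 - (x - z) \<bullet> (x - z)) = 0" by (intro bump_base_eq_0) (simp add: dist_norm)
      then show ?thesis by (simp add: bump_grad_def)
    qed
    ultimately show ?thesis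
      by (rule integrable_on_superset) auto
  qed
  have "((\<lambda>x. integral UNIV (\<lambda>z. h z *\<^sub>R bump (x - z))) has_derivative
     (\<lambda>w. integral UNIV (\<lambda>z. h z *\<^sub>R blinfun_inner_right (bump_grad (x0 - z)) w))) (at x0)" for x0
  proof (rule convolution_has_derivative[OF h])
    show "continuous_on UNIV (\<lambda>z. blinfun_inner_right (bump_grad z))"
      unfolding bump_grad_def[abs_def] by (intro continuous_intros)
    show "bump z = 0" "blinfun_inner_right (bump_grad z) = 0" if "1 \<le> norm z" for z
      using bump_base_eq_0[OF that] by (auto simp: bump_def bump_grad_def intro!: blinfun_eqI)
  qed (use bump_has_derivative in simp)
  moreover have "integral UNIV (\<lambda>z. h z *\<^sub>R blinfun_inner_right (bump_grad (x - z)) w) = g x \<bullet> w" for x w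
    using integral_linear[OF int bounded_linear_inner_left[of w], of x]
    by (simp add: g_def o_def)
  ultimately have 1: "((\<lambda>x. integral UNIV (\<lambda>z. h z * bump (x - z)))
      has_derivative (\<lambda>w. g x \<bullet> w)) (at x)" for x
    by simp
  have app: "blinfun_apply (Blinfun (bump_hess z)) = bump_hess z" for z
    by (rule bounded_linear_Blinfun_apply[OF bounded_linear_bump_hess])
  have 2: "\<exists>M::real ^ 3 ^ 3. (g has_derivative (\<lambda>w. M *v w)) (at x)" for x
  proof -
    have "(g has_derivative (\<lambda>w. integral UNIV (\<lambda>z. h z *\<^sub>R Blinfun (bump_hess (x - z)) w))) (at x)"
      unfolding g_def[abs_def]
    proof (rule convolution_has_derivative[OF h])
      show "continuous_on UNIV (\<lambda>z. Blinfun (bump_hess z))"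
        by (rule continuous_on_blinfun_componentwise)
           (auto simp: app bump_hess_def intro!: continuous_intros)
      show "bump_grad z = 0" "Blinfun (bump_hess z) = 0" if "1 \<le> norm z" for z
        using bump_base_eq_0[OF that] by (auto simp: bump_grad_def app bump_hess_def intro!: blinfun_eqI)
    qed (simp add: app bump_grad_has_derivative)
    then obtain f where f: "(g has_derivative f) (at x)" by blast
    then have "linear f" by (metis has_derivative_bounded_linear bounded_linear.linear)
    then have "(\<lambda>w. matrix f *v w) = f" by (simp add: matrix_works fun_eq_iff)
    then show ?thesis using f by (intro exI[of _ "matrix f"]) simp
  qed
  define H where "H x = (SOME M::real ^ 3 ^ 3. (g has_derivative (\<lambda>w. M *v w)) (at x))" for x
  have "(g has_derivative (\<lambda>w. H x *v w)) (at x)" for x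
    unfolding H_def using someI_ex[OF 2[of x]] .
  with 1 show ?thesis using that by blast
qed

text \<open>Differentiation needs the variable x in the kernel; convexity and the comparison with
  \<open>supp A\<close> need it in \<open>h\<close>. The substitution of x - z for z moves
  it.\<close>

lemma bump_convolution_reflect:
  fixes h :: "real ^ 3 \<Rightarrow> real"
  assumes h: "continuous_on UNIV h"
  shows "integral UNIV (\<lambda>z. h z * bump (x - z)) = integral (cbox (- 1) 1) (\<lambda>z. h (x - z) * bump z)"
proof -
  let ?F = "\<lambda>z. h (x - z) * bump z"
  have "?F integrable_on cbox (- 1) 1"
    by (intro integrable_continuous continuous_intros continuous_on_compose2[OF h] continuous_on_bump) auto
  then have "(?F has_integral integral (cbox (- 1) 1) ?F) (cbox (- 1) 1)"
    by (rule integrable_integral)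
  from has_integral_affinity[OF this, of "- 1" x]
  have "((\<lambda>z. h z * bump (x - z)) has_integral integral (cbox (- 1) 1) ?F) ((\<lambda>z. x - z) ` cbox (- 1) 1)"
    by (simp add: algebra_simps image_def)
  moreover have "h z * bump (x - z) = 0" if "z \<notin> (\<lambda>z. x - z) ` cbox (- 1) 1" for z
  proof -
    have "z = x - (x - z)" by simp
    then have "x - z \<notin> cbox (- 1) 1" using that by (metis image_eqI)
    then obtain i where "(x - z) $ i < - 1 \<or> 1 < (x - z) $ i"
      by (auto simp: mem_box_cart not_le)
    then have "1 < \<bar>(x - z) $ i\<bar>" by linarith
    then have "1 \<le> norm (x - z)" using component_le_norm_cart[of "x - z" i] by linarith
    then show ?thesis using bump_base_eq_0[of "x - z"] by (simp add: bump_def)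
  qed
  ultimately have "((\<lambda>z. h z * bump (x - z)) has_integral integral (cbox (- 1) 1) ?F) UNIV"
    by (rule has_integral_on_superset) auto
  then show ?thesis by (rule integral_unique)
qed

text \<open>The potential is the support function averaged with the bump kernel. Averaging keeps
  convexity and, as \<open>incr\<close>, subadditivity, which bounds the derivative in direction w
  by \<open>supp A w\<close> and so puts the gradient into A. Since \<open>supp A\<close> is
  R-Lipschitz and the kernel lives in the unit ball, the average drops at most R below
  \<open>supp A\<close>.\<close>

lemma potential_exists:
  assumes A: "compact_convex A"
  shows "\<exists>H. potential A H"
proof -
  define \<kappa> where "\<kappa> = integral (cbox (- 1) 1) bump"
  have \<kappa>: "(bump has_integral \<kappa>) (cbox (- 1) 1)"
    unfolding \<kappa>_def by (intro integrable_integral integrable_continuous continuous_on_bump)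
  have box0: "(0 :: real ^ 3) \<in> box (- 1) 1" by (simp add: mem_box_cart)
  have "0 \<le> \<kappa>" using \<kappa> by (rule has_integral_nonneg) (simp add: bump_nonneg)
  moreover have "\<kappa> \<noteq> 0"
  proof
    assume "\<kappa> = 0"
    then have "bump 0 = 0"
      using has_integral_0_cbox_imp_0[OF continuous_on_bump _ \<kappa>[unfolded \<open>\<kappa> = 0\<close>], of 0] box0
      by (auto simp: bump_nonneg dest: subsetD[OF box_subset_cbox])
    then show False by (simp add: bump_def)
  qed
  ultimately have \<kappa>_pos: "0 < \<kappa>" by simp
  let ?h = "supp A"
  obtain R where R: "0 < R" "\<And>a. a \<in> A \<Longrightarrow> norm a \<le> R"
    using compact_convex_norm_bound[OF A] by metis
  obtain g H where g: "\<And>x. ((\<lambda>x. integral UNIV (\<lambda>z. ?h z * bump (x - z)))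
      has_derivative (\<lambda>w. g x \<bullet> w)) (at x)"
    and H: "\<And>x. (g has_derivative (\<lambda>w. H x *v w)) (at x)"
    using bump_convolution_twice_differentiable[OF continuous_on_supp[OF A]] by blast
  define \<phi> where "\<phi> x = integral UNIV (\<lambda>z. ?h z * bump (x - z)) / \<kappa>" for x
  have \<phi>: "((\<lambda>z. ?h (x - z) * bump z) has_integral \<kappa> * \<phi> x) (cbox (- 1) 1)" for x
  proof -
    have "(\<lambda>z. ?h (x - z) * bump z) integrable_on (cbox (- 1) 1)"
      by (intro integrable_continuous continuous_intros continuous_on_bump
            continuous_on_compose2[OF continuous_on_supp[OF A]]) auto
    moreover have "integral (cbox (- 1) 1) (\<lambda>z. ?h (x - z) * bump z) = \<kappa> * \<phi> x"
      using bump_convolution_reflect[OF continuous_on_supp[OF A], of x] \<kappa>_pos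
      by (simp add: \<phi>_def)
    ultimately show ?thesis by (metis integrable_integral)
  qed
  have d\<phi>: "(\<phi> has_derivative (\<lambda>w. (g x /\<^sub>R \<kappa>) \<bullet> w)) (at x)" for x
    unfolding \<phi>_def[abs_def] divide_inverse
    by (rule has_derivative_eq_rhs[OF has_derivative_mult_left[OF g]]) (simp add: mult.commute)
  have dg: "((\<lambda>x. g x /\<^sub>R \<kappa>) has_derivative (\<lambda>w. (H x /\<^sub>R \<kappa>) *v w)) (at x)" for x
    by (rule has_derivative_eq_rhs[OF has_derivative_scaleR_right[OF H]])
       (simp add: scaleR_matrix_vector_assoc)
  have incr: "\<phi> (x + w) \<le> \<phi> x + ?h w" for x w
  proof -
    have "((\<lambda>z. ?h (x - z) * bump z + ?h w * bump z) has_integral (\<kappa> * \<phi> x + ?h w * \<kappa>)) (cbox (- 1) 1)"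
      by (intro has_integral_add \<phi> has_integral_mult_right \<kappa>)
    moreover have "?h ((x + w) - z) * bump z \<le> ?h (x - z) * bump z + ?h w * bump z" for z
      using mult_right_mono[OF supp_add_le[OF A, of "x - z" w] bump_nonneg[of z]]
      by (simp add: algebra_simps)
    ultimately have "\<kappa> * \<phi> (x + w) \<le> \<kappa> * \<phi> x + ?h w * \<kappa>"
      using has_integral_le[OF \<phi>[of "x + w"]] by blast
    then have "\<kappa> * \<phi> (x + w) \<le> \<kappa> * (\<phi> x + ?h w)" by (simp add: algebra_simps)
    then show ?thesis using \<kappa>_pos by simp
  qed
  have grad: "g x /\<^sub>R \<kappa> \<in> A" for x
    unfolding mem_iff_supp[OF A]
  proof
    fix w
    have "((\<lambda>t. \<phi> (x + t *\<^sub>R w)) has_derivative (\<lambda>t. (g x /\<^sub>R \<kappa>) \<bullet> (t *\<^sub>R w))) (at 0)"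
      by (rule has_derivative_compose[of "\<lambda>t. x + t *\<^sub>R w" "\<lambda>t. t *\<^sub>R w" 0 UNIV \<phi>])
         (use d\<phi>[of x] in \<open>auto intro!: derivative_eq_intros\<close>)
    then have "((\<lambda>t. \<phi> (x + t *\<^sub>R w)) has_real_derivative (g x /\<^sub>R \<kappa>) \<bullet> w) (at 0)"
      unfolding has_field_derivative_def by (rule has_derivative_eq_rhs) (simp add: fun_eq_iff mult.commute)
    then have d: "((\<lambda>t. t * ?h w - \<phi> (x + t *\<^sub>R w)) has_real_derivative ?h w - (g x /\<^sub>R \<kappa>) \<bullet> w) (at 0)"
      by (auto intro!: derivative_eq_intros)
    have "mono_on UNIV (\<lambda>t. t * ?h w - \<phi> (x + t *\<^sub>R w))"
    proof (rule mono_onI)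
      fix a b :: real assume ab: "a \<le> b"
      have "\<phi> (x + b *\<^sub>R w) \<le> \<phi> (x + a *\<^sub>R w) + (b - a) * ?h w"
      proof -
        have "x + a *\<^sub>R w + (b - a) *\<^sub>R w = x + b *\<^sub>R w" by (simp add: algebra_simps)
        then show ?thesis
          using incr[of "x + a *\<^sub>R w" "(b - a) *\<^sub>R w"] ab
          unfolding supp_scaleR[OF A, of "b - a", simplified, OF ab]
          by metis
      qed
      then show "a * ?h w - \<phi> (x + a *\<^sub>R w) \<le> b * ?h w - \<phi> (x + b *\<^sub>R w)"
        by (simp add: algebra_simps)
    qed
    from mono_on_imp_deriv_nonneg[OF this d] show "w \<bullet> (g x /\<^sub>R \<kappa>) \<le> ?h w"
      by (simp add: inner_commute)
  qed
  have low: "?h x - R \<le> \<phi> x" for x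
  proof -
    have "((\<lambda>z. (?h x - R) * bump z) has_integral (?h x - R) * \<kappa>) (cbox (- 1) 1)"
      by (intro has_integral_mult_right \<kappa>)
    moreover have "(?h x - R) * bump z \<le> ?h (x - z) * bump z" for z
    proof (cases "1 \<le> norm z")
      case True then show ?thesis using bump_base_eq_0[of z] by (simp add: bump_def)
    next
      case False
      have "?h x - ?h (x - z) \<le> R * norm z"
        using supp_diff_le[OF A R(2), of x "x - z"] by simp
      also have "\<dots> \<le> R" using False R(1) by simp
      finally show ?thesis using bump_nonneg by (intro mult_right_mono) auto
    qed
    ultimately have "(?h x - R) * \<kappa> \<le> \<kappa> * \<phi> x"
      using has_integral_le[OF _ \<phi>[of x]] by blast
    then show ?thesis using \<kappa>_pos by (simp add: mult.commute)
  qed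
  have conv: "convex_on UNIV \<phi>"
  proof (rule convex_onI)
    fix t :: real and x y :: "real ^ 3" assume t: "0 < t" "t < 1"
    let ?u = "(1 - t) *\<^sub>R x + t *\<^sub>R y"
    have "((\<lambda>z. (1 - t) * (?h (x - z) * bump z) + t * (?h (y - z) * bump z)) has_integral
        ((1 - t) * (\<kappa> * \<phi> x) + t * (\<kappa> * \<phi> y))) (cbox (- 1) 1)"
      by (intro has_integral_add has_integral_mult_right \<phi>)
    moreover have "?h (?u - z) * bump z \<le> (1 - t) * (?h (x - z) * bump z) + t * (?h (y - z) * bump z)" for z
    proof -
      have "?u - z = (1 - t) *\<^sub>R (x - z) + t *\<^sub>R (y - z)" by (simp add: algebra_simps)
      then have "?h (?u - z) \<le> (1 - t) * ?h (x - z) + t * ?h (y - z)"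
        using supp_add_le[OF A, of "(1 - t) *\<^sub>R (x - z)" "t *\<^sub>R (y - z)"] t
        by (simp add: supp_scaleR[OF A])
      from mult_right_mono[OF this bump_nonneg[of z]] show ?thesis by (simp add: algebra_simps)
    qed
    ultimately have "\<kappa> * \<phi> ?u \<le> (1 - t) * (\<kappa> * \<phi> x) + t * (\<kappa> * \<phi> y)"
      using has_integral_le[OF \<phi>[of ?u]] by blast
    then have "\<kappa> * \<phi> ?u \<le> \<kappa> * ((1 - t) * \<phi> x + t * \<phi> y)" by (simp add: algebra_simps)
    then show "\<phi> ?u \<le> (1 - t) * \<phi> x + t * \<phi> y" using \<kappa>_pos by simp
  qed simp
  show ?thesis
    unfolding potential_def
    by (intro exI[of _ "\<lambda>x. H x /\<^sub>R \<kappa>"] exI[of _ \<phi>] exI[of _ "\<lambda>x. g x /\<^sub>R \<kappa>"] exI[of _ R] conjI allI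
          d\<phi> dg grad low conv)
qed

section \<open>Mixed volumes\<close>

abbreviation vol :: "(real ^ 3) set \<Rightarrow> real" where
  "vol \<equiv> measure lebesgue"

lemma potential_plus:
  assumes "compact_convex A" "compact_convex B" "potential A H" "potential B H'"
  shows "potential (A + B) (\<lambda>x. H x + H' x)"
  using potential_comb[OF assms, of 1 1] by simp

text \<open>
  The products are hidden in constants because the expansion of the determinants into monomials is
  too large for the simplifier.
\<close>

definition triple_prod :: "real \<Rightarrow> real \<Rightarrow> real \<Rightarrow> real" where
  "triple_prod x y z = x * y * z"

text \<open>The part of the product of three sums \<open>a + c + d\<close> in which each letter
  occurs once, that is, the full polarization of the product.\<close>

definition triple_mixed :: "real \<Rightarrow> real \<Rightarrow> real \<Rightarrow> real \<Rightarrow> real \<Rightarrow> real \<Rightarrow> real \<Rightarrow> real \<Rightarrow> real \<Rightarrow> real" where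
  "triple_mixed a1 a2 a3 c1 c2 c3 d1 d2 d3 = a1*(c2*d3+d2*c3) + a2*(c1*d3+d1*c3) + a3*(c1*d2+d1*c2)"

lemma triple_prod_polarization:
  "triple_prod (a1+c1+d1) (a2+c2+d2) (a3+c3+d3) =
      triple_mixed a1 a2 a3 c1 c2 c3 d1 d2 d3
    + triple_prod (a1+c1) (a2+c2) (a3+c3) + triple_prod (a1+d1) (a2+d2) (a3+d3)
    + triple_prod (c1+d1) (c2+d2) (c3+d3)
    - triple_prod a1 a2 a3 - triple_prod c1 c2 c3 - triple_prod d1 d2 d3"
  unfolding triple_prod_def triple_mixed_def by algebra

lemma triple_mixed_linear:
  "triple_mixed (s*a1+t*e1) (s*a2+t*e2) (s*a3+t*e3) c1 c2 c3 d1 d2 d3 =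
    s * triple_mixed a1 a2 a3 c1 c2 c3 d1 d2 d3 + t * triple_mixed e1 e2 e3 c1 c2 c3 d1 d2 d3"
  unfolding triple_mixed_def by (simp add: distrib_left distrib_right mult.assoc)

lemma det_3_triple_prod:
  "det (A :: real ^ 3 ^ 3) =
      triple_prod (A$1$1) (A$2$2) (A$3$3) + triple_prod (A$1$2) (A$2$3) (A$3$1)
    + triple_prod (A$1$3) (A$2$1) (A$3$2) - triple_prod (A$1$1) (A$2$3) (A$3$2)
    - triple_prod (A$1$2) (A$2$1) (A$3$3) - triple_prod (A$1$3) (A$2$2) (A$3$1)"
  by (simp add: det_3 triple_prod_def)

lemma det_polarization:
  fixes M N L :: "real ^ 3 ^ 3"
  shows "det (M + N + L) - det (M + N) - det (M + L) - det (N + L) + det M + det N + det L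
    = triple_mixed (M$1$1) (M$2$2) (M$3$3) (N$1$1) (N$2$2) (N$3$3) (L$1$1) (L$2$2) (L$3$3)
    + triple_mixed (M$1$2) (M$2$3) (M$3$1) (N$1$2) (N$2$3) (N$3$1) (L$1$2) (L$2$3) (L$3$1)
    + triple_mixed (M$1$3) (M$2$1) (M$3$2) (N$1$3) (N$2$1) (N$3$2) (L$1$3) (L$2$1) (L$3$2)
    - triple_mixed (M$1$1) (M$2$3) (M$3$2) (N$1$1) (N$2$3) (N$3$2) (L$1$1) (L$2$3) (L$3$2)
    - triple_mixed (M$1$2) (M$2$1) (M$3$3) (N$1$2) (N$2$1) (N$3$3) (L$1$2) (L$2$1) (L$3$3)
    - triple_mixed (M$1$3) (M$2$2) (M$3$1) (N$1$3) (N$2$2) (N$3$1) (L$1$3) (L$2$2) (L$3$1)"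
  unfolding det_3_triple_prod vector_add_component triple_prod_polarization by simp

lemma det_polarization_linear:
  fixes M M' N L :: "real ^ 3 ^ 3"
  shows "det (s *\<^sub>R M + t *\<^sub>R M' + N + L) - det (s *\<^sub>R M + t *\<^sub>R M' + N) - det (s *\<^sub>R M + t *\<^sub>R M' + L)
      - det (N + L) + det (s *\<^sub>R M + t *\<^sub>R M') + det N + det L
    = s * (det (M + N + L) - det (M + N) - det (M + L) - det (N + L) + det M + det N + det L)
    + t * (det (M' + N + L) - det (M' + N) - det (M' + L) - det (N + L) + det M' + det N + det L)"
  unfolding det_polarization vector_add_component vector_scaleR_component real_scaleR_def
      triple_mixed_linear
  by (simp add: distrib_left right_diff_distrib)

text \<open>Six times the mixed volume by the polarization formula, available before a mixed volume
  is known to exist.\<close>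

definition polar_vol :: "(real ^ 3) set \<Rightarrow> (real ^ 3) set \<Rightarrow> (real ^ 3) set \<Rightarrow> real" where
  "polar_vol A B C = vol (A + B + C) - vol (A + B) - vol (A + C) - vol (B + C) + vol A + vol B + vol C"

text \<open>All seven volumes are integrals, over the whole space, of determinants of sums of the
  same Hessians, so the claim is \<open>det_polarization_linear\<close> integrated.\<close>

lemma polar_vol_linear:
  assumes A: "compact_convex A" and A': "compact_convex A'" and B: "compact_convex B"
    and C: "compact_convex C"
    and st: "0 \<le> s" "0 \<le> t"
  shows "polar_vol (s \<cdot> A + t \<cdot> A') B C = s * polar_vol A B C + t * polar_vol A' B C"
proof -
  obtain M M' N L where p: "potential A M" "potential A' M'" "potential B N" "potential C L"
    using potential_exists A A' B C by metis
  let ?S = "s \<cdot> A + t \<cdot> A'" and ?T = "\<lambda>x. s *\<^sub>R M x + t *\<^sub>R M' x"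
  have S: "compact_convex ?S" and pS: "potential ?S ?T"
    using A A' p st by (auto intro: compact_convex_comb potential_comb)
  have int: "((\<lambda>x. det (H x + N x + L x) - det (H x + N x) - det (H x + L x) - det (N x + L x)
      + det (H x) + det (N x) + det (L x)) has_integral polar_vol X B C) UNIV"
    if X: "compact_convex X" and H: "potential X H" for X H
    unfolding polar_vol_def
    using X B C H p
    by (intro has_integral_add has_integral_diff potential_det_has_integral potential_plus
        compact_convex_plus)
  have "((\<lambda>x. s * (det (M x + N x + L x) - det (M x + N x) - det (M x + L x) - det (N x + L x)
      + det (M x) + det (N x) + det (L x))
      + t * (det (M' x + N x + L x) - det (M' x + N x) - det (M' x + L x) - det (N x + L x)
      + det (M' x) + det (N x) + det (L x))) has_integral s * polar_vol A B C + t * polar_vol A' B C) UNIV"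
    by (intro has_integral_add has_integral_mult_right int A A' p)
  then show ?thesis
    using int[OF S pS] has_integral_unique unfolding det_polarization_linear by blast
qed

lemma vol_scaled: "0 \<le> s \<Longrightarrow> vol (s \<cdot> A) = s ^ 3 * vol A"
  using measure_lebesgue_affine[of s 0 A] by simp

lemma polar_vol_diagonal:
  assumes A: "compact_convex A"
  shows "polar_vol A A A = 6 * vol A"
proof -
  have 2: "A + A = 2 \<cdot> A" using scaled_add[OF A, of 1 1] by simp
  then have "A + A + A = 3 \<cdot> A" using scaled_add[OF A, of 2 1] by simp
  with 2 show ?thesis by (simp add: polar_vol_def vol_scaled)
qed

lemma mixed_volume_functional_mixed_volume: "mixed_volume_functional mixed_volume"
proof -
  define V where "V A B C = (if compact_convex A \<and> compact_convex B \<and> compact_convex C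
    then polar_vol A B C / 6 else 0)" for A B C
  have "mixed_volume_functional V"
    unfolding mixed_volume_functional_def
  proof (intro conjI allI impI; (elim conjE)?)
    fix A B C assume "compact_convex A" "compact_convex B" "compact_convex C"
    then show "V A B C = V B A C" "V A B C = V A C B"
      by (simp_all add: V_def polar_vol_def add_ac)
  next
    fix A A' B C and s t :: real
    assume "compact_convex A" "compact_convex A'" "compact_convex B" "compact_convex C" "0 \<le> s" "0 \<le> t"
    then show "V (s \<cdot> A + t \<cdot> A') B C = s * V A B C + t * V A' B C"
      by (simp add: V_def polar_vol_linear compact_convex_comb field_simps)
  next
    fix A assume "compact_convex A"
    then show "V A A A = vol A" by (simp add: V_def polar_vol_diagonal)
  next
    fix A B C assume "\<not> (compact_convex A \<and> compact_convex B \<and> compact_convex C)"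
    then show "V A B C = 0" unfolding V_def by (rule if_not_P)
  qed
  then have "mixed_volume = V"
    unfolding mixed_volume_def by (intro the_equality mixed_volume_functional_unique)
  with \<open>mixed_volume_functional V\<close> show ?thesis by simp
qed

abbreviation "MV \<equiv> mixed_volume"

lemma mixed_volume_commute:
  assumes "compact_convex A" "compact_convex B" "compact_convex C"
  shows "MV A B C = MV B A C" "MV A B C = MV A C B"
proof -
  have "\<forall>A B C. compact_convex A \<and> compact_convex B \<and> compact_convex C \<longrightarrow> MV A B C = MV B A C \<and> MV A B C
      = MV A C B"
    using mixed_volume_functional_mixed_volume unfolding mixed_volume_functional_def by (rule conjunct1)
  with assms show "MV A B C = MV B A C" "MV A B C = MV A C B" by simp_all
qed

lemma mixed_volume_diagonal: "compact_convex A \<Longrightarrow> MV A A A = vol A"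
  using mixed_volume_functional_mixed_volume unfolding mixed_volume_functional_def by blast

lemma mixed_volume_comb1:
  assumes "compact_convex A" "compact_convex A'" "compact_convex B" "compact_convex C" "0 \<le> s" "0 \<le> t"
  shows "MV (s \<cdot> A + t \<cdot> A') B C = s * MV A B C + t * MV A' B C"
  using mixed_volume_functional_mixed_volume assms unfolding mixed_volume_functional_def by blast

lemma mixed_volume_plus1:
  assumes "compact_convex A" "compact_convex A'" "compact_convex B" "compact_convex C"
  shows "MV (A + A') B C = MV A B C + MV A' B C"
  using mixed_volume_comb1[OF assms, of 1 1] by simp

lemma mixed_volume_scaled1:
  assumes "compact_convex A" "compact_convex B" "compact_convex C" "0 \<le> s"
  shows "MV (s \<cdot> A) B C = s * MV A B C"
proof -
  have "s \<cdot> A + 0 \<cdot> A = s \<cdot> A" using scaled_add[of A s 0] assms by simp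
  then show ?thesis using mixed_volume_comb1[of A A B C s 0] assms by simp
qed

lemma mixed_volume_plus2:
  assumes "compact_convex A" "compact_convex B" "compact_convex B'" "compact_convex C"
  shows "MV A (B + B') C = MV A B C + MV A B' C"
  using mixed_volume_plus1[of B B' A C] assms
  by (simp add: mixed_volume_commute(1)[of A] compact_convex_plus)

lemma mixed_volume_scaled2:
  assumes "compact_convex A" "compact_convex B" "compact_convex C" "0 \<le> s"
  shows "MV A (s \<cdot> B) C = s * MV A B C"
  using mixed_volume_scaled1[of B A C s] assms
  by (simp add: mixed_volume_commute(1)[of A] compact_convex_scaled)

lemma mixed_volume_plus3:
  assumes "compact_convex A" "compact_convex B" "compact_convex C" "compact_convex C'"
  shows "MV A B (C + C') = MV A B C + MV A B C'"
  using mixed_volume_plus2[of A C C' B] assms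
  by (simp add: mixed_volume_commute(2)[of A] compact_convex_plus)

lemma mixed_volume_scaled3:
  assumes "compact_convex A" "compact_convex B" "compact_convex C" "0 \<le> s"
  shows "MV A B (s \<cdot> C) = s * MV A B C"
  using mixed_volume_scaled2[of A C B s] assms
  by (simp add: mixed_volume_commute(2)[of A] compact_convex_scaled)

lemmas mixed_volume_linear =
  mixed_volume_plus1 mixed_volume_plus2 mixed_volume_plus3
  mixed_volume_scaled1 mixed_volume_scaled2 mixed_volume_scaled3

lemma vol_plus:
  assumes A: "compact_convex A" and B: "compact_convex B"
  shows "vol (A + B) = vol A + 3 * MV A A B + 3 * MV A B B + vol B"
proof -
  have sym: "MV A B A = MV A A B" "MV B A A = MV A A B" "MV B A B = MV A B B" "MV B B A = MV A B B"
    using A B mixed_volume_commute by metis+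
  have "MV (A + B) (A + B) (A + B) = MV A A A + 3 * MV A A B + 3 * MV A B B + MV B B B"
    using A B by (simp add: mixed_volume_linear compact_convex_plus sym)
  then show ?thesis
    using A B by (simp add: mixed_volume_diagonal compact_convex_plus)
qed

lemma vol_comb:
  assumes "compact_convex A" "compact_convex B" "0 \<le> s" "0 \<le> t"
  shows "vol (s \<cdot> A + t \<cdot> B) = s ^ 3 * vol A + 3 * s\<^sup>2 * t * MV A A B + 3 * s * t\<^sup>2 * MV A B B
      + t ^ 3 * vol B"
  using assms
  by (simp add: vol_plus compact_convex_scaled vol_scaled mixed_volume_linear power2_eq_square)

lemma vol_mono: "compact_convex A \<Longrightarrow> compact_convex B \<Longrightarrow> A \<subseteq> B \<Longrightarrow> vol A \<le> vol B"
  by (simp add: compact_convexD(6) measure_mono_fmeasurable fmeasurableD)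

section \<open>Comparing coefficients, and monotonicity of mixed volumes\<close>

lemma nonneg_at_0_of_quadratic:
  fixes a b c :: real
  assumes "\<And>s. 0 < s \<Longrightarrow> s \<le> 1 \<Longrightarrow> 0 \<le> a + b * s + c * s\<^sup>2"
  shows "0 \<le> a"
proof (rule tendsto_lowerbound[of "\<lambda>s. a + b * s + c * s\<^sup>2" a "at_right 0"])
  have "((\<lambda>s. a + b * s + c * s\<^sup>2) \<longlongrightarrow> a + b * 0 + c * 0\<^sup>2) (at_right 0)"
    by (intro tendsto_intros)
  then show "((\<lambda>s. a + b * s + c * s\<^sup>2) \<longlongrightarrow> a) (at_right 0)" by simp
  show "\<forall>\<^sub>F s in at_right 0. 0 \<le> a + b * s + c * s\<^sup>2"
    using assms by (intro eventually_at_rightI[of 0 1]) auto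
qed simp

lemma nonneg_leading_of_quadratic:
  fixes a b c :: real
  assumes "\<And>s. 0 < s \<Longrightarrow> 0 \<le> a + b * s + c * s\<^sup>2"
  shows "0 \<le> c"
proof (rule nonneg_at_0_of_quadratic[of _ b a])
  fix s :: real assume s: "0 < s"
  have "0 \<le> s\<^sup>2 * (a + b * (1 / s) + c * (1 / s)\<^sup>2)"
    using assms[of "1 / s"] s by simp
  also have "\<dots> = c + b * s + a * s\<^sup>2"
    using s by (simp add: field_simps power2_eq_square)
  finally show "0 \<le> c + b * s + a * s\<^sup>2" .
qed

lemma nonneg_slope_of_linear:
  fixes a b :: real
  assumes "\<And>s. 0 < s \<Longrightarrow> 0 \<le> a + b * s"
  shows "0 \<le> b"
proof (rule nonneg_leading_of_quadratic[of 0 a])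
  fix s :: real assume "0 < s"
  then show "0 \<le> 0 + a * s + b * s\<^sup>2"
    using mult_left_mono[OF assms[of s], of s] by (simp add: algebra_simps power2_eq_square)
qed

lemma mixed_volume_rotate:
  assumes "compact_convex A" "compact_convex B" "compact_convex C"
  shows "MV A B C = MV B C A" "MV A B C = MV C A B"
  using mixed_volume_commute assms by metis+

lemma vol_plus_scaled:
  assumes "compact_convex B" "compact_convex A" "0 \<le> s"
  shows "vol (B + s \<cdot> A) = vol B + 3 * s * MV B B A + 3 * s\<^sup>2 * MV B A A + s ^ 3 * vol A"
  using vol_comb[OF assms(1,2), of 1 s] assms(3) by simp

lemma vol_scaled_plus:
  assumes "compact_convex K" "compact_convex U" "0 \<le> s"
  shows "vol (s \<cdot> K + U) = s ^ 3 * vol K + 3 * s\<^sup>2 * MV K K U + 3 * s * MV K U U + vol U"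
  using vol_comb[OF assms(1,2), of s 1] assms(3) by simp

text \<open>Compare the terms linear in s of the volumes of \<open>B + s \<cdot> A\<close> and
  \<open>B + s \<cdot> A'\<close>.\<close>

lemma mixed_volume_mono:
  assumes A: "compact_convex A" and A': "compact_convex A'" and B: "compact_convex B" and sub: "A \<subseteq> A'"
  shows "MV A B B \<le> MV A' B B"
proof -
  have "0 \<le> 3 * (MV A' B B - MV A B B) + 3 * (MV B A' A' - MV B A A) * s + (vol A' - vol A) * s\<^sup>2"
    if s: "0 < s" for s
  proof -
    have "B + s \<cdot> A \<subseteq> B + s \<cdot> A'"
      by (intro set_plus_mono2 image_mono sub) simp
    then have "vol (B + s \<cdot> A) \<le> vol (B + s \<cdot> A')"
      using A A' B by (intro vol_mono compact_convex_intros)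
    then have "0 \<le> 3 * s * (MV B B A' - MV B B A) + 3 * s\<^sup>2 * (MV B A' A' - MV B A A)
        + s ^ 3 * (vol A' - vol A)"
      using A A' B s by (simp add: vol_plus_scaled right_diff_distrib)
    also have "\<dots> = s * (3 * (MV B B A' - MV B B A) + 3 * (MV B A' A' - MV B A A) * s
        + (vol A' - vol A) * s\<^sup>2)"
      by (simp add: algebra_simps power2_eq_square power3_eq_cube)
    finally show ?thesis
      using s A A' B by (simp add: zero_le_mult_iff mixed_volume_rotate(2)[of B B])
  qed
  then have "0 \<le> 3 * (MV A' B B - MV A B B)"
    by (rule nonneg_at_0_of_quadratic)
  then show ?thesis by simp
qed

lemma vol_plus_singleton: "vol (A + {x}) = vol A"
proof -
  have "A + {x} = (+) x ` A" by (auto simp: set_plus_def add.commute)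
  then show ?thesis by (simp add: measure_translation)
qed

lemma vol_singleton: "vol {x} = 0"
  by (simp add: negligible_imp_measure0)

text \<open>Adding a point does not change a volume, which gives the case B = C; applied to B + C it
  yields the mixed term.\<close>

lemma mixed_volume_singleton:
  assumes B: "compact_convex B" and C: "compact_convex C"
  shows "MV {x} B C = 0"
proof -
  have *: "MV {x} B B = 0" if B: "compact_convex B" for B
  proof -
    have eq: "MV B B {x} * 3 + (3 * MV B {x} {x}) * s = 0" if s: "0 < s" for s
    proof -
      have "vol (B + s \<cdot> {x}) = vol B"
        using vol_plus_singleton[of B "s *\<^sub>R x"] by simp
      then have "s * (MV B B {x} * 3 + (3 * MV B {x} {x}) * s) = 0"
        using vol_plus_scaled[OF B compact_convex_singleton, of s x] s
        by (simp add: vol_singleton algebra_simps power2_eq_square)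
      then show ?thesis using s by simp
    qed
    from eq[of 1] eq[of 2] have "MV B B {x} = 0" by simp
    then show ?thesis using B by (simp add: mixed_volume_rotate(1)[of "{x}"] compact_convex_singleton)
  qed
  have "MV {x} (B + C) (B + C) = 0" using B C by (simp add: * compact_convex_plus)
  then have "MV {x} B B + MV {x} B C + (MV {x} C B + MV {x} C C) = 0"
    using B C by (simp add: mixed_volume_linear compact_convex_intros)
  then show ?thesis
    using B C mixed_volume_commute(2)[of "{x}" C B] by (simp add: * compact_convex_singleton)
qed

lemma mixed_volume_translate:
  assumes "compact_convex A" "compact_convex B" "compact_convex C"
  shows "MV (A + {x}) B C = MV A B C"
  using assms by (simp add: mixed_volume_plus1 compact_convex_singleton mixed_volume_singleton)

lemma mixed_volume_nonneg:
  assumes A: "compact_convex A" and B: "compact_convex B"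
  shows "0 \<le> MV A B B"
proof -
  obtain a where "a \<in> A" using A by (auto simp: compact_convex_def)
  then show ?thesis
    using mixed_volume_mono[of "{a}" A B] A B by (simp add: compact_convex_singleton mixed_volume_singleton)
qed

text \<open>
  Monotonicity in the first argument when the third argument cannot tell \<open>A\<close> from \<open>A'\<close>: the leading
  terms of the volumes of \<open>A + t B + s K\<close> and \<open>A' + t B + s K\<close> agree, so the next ones are ordered.
\<close>

lemma mixed_volume_mono_if_eq:
  assumes A: "compact_convex A" and A': "compact_convex A'" and B: "compact_convex B"
    and K: "compact_convex K"
    and sub: "A \<subseteq> A'" and eq: "MV A K K = MV A' K K"
  shows "MV A B K \<le> MV A' B K"
proof -
  have step: "MV U U K \<le> MV U' U' K"
    if U: "compact_convex U" "compact_convex U'" "U \<subseteq> U'" "MV U K K = MV U' K K" for U U'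
  proof -
    have "0 \<le> (vol U' - vol U) + 3 * (MV K U' U' - MV K U U) * s" if s: "0 < s" for s
    proof -
      have "s \<cdot> K + U \<subseteq> s \<cdot> K + U'"
        using U by (intro set_plus_mono2) auto
      then have "vol (s \<cdot> K + U) \<le> vol (s \<cdot> K + U')"
        using U K by (intro vol_mono compact_convex_intros)
      moreover have "MV K K U = MV K K U'"
        using U K by (simp add: mixed_volume_rotate(2)[of K K])
      ultimately show ?thesis
        using U K s by (simp add: vol_scaled_plus right_diff_distrib mult.assoc) (simp add: algebra_simps)
    qed
    then have "0 \<le> 3 * (MV K U' U' - MV K U U)" by (rule nonneg_slope_of_linear)
    then show ?thesis using U K by (simp add: mixed_volume_rotate(1)[of K])
  qed
  \<comment> \<open>Here t tends to infinity: the terms quadratic in t are equal and cancel, so the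
    linear ones are ordered.\<close>
  have "0 \<le> (MV A' A' K - MV A A K) + 2 * (MV A' B K - MV A B K) * t" if t: "0 < t" for t
  proof -
    have exp: "MV (X + t \<cdot> B) (X + t \<cdot> B) K = MV X X K + 2 * t * MV X B K + t\<^sup>2 * MV B B K"
      if X: "compact_convex X" for X
      using X B K t mixed_volume_commute(1)[of B X K]
      by (simp add: mixed_volume_linear compact_convex_intros power2_eq_square algebra_simps)
    have "A + t \<cdot> B \<subseteq> A' + t \<cdot> B" using sub by (intro set_plus_mono2) auto
    then have "MV (A + t \<cdot> B) (A + t \<cdot> B) K \<le> MV (A' + t \<cdot> B) (A' + t \<cdot> B) K"
      using A A' B K t eq by (intro step) (simp_all add: compact_convex_intros mixed_volume_plus1)
    then show ?thesis using A A' by (simp add: exp algebra_simps)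
  qed
  then have "0 \<le> 2 * (MV A' B K - MV A B K)" by (rule nonneg_slope_of_linear)
  then show ?thesis by simp
qed

section \<open>The Bezout inequality\<close>

definition bezout :: "(real ^ 3) set \<Rightarrow> bool" where
  "bezout K \<longleftrightarrow> (\<forall>A B. compact_convex A \<and> compact_convex B \<longrightarrow> MV A B K * vol K \<le> MV A K K * MV B K K)"

lemma convex_body_compact_convex: "convex_body K \<Longrightarrow> compact_convex K"
  by (auto simp: convex_body_def compact_convex_def)

lemma convex_body_vol_pos:
  assumes "convex_body K"
  shows "0 < vol K"
proof -
  obtain x e where e: "0 < e" "ball x e \<subseteq> K"
    using assms by (auto simp: convex_body_def mem_interior)
  have "0 < vol (ball x e)" using e by (simp add: content_ball_pos)
  also have "\<dots> \<le> vol K"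
    using e compact_convexD(6)[OF convex_body_compact_convex[OF assms]]
    by (intro measure_mono_fmeasurable) (auto simp: fmeasurableD)
  finally show ?thesis .
qed

text \<open>
  Replacing \<open>A\<close> and \<open>B\<close> by \<open>A + K\<close> and \<open>B + K\<close> adds the same quantity to both sides of the
  inequality, so it holds even for those \<open>A\<close> and \<open>B\<close> for which the quotient is not defined.
\<close>

lemma bezout_if_b2_le_1:
  assumes K: "convex_body K" and b2: "b2 K \<le> 1"
  shows "bezout K"
  unfolding bezout_def
proof (intro allI impI, elim conjE)
  fix A B assume A: "compact_convex A" and B: "compact_convex B"
  note K' = convex_body_compact_convex[OF K]
  have v: "0 < vol K" by (rule convex_body_vol_pos[OF K])
  have big: "\<not> is_singleton (X + K)" if X: "compact_convex X" for X
  proof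
    assume "is_singleton (X + K)"
    then obtain z where z: "X + K = {z}" by (auto simp: is_singleton_def)
    obtain x where "x \<in> X" using X by (auto simp: compact_convex_def)
    then have "vol K \<le> vol (X + K)"
      using vol_plus_singleton[of K x] set_plus_mono2[of K K "{x}" X]
        vol_mono[of "K + {x}" "X + K"] X K'
      by (simp add: add.commute[of X] compact_convex_intros)
    then show False using z v by (simp add: vol_singleton)
  qed
  let ?q = "\<lambda>A B. MV A B K * vol K / (MV A K K * MV B K K)"
  have "ereal (?q (A + K) (B + K)) \<le> b2 K"
    unfolding b2_def using A B K' big
    by (intro SUP_upper2[of "(A + K, B + K)"]) (simp_all add: compact_convex_plus)
  also have "\<dots> \<le> ereal 1" using b2 by (simp add: one_ereal_def)
  finally have "?q (A + K) (B + K) \<le> 1" by simp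
  moreover have a: "MV (A + K) K K = MV A K K + vol K" and b: "MV (B + K) K K = MV B K K + vol K"
    using A B K' by (simp_all add: mixed_volume_plus1 mixed_volume_diagonal)
  moreover have "0 \<le> MV A K K" "0 \<le> MV B K K"
    using A B K' by (simp_all add: mixed_volume_nonneg)
  moreover from this have "0 < (MV A K K + vol K) * (MV B K K + vol K)"
    using v by (intro mult_pos_pos add_nonneg_pos)
  ultimately have "MV (A + K) (B + K) K * vol K \<le> (MV A K K + vol K) * (MV B K K + vol K)"
    by (auto simp: divide_le_eq_1)
  moreover have "MV (A + K) (B + K) K = MV A B K + MV A K K + MV B K K + vol K"
    using A B K' mixed_volume_commute(1)[of K B K]
    by (simp add: mixed_volume_linear compact_convex_plus mixed_volume_diagonal)
  ultimately show "MV A B K * vol K \<le> MV A K K * MV B K K"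
    by (simp add: algebra_simps)
qed

lemma bezoutD:
  "bezout K \<Longrightarrow> compact_convex A \<Longrightarrow> compact_convex B \<Longrightarrow> MV A B K * vol K \<le> MV A K K * MV B K K"
  unfolding bezout_def by blast

text \<open>The matrix maps S into a box with half-widths e. This bounds the volume near an edge of
  the simplex, and that of the thin piece cut off where two facets meet in a point.\<close>

lemma vol_parallelepiped_le:
  fixes M :: "real ^ 3 ^ 3"
  assumes S: "S \<in> lmeasurable" and e: "\<And>i. 0 \<le> e $ i"
    and sub: "\<And>z i. z \<in> S \<Longrightarrow> \<bar>(M *v z) $ i - c $ i\<bar> \<le> e $ i"
  shows "\<bar>det M\<bar> * vol S \<le> 8 * (e $ 1 * e $ 2 * e $ 3)"
proof -
  have lin: "linear ((*v) M)" by simp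
  have "\<bar>det M\<bar> * vol S = vol ((*v) M ` S)"
    using measure_linear_image[OF lin S] by (simp add: matrix_of_matrix_vector_mul)
  also have "\<dots> \<le> vol (cbox (c - e) (c + e))"
  proof (rule measure_mono_fmeasurable)
    show "(*v) M ` S \<subseteq> cbox (c - e) (c + e)"
      using sub by (fastforce simp: mem_box_cart abs_le_iff algebra_simps)
    show "(*v) M ` S \<in> sets lebesgue"
      using measurable_linear_image[OF lin S] by (rule fmeasurableD)
  qed simp
  also have "\<dots> = 8 * (e $ 1 * e $ 2 * e $ 3)"
  proof -
    have "cbox (c - e) (c + e) \<noteq> {}" using e by (simp add: interval_ne_empty_cart)
    then have "vol (cbox (c - e) (c + e)) = (\<Prod>i\<in>{1, 2, 3}. (c + e) $ i - (c - e) $ i)"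
      using UNIV_3 by (simp add: content_cbox_cart[OF \<open>cbox (c - e) (c + e) \<noteq> {}\<close>] del:
          vector_add_component vector_minus_component)
    also have "\<dots> = (2 * e $ 1) * ((2 * e $ 2) * (2 * e $ 3))"
      by simp
    finally show ?thesis by simp
  qed
  finally show ?thesis .
qed

section \<open>The inequality holds for a simplex\<close>

text \<open>One simplex suffices: it is the competitor that forces \<open>b2 K \<le> 1\<close> on a
  minimizer.\<close>

definition corner :: "(real ^ 3) set" where
  "corner = {x. (\<forall>i. 0 \<le> x $ i) \<and> x $ 1 + x $ 2 + x $ 3 \<le> 1}"

lemma mem_scaled_corner:
  assumes "0 < s"
  shows "x \<in> s \<cdot> corner \<longleftrightarrow> (\<forall>i. 0 \<le> x $ i) \<and> x $ 1 + x $ 2 + x $ 3 \<le> s"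
proof -
  have "x \<in> s \<cdot> corner \<longleftrightarrow> x /\<^sub>R s \<in> corner"
  proof
    assume "x /\<^sub>R s \<in> corner"
    moreover have "x = s *\<^sub>R (x /\<^sub>R s)" using assms by simp
    ultimately show "x \<in> s \<cdot> corner" by blast
  qed (use assms in auto)
  also have "\<dots> \<longleftrightarrow> (\<forall>i. 0 \<le> x $ i) \<and> x $ 1 + x $ 2 + x $ 3 \<le> s"
    using assms by (simp add: corner_def zero_le_mult_iff field_simps)
  finally show ?thesis .
qed

lemma convex_body_corner: "convex_body corner"
  unfolding convex_body_def
proof (intro conjI)
  have "closed corner"
    unfolding corner_def
    by (intro closed_Collect_conj closed_Collect_all closed_Collect_le continuous_intros)
  moreover have "corner \<subseteq> cbox 0 1"
  proof
    fix x assume x: "x \<in> corner"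
    then have "0 \<le> x $ 1" "0 \<le> x $ 2" "0 \<le> x $ 3" "x $ 1 + x $ 2 + x $ 3 \<le> 1" by (auto simp: corner_def)
    then show "x \<in> cbox 0 1" by (simp add: mem_box_cart forall_3)
  qed
  ultimately show "compact corner"
    using bounded_cbox bounded_subset compact_eq_bounded_closed by blast
  show "convex corner"
  proof (rule convexI)
    fix x y :: "real ^ 3" and u v :: real
    assume xy: "x \<in> corner" "y \<in> corner" and uv: "0 \<le> u" "0 \<le> v" "u + v = 1"
    have "u * (x $ 1 + x $ 2 + x $ 3) + v * (y $ 1 + y $ 2 + y $ 3) \<le> u * 1 + v * 1"
      using xy uv by (intro add_mono mult_left_mono) (auto simp: corner_def)
    then show "u *\<^sub>R x + v *\<^sub>R y \<in> corner"
      using xy uv by (auto simp: corner_def algebra_simps)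
  qed
  have "box 0 (vec (1 / 4)) \<subseteq> corner"
  proof
    fix x :: "real ^ 3" assume "x \<in> box 0 (vec (1 / 4))"
    then have "0 < x $ i \<and> x $ i < 1 / 4" for i by (simp add: mem_box_cart)
    from this this[of 1] this[of 2] this[of 3] have "\<forall>i. 0 \<le> x $ i" "x $ 1 + x $ 2 + x $ 3 \<le> 1"
      using less_imp_le by (blast, linarith)
    then show "x \<in> corner" by (simp add: corner_def)
  qed
  then have "box 0 (vec (1 / 4)) \<subseteq> interior corner" by (simp add: interior_maximal open_box)
  moreover have "vec (1 / 8) \<in> box (0 :: real ^ 3) (vec (1 / 4))" by (simp add: mem_box_cart)
  ultimately show "interior corner \<noteq> {}" by blast
qed

lemmas compact_convex_corner = convex_body_compact_convex[OF convex_body_corner]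

text \<open>
  An entry \<open>(c, r, r', r'')\<close> stands for the edge on the line \<open>r \<bullet> x = c\<close>, \<open>r' \<bullet> x = 0\<close>; the vector
  \<open>r''\<close> completes \<open>r\<close> and \<open>r'\<close> to a basis.
\<close>

definition corner_edges :: "(real \<times> (real ^ 3) \<times> (real ^ 3) \<times> (real ^ 3)) list" where
  "corner_edges = [
    (0, vector [1, 0, 0], vector [0, 1, 0], vector [0, 0, 1]),
    (0, vector [1, 0, 0], vector [0, 0, 1], vector [0, 1, 0]),
    (0, vector [0, 1, 0], vector [0, 0, 1], vector [1, 0, 0]),
    (1, vector [1, 1, 1], vector [1, 0, 0], vector [0, 1, 0]),
    (1, vector [1, 1, 1], vector [0, 1, 0], vector [1, 0, 0]),
    (1, vector [1, 1, 1], vector [0, 0, 1], vector [1, 0, 0])]"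

definition near_edge :: "real \<Rightarrow> real \<times> (real ^ 3) \<times> (real ^ 3) \<times> (real ^ 3) \<Rightarrow> (real ^ 3) set" where
  "near_edge s e = (case e of (c, r, r', _) \<Rightarrow> {x \<in> (1 + s) \<cdot> corner. \<bar>r \<bullet> x - c\<bar> \<le> s \<and> \<bar>r' \<bullet> x\<bar> \<le> s})"

lemma inner_vector_3: "vector [a, b, c] \<bullet> x = a * x $ 1 + b * x $ 2 + c * x $ 3" for x :: "real ^ 3"
  by (simp add: inner_vec_def sum_3)

lemma compact_near_edge: "compact (near_edge s e)"
proof -
  obtain c r r' r'' where e: "e = (c, r, r', r'')" by (cases e)
  have "near_edge s e = (1 + s) \<cdot> corner \<inter> {x. \<bar>r \<bullet> x - c\<bar> \<le> s \<and> \<bar>r' \<bullet> x\<bar> \<le> s}"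
    by (auto simp: near_edge_def e)
  moreover have "closed {x. \<bar>r \<bullet> x - c\<bar> \<le> s \<and> \<bar>r' \<bullet> x\<bar> \<le> s}"
    by (intro closed_Collect_conj closed_Collect_le continuous_intros)
  ultimately show ?thesis
    using compact_convexD(2)[OF compact_convex_scaled[OF compact_convex_corner]] by auto
qed

text \<open>Quadratic in s because two of the three coordinates \<open>r\<close>, \<open>r'\<close>,
  \<open>r''\<close> vary by at most s around their values on the edge; the third is at most 2 on (1
  + s) times the simplex.\<close>

lemma vol_near_edge_le:
  assumes e: "e \<in> set corner_edges" and s: "0 < s" "s \<le> 1"
  shows "vol (near_edge s e) \<le> 16 * s\<^sup>2"
proof -
  obtain c r r' r'' where e': "e = (c, r, r', r'')" by (cases e)
  let ?M = "vector [r, r', r''] :: real ^ 3 ^ 3"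
  have M: "(?M *v z) $ 1 = r \<bullet> z" "(?M *v z) $ 2 = r' \<bullet> z" "(?M *v z) $ 3 = r'' \<bullet> z" for z
    by (simp_all add: matrix_vector_mul_component)
  have "\<bar>det ?M\<bar> = 1"
    using e unfolding e' corner_edges_def by (auto simp: det_3)
  moreover have "\<bar>r'' \<bullet> z\<bar> \<le> 2" if "z \<in> near_edge s e" for z
  proof -
    have "z \<in> (1 + s) \<cdot> corner" using that by (auto simp: near_edge_def e')
    then have "\<forall>i. 0 \<le> z $ i" "z $ 1 + z $ 2 + z $ 3 \<le> 2"
      using s by (auto simp: mem_scaled_corner)
    then have "\<bar>z $ 1\<bar> \<le> 2" "\<bar>z $ 2\<bar> \<le> 2" "\<bar>z $ 3\<bar> \<le> 2"
      using \<open>\<forall>i. 0 \<le> z $ i\<close>[rule_format, of 1] \<open>\<forall>i. 0 \<le> z $ i\<close>[rule_format, of 2]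
        \<open>\<forall>i. 0 \<le> z $ i\<close>[rule_format, of 3] by linarith+
    then show ?thesis
      using e unfolding e' corner_edges_def by (auto simp: inner_vector_3)
  qed
  then have "\<bar>(?M *v z) $ i - vector [c, 0, 0] $ i\<bar> \<le> vector [s, s, 2] $ i" if "z \<in> near_edge s e" for z i
  proof -
    have "\<bar>r \<bullet> z - c\<bar> \<le> s" "\<bar>r' \<bullet> z\<bar> \<le> s" "\<bar>r'' \<bullet> z\<bar> \<le> 2"
      using that \<open>\<And>z. z \<in> near_edge s e \<Longrightarrow> \<bar>r'' \<bullet> z\<bar> \<le> 2\<close> by (auto simp: near_edge_def e')
    then show ?thesis using exhaust_3[of i] M[of z] by (elim disjE) simp_all
  qed
  moreover have "0 \<le> (vector [s, s, 2] :: real ^ 3) $ i" for i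
    using s exhaust_3[of i] by auto
  ultimately have "\<bar>det ?M\<bar> * vol (near_edge s e) \<le> 8 * (s * s * 2)"
    using vol_parallelepiped_le[OF lmeasurable_compact[OF compact_near_edge], of "vector [s, s, 2]" s e
        ?M "vector [c, 0, 0]"]
    by simp
  with \<open>\<bar>det ?M\<bar> = 1\<close> show ?thesis by (simp add: power2_eq_square)
qed

text \<open>
  If \<open>A\<close> touches all facets of the simplex \<open>\<Delta>\<close> then the translates of \<open>\<Delta>\<close> inside \<open>\<Delta> + s A\<close> cover
  \<open>(1 + s) \<Delta>\<close> except near its edges.
\<close>

lemma scaled_corner_subset:
  assumes A: "A \<subseteq> corner" and s: "0 < s" "s \<le> 1"
    and touch: "\<And>i. \<exists>a\<in>A. a $ i = 0" "\<exists>a\<in>A. a $ 1 + a $ 2 + a $ 3 = 1"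
  shows "(1 + s) \<cdot> corner \<subseteq> (corner + s \<cdot> A) \<union> (\<Union>e\<in>set corner_edges. near_edge s e)"
proof
  fix x assume x: "x \<in> (1 + s) \<cdot> corner"
  then have x0: "0 \<le> x $ 1" "0 \<le> x $ 2" "0 \<le> x $ 3" and x1: "x $ 1 + x $ 2 + x $ 3 \<le> 1 + s"
    using s by (auto simp: mem_scaled_corner)
  have cover: "x \<in> corner + s \<cdot> A"
    if a: "a \<in> A" "s * a $ 1 \<le> x $ 1" "s * a $ 2 \<le> x $ 2" "s * a $ 3 \<le> x $ 3"
      "x $ 1 + x $ 2 + x $ 3 \<le> 1 + s * (a $ 1 + a $ 2 + a $ 3)" for a
  proof -
    have "x - s *\<^sub>R a \<in> corner"
      using a(2-) by (simp add: corner_def forall_3 algebra_simps)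
    then have "(x - s *\<^sub>R a) + s *\<^sub>R a \<in> corner + s \<cdot> A"
      using a(1) by (intro set_plus_intro) auto
    then show ?thesis by simp
  qed
  have le: "s * a $ 1 \<le> s" "s * a $ 2 \<le> s" "s * a $ 3 \<le> s" "0 \<le> s * a $ 1" "0 \<le> s * a $ 2" "0 \<le> s * a $ 3"
    "0 \<le> s * (a $ 1 + a $ 2 + a $ 3)" if "a \<in> A" for a
  proof -
    have "0 \<le> a $ 1" "0 \<le> a $ 2" "0 \<le> a $ 3" "a $ 1 + a $ 2 + a $ 3 \<le> 1"
      using that A by (auto simp: corner_def)
    then show "s * a $ 1 \<le> s" "s * a $ 2 \<le> s" "s * a $ 3 \<le> s" "0 \<le> s * a $ 1" "0 \<le> s * a $ 2"
        "0 \<le> s * a $ 3"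
      "0 \<le> s * (a $ 1 + a $ 2 + a $ 3)"
      using s by (auto intro!: mult_nonneg_nonneg mult_left_le)
  qed
  obtain a1 a2 a3 a0 where a: "a1 \<in> A" "a1 $ 1 = 0" "a2 \<in> A" "a2 $ 2 = 0" "a3 \<in> A" "a3 $ 3 = 0"
    "a0 \<in> A" "a0 $ 1 + a0 $ 2 + a0 $ 3 = 1"
    using touch by metis
  have sa: "s * a1 $ 1 = 0" "s * a2 $ 2 = 0" "s * a3 $ 3 = 0" "s * (a0 $ 1 + a0 $ 2 + a0 $ 3) = s"
    using a by simp_all
  note in_edges = corner_edges_def near_edge_def inner_vector_3
  \<comment> \<open>Count the facets of (1 + s) times the simplex to which x is closer than s,
    measured by their linear functions. If there is at most one, the translate by s times a point of
    A on that facet covers x; if there are two, x is near their common edge.\<close>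
  consider "s \<le> x $ 2" "s \<le> x $ 3" "x $ 1 + x $ 2 + x $ 3 \<le> 1"
    | "s \<le> x $ 1" "s \<le> x $ 3" "x $ 1 + x $ 2 + x $ 3 \<le> 1"
    | "s \<le> x $ 1" "s \<le> x $ 2" "x $ 1 + x $ 2 + x $ 3 \<le> 1"
    | "s \<le> x $ 1" "s \<le> x $ 2" "s \<le> x $ 3"
    | "x $ 1 < s" "x $ 2 < s" | "x $ 1 < s" "x $ 3 < s" | "x $ 2 < s" "x $ 3 < s"
    | "1 < x $ 1 + x $ 2 + x $ 3" "x $ 1 < s"
    | "1 < x $ 1 + x $ 2 + x $ 3" "x $ 2 < s"
    | "1 < x $ 1 + x $ 2 + x $ 3" "x $ 3 < s"
    by (cases "s \<le> x $ 1"; cases "s \<le> x $ 2"; cases "s \<le> x $ 3"; cases "x $ 1 + x $ 2 + x $ 3 \<le> 1")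
       (simp_all add: not_le)
  then show "x \<in> (corner + s \<cdot> A) \<union> (\<Union>e\<in>set corner_edges. near_edge s e)"
  proof cases
    case 1
    have "x \<in> corner + s \<cdot> A" by (rule cover[OF a(1)]) (use 1 x0 sa le[OF a(1)] in linarith)+
    then show ?thesis by blast
  next
    case 2
    have "x \<in> corner + s \<cdot> A" by (rule cover[OF a(3)]) (use 2 x0 sa le[OF a(3)] in linarith)+
    then show ?thesis by blast
  next
    case 3
    have "x \<in> corner + s \<cdot> A" by (rule cover[OF a(5)]) (use 3 x0 sa le[OF a(5)] in linarith)+
    then show ?thesis by blast
  next
    case 4
    have "x \<in> corner + s \<cdot> A"
      by (rule cover[OF a(7)]) (use 4 x0 x1 sa le[OF a(7)] in linarith)+
    then show ?thesis by blast
  qed (use x x0 x1 in \<open>simp_all add: in_edges\<close>)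
qed

text \<open>The uncovered part near the edges has volume of order \<open>s\<^sup>2\<close>, so it
  does not affect the terms linear in s of the volumes of \<open>(1 + s) \<cdot> corner\<close> and
  \<open>corner + s \<cdot> A\<close>.\<close>

lemma mixed_volume_corner_touching:
  assumes A: "compact_convex A" and sub: "A \<subseteq> corner"
    and touch: "\<And>i. \<exists>a\<in>A. a $ i = 0" "\<exists>a\<in>A. a $ 1 + a $ 2 + a $ 3 = 1"
  shows "MV A corner corner = vol corner"
proof (rule antisym)
  note C = compact_convex_corner
  show "MV A corner corner \<le> vol corner"
    using mixed_volume_mono[OF A C C sub] C by (simp add: mixed_volume_diagonal)
  \<comment> \<open>The constant 96 is six edges times the bound 16 of
    \<open>vol_near_edge_le\<close>.\<close>
  have "0 \<le> 3 * (MV A corner corner - vol corner) + (3 * MV corner A A - 3 * vol corner + 96) * s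
      + (vol A - vol corner) * s\<^sup>2"
    if s: "0 < s" "s \<le> 1" for s
  proof -
    have "vol ((1 + s) \<cdot> corner) \<le> vol ((corner + s \<cdot> A) \<union> (\<Union>e\<in>set corner_edges. near_edge s e))"
    proof (rule measure_mono_fmeasurable)
      show "(1 + s) \<cdot> corner \<subseteq> (corner + s \<cdot> A) \<union> (\<Union>e\<in>set corner_edges. near_edge s e)"
        by (rule scaled_corner_subset[OF sub s touch])
      show "(1 + s) \<cdot> corner \<in> sets lebesgue"
        using compact_convexD(6)[OF compact_convex_scaled[OF C]] by (rule fmeasurableD)
      show "(corner + s \<cdot> A) \<union> (\<Union>e\<in>set corner_edges. near_edge s e) \<in> lmeasurable"
        using A C compact_near_edge
        by (intro fmeasurable.Un fmeasurable.finite_UN lmeasurable_compact compact_convexD(6)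
            compact_convex_intros) auto
    qed
    also have "\<dots> \<le> vol (corner + s \<cdot> A) + vol (\<Union>e\<in>set corner_edges. near_edge s e)"
      using A C compact_near_edge
      by (intro measure_Un_le sets.finite_UN fmeasurableD lmeasurable_compact compact_convexD(6)
          compact_convex_intros) auto
    also have "vol (\<Union>e\<in>set corner_edges. near_edge s e) \<le> (\<Sum>e\<in>set corner_edges. vol (near_edge s e))"
      using compact_near_edge by (intro measure_UNION_le) (auto intro!: fmeasurableD lmeasurable_compact)
    also have "\<dots> \<le> of_nat (card (set corner_edges)) * (16 * s\<^sup>2)"
      using vol_near_edge_le s by (intro sum_bounded_above) auto
    also have "\<dots> \<le> 6 * (16 * s\<^sup>2)"
    proof -
      have "card (set corner_edges) \<le> 6"
        using card_length[of corner_edges] by (simp add: corner_edges_def)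
      then show ?thesis by (intro mult_right_mono) auto
    qed
    finally have "0 \<le> s * (3 * (MV A corner corner - vol corner)
        + (3 * MV corner A A - 3 * vol corner + 96) * s + (vol A - vol corner) * s\<^sup>2)"
      using A C s mixed_volume_rotate(2)[OF C C A]
      by (simp add: vol_scaled vol_plus_scaled) (simp add: power3_eq_cube power2_eq_square algebra_simps)
    then show ?thesis using s by (simp add: zero_le_mult_iff)
  qed
  then have "0 \<le> 3 * (MV A corner corner - vol corner)" by (rule nonneg_at_0_of_quadratic)
  then show "vol corner \<le> MV A corner corner" by simp
qed

text \<open>After translation and dilation A is inscribed in the simplex and touches all its facets.
  Then both have the same mixed volume with two copies of the simplex, so
  \<open>mixed_volume_mono_if_eq\<close> bounds \<open>MV A B corner\<close> by the value with the
  simplex in place of A.\<close>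

lemma bezout_corner: "bezout corner"
  unfolding bezout_def
proof (intro allI impI, elim conjE)
  fix A B assume A: "compact_convex A" and B: "compact_convex B"
  note C = compact_convex_corner
  \<comment> \<open>The simplex scaled by \<open>\<alpha>\<close> and translated by \<open>m\<close>
    is the smallest homothet containing A; \<open>\<alpha>\<close> is 0 when A is a point.\<close>
  define m where "m = (\<chi> i. - supp A (- axis i 1))"
  define one where "one = (vector [1, 1, 1] :: real ^ 3)"
  define \<alpha> where "\<alpha> = supp A one - one \<bullet> m"
  have m: "m $ i \<le> a $ i" if "a \<in> A" for a i
    using supp_ge[OF A that, of "- axis i 1"] by (simp add: m_def inner_axis')
  have m_att: "\<exists>a\<in>A. a $ i = m $ i" for i
  proof -
    obtain a where "a \<in> A" "- axis i 1 \<bullet> a = supp A (- axis i 1)" using supp_attained[OF A] by metis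
    then show ?thesis by (intro bexI[of _ a]) (simp_all add: m_def inner_axis' flip: \<open>- axis i 1 \<bullet> a = _\<close>)
  qed
  obtain p where p: "p \<in> A" "one \<bullet> p = supp A one" using supp_attained[OF A] by metis
  have \<alpha>: "0 \<le> \<alpha>"
    using m[OF p(1), of 1] m[OF p(1), of 2] m[OF p(1), of 3] p(2)
    by (simp add: \<alpha>_def one_def inner_vector_3)
  have in_corner: "\<And>i. 0 \<le> (a - m) $ i" "(a - m) $ 1 + (a - m) $ 2 + (a - m) $ 3 \<le> \<alpha>" if "a \<in> A" for a
    using m[OF that] supp_ge[OF A that, of one] by (auto simp: \<alpha>_def one_def inner_vector_3)
  show "MV A B corner * vol corner \<le> MV A corner corner * MV B corner corner"
  proof (cases "\<alpha> = 0")
    case True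
    have "A = {m}"
    proof -
      have "a = m" if "a \<in> A" for a
      proof -
        have "a $ 1 = m $ 1 \<and> a $ 2 = m $ 2 \<and> a $ 3 = m $ 3"
          using in_corner(2)[OF that] True in_corner(1)[OF that, of 1] in_corner(1)[OF that, of
              2] in_corner(1)[OF that, of 3]
          unfolding vector_minus_component by linarith
        then show ?thesis by (simp add: vec_eq_iff forall_3)
      qed
      then show ?thesis using p(1) by blast
    qed
    then show ?thesis using B C by (simp add: mixed_volume_singleton)
  next
    case False
    with \<alpha> have \<alpha>: "0 < \<alpha>" by simp
    define A' where "A' = inverse \<alpha> \<cdot> (A + {- m})"
    have A': "compact_convex A'" unfolding A'_def using A by (intro compact_convex_intros)
    have A'_eq: "A' = (\<lambda>a. (a - m) /\<^sub>R \<alpha>) ` A" by (auto simp: A'_def set_plus_def image_def)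
    have AA': "\<alpha> \<cdot> A' = A + {- m}" using \<alpha> by (auto simp: A'_def image_image)
    have scale: "MV A X Y = \<alpha> * MV A' X Y" if "compact_convex X" "compact_convex Y" for X Y
      using that A A' \<alpha> by (metis AA' mixed_volume_translate mixed_volume_scaled1 less_imp_le)
    have sub: "A' \<subseteq> corner"
    proof -
      have "(a - m) /\<^sub>R \<alpha> \<in> corner" if "a \<in> A" for a
      proof -
        have "((a - m) $ 1 + (a - m) $ 2 + (a - m) $ 3) / \<alpha> \<le> 1"
          using in_corner(2)[OF that] \<alpha> by (simp add: divide_le_eq_1)
        then show ?thesis
          using in_corner(1)[OF that] \<alpha>
          by (auto simp: corner_def divide_inverse algebra_simps intro!: mult_left_mono)
      qed
      then show ?thesis unfolding A'_eq by blast
    qed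
    have "MV A' corner corner = vol corner"
    proof (rule mixed_volume_corner_touching[OF A' sub])
      show "\<exists>a\<in>A'. a $ i = 0" for i using m_att[of i] unfolding A'_eq by auto
      show "\<exists>a\<in>A'. a $ 1 + a $ 2 + a $ 3 = 1"
      proof (rule bexI)
        let ?p = "(p - m) /\<^sub>R \<alpha>"
        have "(p - m) $ 1 + (p - m) $ 2 + (p - m) $ 3 = \<alpha>"
          using p by (simp add: \<alpha>_def one_def inner_vector_3)
        then have "((p - m) $ 1 + (p - m) $ 2 + (p - m) $ 3) / \<alpha> = 1" using \<alpha> by simp
        then show "?p $ 1 + ?p $ 2 + ?p $ 3 = 1"
          by (simp add: divide_inverse_commute distrib_left)
        show "?p \<in> A'" unfolding A'_eq using p by blast
      qed
    qed
    then have eq: "MV A corner corner = \<alpha> * vol corner" using C by (simp add: scale)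
    have "MV A' B corner \<le> MV corner B corner"
      using A' B C sub \<open>MV A' corner corner = vol corner\<close>
      by (intro mixed_volume_mono_if_eq) (auto simp: mixed_volume_diagonal)
    also have "\<dots> = MV B corner corner" using B C by (simp add: mixed_volume_commute(1)[of corner])
    finally have "\<alpha> * vol corner * MV A' B corner \<le> \<alpha> * vol corner * MV B corner corner"
      using \<alpha> by (intro mult_left_mono) auto
    then show ?thesis using B C by (simp add: scale eq algebra_simps \<open>MV A' corner corner = vol corner\<close>)
  qed
qed

lemma b2_corner_le: "b2 corner \<le> 1"
  unfolding b2_def
proof (rule SUP_least, clarify)
  fix A B assume A: "compact_convex A" and B: "compact_convex B"
  have "MV A B corner * vol corner \<le> MV A corner corner * MV B corner corner"
    using bezout_corner A B by (rule bezoutD)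
  moreover have "0 \<le> MV A corner corner * MV B corner corner"
    using A B compact_convex_corner by (simp add: mixed_volume_nonneg)
  ultimately show "ereal (MV A B corner * vol corner / (MV A corner corner * MV B corner corner)) \<le> 1"
    by (auto simp: divide_le_eq_1 one_ereal_def less_le)
qed

lemma bezout_if_minimal:
  assumes "is_arg_min b2 convex_body K"
  shows "bezout K"
proof (rule bezout_if_b2_le_1)
  show "convex_body K" using assms by (simp add: is_arg_min_def)
  show "b2 K \<le> 1"
    using assms convex_body_corner order_trans[OF _ b2_corner_le, of "b2 K"]
    by (auto simp: is_arg_min_def not_less)
qed

section \<open>Regular supporting planes\<close>

definition face :: "(real ^ 3) set \<Rightarrow> real ^ 3 \<Rightarrow> (real ^ 3) set" where
  "face K n = {z \<in> K. n \<bullet> z = supp K n}"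

text \<open>A supporting plane is regular at a point if a ball inside \<open>K\<close> touches it there.\<close>

definition regular_at :: "(real ^ 3) set \<Rightarrow> real ^ 3 \<Rightarrow> real ^ 3 \<Rightarrow> bool" where
  "regular_at K q n \<longleftrightarrow> norm n = 1 \<and> q \<in> face K n \<and> (\<exists>r>0. cball (q - r *\<^sub>R n) r \<subseteq> K)"

definition regular_normals :: "(real ^ 3) set \<Rightarrow> (real ^ 3) set" where
  "regular_normals K = {n. \<exists>q. regular_at K q n}"

text \<open>v supports K at q, hence also the touching ball, which has only one outer normal
  direction there.\<close>

lemma regular_normal_unique:
  assumes K: "compact_convex K" and q: "regular_at K q n" and v: "v \<bullet> q = supp K v"
  shows "v = norm v *\<^sub>R n"
proof (cases "v = 0")
  case False
  obtain r where r: "0 < r" "cball (q - r *\<^sub>R n) r \<subseteq> K" and n: "norm n = 1"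
    using q by (auto simp: regular_at_def)
  have "(q - r *\<^sub>R n) + (r / norm v) *\<^sub>R v \<in> K"
    using r False by (intro subsetD[OF r(2)]) (simp add: dist_norm)
  from supp_ge[OF K this, of v] have "v \<bullet> q - r * (v \<bullet> n) + (r / norm v) * (v \<bullet> v) \<le> v \<bullet> q"
    by (simp add: inner_add_right inner_diff_right v)
  moreover have "(r / norm v) * (v \<bullet> v) = r * norm v"
    using False by (simp add: dot_square_norm power2_eq_square)
  ultimately have "r * norm v \<le> r * (v \<bullet> n)" by simp
  then have "norm v \<le> v \<bullet> n" using r(1) by simp
  moreover have "v \<bullet> n \<le> norm v" using norm_cauchy_schwarz[of v n] n by simp
  ultimately have "v \<bullet> n = norm v * norm n" using n by simp
  then have "norm v *\<^sub>R n = norm n *\<^sub>R v" by (simp only: norm_cauchy_schwarz_eq)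
  then show ?thesis using n by simp
qed simp

text \<open>By compactness the gap \<open>supp K v - v \<bullet> q\<close> has a positive lower
  bound on the part of T away from n. T is the unit sphere for bodies, and a circle of directions in
  a plane for the base of a cone.\<close>

lemma normal_near:
  assumes K: "compact_convex K" and qK: "q \<in> K" and T: "closed T" "T \<subseteq> sphere 0 1"
    and uniq: "\<And>v. v \<in> T \<Longrightarrow> v \<bullet> q = supp K v \<Longrightarrow> v = n" and "0 < \<rho>"
  obtains \<omega> where "0 < \<omega>" "\<And>v. v \<in> T \<Longrightarrow> supp K v < v \<bullet> q + \<omega> \<Longrightarrow> norm (v - n) < \<rho>"
proof -
  define S where "S = T - ball n \<rho>"
  have pos: "0 < supp K v - v \<bullet> q" if "v \<in> S" for v
  proof -
    have "supp K v \<noteq> v \<bullet> q"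
    proof
      assume "supp K v = v \<bullet> q"
      then have "v = n" using uniq[of v] that by (simp add: S_def)
      then show False using that \<open>0 < \<rho>\<close> by (simp add: S_def)
    qed
    then show ?thesis using supp_ge[OF K qK, of v] by simp
  qed
  show thesis
  proof (cases "S = {}")
    case True
    have "norm (v - n) < \<rho>" if "v \<in> T" for v
      using True that by (force simp: S_def dist_norm norm_minus_commute)
    then show thesis using that[of 1] by simp
  next
    case False
    have "compact T" using T by (meson bounded_sphere bounded_subset compact_eq_bounded_closed)
    then have "compact S" unfolding S_def by (intro compact_diff) auto
    moreover have "continuous_on S (\<lambda>v. supp K v - v \<bullet> q)"
      by (intro continuous_intros continuous_on_supp[OF K])
    ultimately obtain w where w: "w \<in> S" "\<And>v. v \<in> S \<Longrightarrow> supp K w - w \<bullet> q \<le> supp K v - v \<bullet> q"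
      using continuous_attains_inf[of S "\<lambda>v. supp K v - v \<bullet> q"] False by blast
    show thesis
    proof (rule that)
      show "0 < supp K w - w \<bullet> q" by (rule pos[OF w(1)])
      fix v assume "v \<in> T" "supp K v < v \<bullet> q + (supp K w - w \<bullet> q)"
      then have "v \<notin> S" using w(2)[of v] by auto
      then show "norm (v - n) < \<rho>"
        using \<open>v \<in> T\<close> by (simp add: S_def dist_norm norm_minus_commute)
    qed
  qed
qed

lemma regular_normal_near:
  assumes K: "compact_convex K" and q: "regular_at K q n" and "0 < \<rho>"
  obtains \<omega> where "0 < \<omega>"
    "\<And>v. norm v = 1 \<Longrightarrow> supp K v < v \<bullet> q + \<omega> \<Longrightarrow> norm (v - n) < \<rho>"
proof -
  have "q \<in> K" using q by (auto simp: regular_at_def face_def)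
  moreover have "v = n" if "v \<in> sphere 0 1" "v \<bullet> q = supp K v" for v
    using regular_normal_unique[OF K q that(2)] that(1) by simp
  ultimately obtain \<omega> where "0 < \<omega>"
    "\<And>v. v \<in> sphere 0 1 \<Longrightarrow> supp K v < v \<bullet> q + \<omega> \<Longrightarrow> norm (v - n) < \<rho>"
    using normal_near[OF K, of q "sphere 0 1" n \<rho>] \<open>0 < \<rho>\<close> by auto
  then show thesis using that by simp
qed

lemma supp_cball: "0 \<le> r \<Longrightarrow> supp (cball c r) v = v \<bullet> c + r * norm v"
proof (rule antisym)
  assume r: "0 \<le> r"
  have C: "compact_convex (cball c r)" using r by (simp add: compact_convex_def)
  show "supp (cball c r) v \<le> v \<bullet> c + r * norm v"
  proof (rule supp_le[OF C])
    fix a assume "a \<in> cball c r"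
    then have "norm (a - c) \<le> r" by (simp add: dist_norm norm_minus_commute)
    then have "v \<bullet> (a - c) \<le> norm v * r"
      by (metis norm_cauchy_schwarz mult_left_mono norm_ge_zero order_trans)
    then show "v \<bullet> a \<le> v \<bullet> c + r * norm v" by (simp add: inner_diff_right mult.commute)
  qed
  show "v \<bullet> c + r * norm v \<le> supp (cball c r) v"
  proof (cases "v = 0")
    case False
    have "c + (r / norm v) *\<^sub>R v \<in> cball c r" using r False by (simp add: dist_norm)
    from supp_ge[OF C this, of v] show ?thesis
      using False by (simp add: inner_add_right dot_square_norm power2_eq_square)
  qed (simp add: supp_zero[OF C])
qed

text \<open>Largest inscribed balls touch the boundary in regular points. Their centres are taken on
  the segment from x to an interior point; one whose ball is small compared with the way from x
  yields a normal excluding x.\<close>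

lemma exists_regular_excluding:
  assumes K: "convex_body K" and x: "x \<notin> K"
  obtains q n where "regular_at K q n" "supp K n < n \<bullet> x"
proof -
  note K' = convex_body_compact_convex[OF K]
  define gap where "gap c v = supp K v - v \<bullet> c" for c v
  \<comment> \<open>Inside K this is the distance to the boundary; it is negative outside.\<close>
  define depth where "depth c = (INF v\<in>sphere 0 1. gap c v)" for c
  have ne: "sphere (0 :: real ^ 3) 1 \<noteq> {}" by simp
  have "\<exists>v\<in>sphere 0 1. \<forall>w\<in>sphere 0 1. gap c v \<le> gap c w" for c
    unfolding gap_def by (intro continuous_attains_inf ne continuous_intros continuous_on_supp[OF K']) simp
  then obtain dir where dir: "\<And>c. dir c \<in> sphere 0 1" "\<And>c w. w \<in> sphere 0 1 \<Longrightarrow> gap c (dir c) \<le> gap c w"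
    by metis
  have depth: "depth c = gap c (dir c)" for c
    unfolding depth_def using dir by (intro cInf_eq_minimum) auto
  have reg: "regular_at K (c + depth c *\<^sub>R dir c) (dir c)" if "0 < depth c" for c
  proof -
    have C: "compact_convex (cball c (depth c))" using that by (simp add: compact_convex_def)
    have sub: "cball c (depth c) \<subseteq> K"
      unfolding subset_iff_supp[OF C K']
    proof
      fix v show "supp (cball c (depth c)) v \<le> supp K v"
      proof (cases "v = 0")
        case False
        have "depth c \<le> gap c (v /\<^sub>R norm v)" using dir(2)[of "v /\<^sub>R norm v" c] False by (simp add: depth)
        also have "supp K (v /\<^sub>R norm v) = supp K v / norm v"
          by (simp add: supp_scaleR[OF K'] divide_inverse_commute)
        ultimately have "depth c * norm v \<le> supp K v - v \<bullet> c"
          using False by (simp add: gap_def field_simps)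
        then show ?thesis using that by (simp add: supp_cball)
      qed (simp add: supp_zero[OF C] supp_zero[OF K'])
    qed
    have n: "norm (dir c) = 1" using dir(1)[of c] by simp
    then have "c + depth c *\<^sub>R dir c \<in> cball c (depth c)" using that by (simp add: dist_norm)
    moreover have "dir c \<bullet> (c + depth c *\<^sub>R dir c) = supp K (dir c)"
      using n by (simp add: depth gap_def inner_add_right dot_square_norm)
    ultimately show ?thesis
      unfolding regular_at_def face_def using n sub that by (auto intro!: exI[of _ "depth c"])
  qed
  obtain c0 \<rho> where \<rho>: "0 < \<rho>" "cball c0 \<rho> \<subseteq> K"
    using K by (auto simp: convex_body_def mem_interior_cball)
  have C0: "compact_convex (cball c0 \<rho>)" using \<rho> by (simp add: compact_convex_def)
  have gap0: "\<rho> \<le> gap c0 v" if "norm v = 1" for v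
  proof -
    have "v \<bullet> c0 + \<rho> * norm v \<le> supp K v"
      using \<rho> subset_iff_supp[OF C0 K'] by (simp add: supp_cball)
    then show ?thesis using that by (simp add: gap_def)
  qed
  have depth_x: "depth x < 0"
  proof -
    obtain v where v: "supp K v < v \<bullet> x" using x mem_iff_supp[OF K'] by (meson not_le)
    then have "v \<noteq> 0" using supp_zero[OF K'] by auto
    then have "depth x \<le> gap x (v /\<^sub>R norm v)" using dir(2)[of "v /\<^sub>R norm v" x] by (simp add: depth)
    also have "\<dots> = (supp K v - v \<bullet> x) / norm v"
      by (simp add: gap_def supp_scaleR[OF K'] divide_inverse_commute algebra_simps)
    also have "\<dots> < 0" using v \<open>v \<noteq> 0\<close> by (simp add: divide_neg_pos)
    finally show ?thesis .
  qed
  have lip: "\<bar>depth c - depth c'\<bar> \<le> norm (c - c')" for c c'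
  proof -
    have "depth c \<le> depth c' + norm (c - c')" for c c'
    proof -
      have "depth c \<le> gap c (dir c')" using dir by (simp add: depth)
      also have "\<dots> = gap c' (dir c') + dir c' \<bullet> (c' - c)" by (simp add: gap_def inner_diff_right)
      also have "dir c' \<bullet> (c' - c) \<le> norm (c - c')"
        using norm_cauchy_schwarz[of "dir c'" "c' - c"] dir(1)[of c'] by (simp add: norm_minus_commute)
      finally show ?thesis by (simp add: depth)
    qed
    from this[of c c'] this[of c' c] show ?thesis by (simp add: norm_minus_commute)
  qed
  define pt where "pt t = (1 - t) *\<^sub>R x + t *\<^sub>R c0" for t :: real
  have "1-lipschitz_on UNIV depth" using lip by (intro lipschitz_onI) (auto simp: dist_norm)
  then have cd: "continuous_on UNIV depth" by (rule lipschitz_on_continuous_on)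
  \<comment> \<open>For a fixed direction the gap is affine along the segment. At the chosen point
    it is \<open>t * \<rho> / 2\<close>, while the share of \<open>c0\<close> is already at least
    \<open>t * \<rho>\<close>, so the share of x is negative.\<close>
  have "\<exists>t. 0 \<le> t \<and> t \<le> 1 \<and> depth (pt t) - t * \<rho> / 2 = 0"
  proof (rule IVT')
    show "depth (pt 0) - 0 * \<rho> / 2 \<le> 0" using depth_x by (simp add: pt_def)
    have "\<rho> \<le> depth c0" using gap0 dir(1)[of c0] by (simp add: depth)
    then show "0 \<le> depth (pt 1) - 1 * \<rho> / 2" using \<rho> by (simp add: pt_def)
    show "continuous_on {0..1} (\<lambda>t. depth (pt t) - t * \<rho> / 2)"
      unfolding pt_def by (intro continuous_intros continuous_on_compose2[OF cd]) auto
  qed simp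
  then obtain t where t: "0 \<le> t" "t \<le> 1" "depth (pt t) = t * \<rho> / 2" by auto
  have "t \<noteq> 0" using t(3) depth_x by (auto simp: pt_def)
  then have "0 < t * \<rho>" using t \<rho> by simp
  then have pos: "0 < depth (pt t)" using t(3) by simp
  let ?n = "dir (pt t)"
  have "depth (pt t) = (1 - t) * gap x ?n + t * gap c0 ?n"
    unfolding depth by (simp add: gap_def pt_def algebra_simps)
  moreover have "t * \<rho> \<le> t * gap c0 ?n" using gap0[of ?n] dir(1)[of "pt t"] t by (intro mult_left_mono) auto
  moreover have "t * \<rho> / 2 < t * \<rho>" using t \<open>t \<noteq> 0\<close> \<rho> by simp
  ultimately have "(1 - t) * gap x ?n < 0" using t(3) by linarith
  then have "gap x ?n < 0" using t by (simp add: mult_less_0_iff)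
  then show thesis using that[OF reg[OF pos]] by (simp add: gap_def)
qed

section \<open>Segments as arguments\<close>

abbreviation seg :: "real ^ 3 \<Rightarrow> (real ^ 3) set" where
  "seg w \<equiv> closed_segment 0 w"

lemma compact_convex_seg: "compact_convex (closed_segment a b)"
  by (simp add: compact_convex_def)

lemma mem_scaled_seg:
  assumes "0 \<le> s"
  shows "x \<in> s \<cdot> seg w \<longleftrightarrow> (\<exists>t. 0 \<le> t \<and> t \<le> s \<and> x = t *\<^sub>R w)"
proof
  assume "x \<in> s \<cdot> seg w"
  then obtain u where "0 \<le> u" "u \<le> 1" "x = (s * u) *\<^sub>R w" by (auto simp: in_segment)
  then show "\<exists>t. 0 \<le> t \<and> t \<le> s \<and> x = t *\<^sub>R w" using assms mult_left_le by (intro exI[of _ "s * u"]) auto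
next
  assume "\<exists>t. 0 \<le> t \<and> t \<le> s \<and> x = t *\<^sub>R w"
  then obtain t where t: "0 \<le> t" "t \<le> s" "x = t *\<^sub>R w" by blast
  show "x \<in> s \<cdot> seg w"
  proof (cases "s = 0")
    case False
    then show ?thesis using t assms
      by (intro image_eqI[of _ _ "(t / s) *\<^sub>R w"]) (auto simp: in_segment intro!: exI[of _ "t / s"])
  qed (use t in auto)
qed

text \<open>The long segment is cut into Suc N translates of \<open>seg w\<close>.\<close>

lemma vol_plus_seg_le:
  assumes B: "compact_convex B"
  shows "vol (B + real (Suc N) \<cdot> seg w) \<le> real (Suc N) * vol (B + seg w)"
proof -
  have tr: "vol (B + seg w + {real j *\<^sub>R w}) = vol (B + seg w)" for j
    by (rule vol_plus_singleton)
  have C: "compact_convex (B + seg w + {real j *\<^sub>R w})" for j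
    using B by (intro compact_convex_intros compact_convex_seg)
  have "B + real (Suc N) \<cdot> seg w \<subseteq> (\<Union>j\<in>{..N}. B + seg w + {real j *\<^sub>R w})"
  proof
    fix x assume "x \<in> B + real (Suc N) \<cdot> seg w"
    then obtain b y where b: "b \<in> B" and y: "y \<in> real (Suc N) \<cdot> seg w" "x = b + y"
      by (rule set_plus_elim)
    then obtain t where t: "0 \<le> t" "t \<le> real (Suc N)" and x: "x = b + t *\<^sub>R w"
      using mem_scaled_seg[of "real (Suc N)" y w] by auto
    \<comment> \<open>The minimum with N handles t = Suc N, where the floor would name a piece
      beyond the last one.\<close>
    define j where "j = min N (nat \<lfloor>t\<rfloor>)"
    have "real j \<le> t" "t \<le> real j + 1"
      using t by (auto simp: j_def min_def) linarith+
    then have "(t - real j) *\<^sub>R w \<in> seg w"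
      by (auto simp: in_segment intro!: exI[of _ "t - real j"])
    with b have "b + (t - real j) *\<^sub>R w + real j *\<^sub>R w \<in> B + seg w + {real j *\<^sub>R w}"
      by (intro set_plus_intro) auto
    then have "x \<in> B + seg w + {real j *\<^sub>R w}" by (simp add: x algebra_simps)
    then show "x \<in> (\<Union>j\<in>{..N}. B + seg w + {real j *\<^sub>R w})" by (auto simp: j_def)
  qed
  then have "vol (B + real (Suc N) \<cdot> seg w) \<le> vol (\<Union>j\<in>{..N}. B + seg w + {real j *\<^sub>R w})"
    using C B by (intro measure_mono_fmeasurable fmeasurable.finite_UN)
      (auto intro!: compact_convexD(6) fmeasurableD compact_convex_intros compact_convex_seg)
  also have "\<dots> \<le> (\<Sum>j\<in>{..N}. vol (B + seg w + {real j *\<^sub>R w}))"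
    using C by (intro measure_UNION_le) (auto intro!: fmeasurableD compact_convexD(6))
  also have "\<dots> = real (Suc N) * vol (B + seg w)" by (simp add: tr)
  finally show ?thesis .
qed

text \<open>Doubling the segment multiplies its volume by 8, but at most by 2 according to
  \<open>vol_plus_seg_le\<close>.\<close>

lemma vol_seg: "vol (seg w) = 0"
proof -
  have "vol ({0} + real (Suc 1) \<cdot> seg w) \<le> real (Suc 1) * vol ({0} + seg w)"
    by (rule vol_plus_seg_le[OF compact_convex_singleton])
  moreover have "{0} + X = X" for X :: "(real ^ 3) set" by (auto simp: set_plus_def)
  ultimately have "8 * vol (seg w) \<le> 2 * vol (seg w)"
    using vol_scaled[of 2 "seg w"] by simp
  moreover have "0 \<le> vol (seg w)" by simp
  ultimately show ?thesis by linarith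
qed

text \<open>The volume of B plus a segment grows at most linearly in the length, so the quadratic
  coefficient vanishes. Hence that volume is affine in the length.\<close>

lemma mixed_volume_seg_seg:
  assumes B: "compact_convex B"
  shows "MV B (seg w) (seg w) = 0"
proof (rule antisym)
  note S = compact_convex_seg[of 0 w]
  let ?b = "MV B (seg w) (seg w)"
  show "0 \<le> ?b" by (rule mixed_volume_nonneg[OF B S])
  show "?b \<le> 0"
  proof (rule ccontr)
    assume "\<not> ?b \<le> 0"
    then have pos: "0 < ?b" by simp
    obtain N where N: "vol (B + seg w) / (3 * ?b) < real N" using reals_Archimedean2 by blast
    have "vol (B + real (Suc N) \<cdot> seg w) \<le> real (Suc N) * vol (B + seg w)"
      by (rule vol_plus_seg_le[OF B])
    moreover have "vol (B + real (Suc N) \<cdot> seg w) = vol B + 3 * real (Suc N) * MV B B (seg w)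
        + 3 * (real (Suc N))\<^sup>2 * ?b"
      using vol_plus_scaled[OF B S, of "real (Suc N)"] by (simp add: vol_seg)
    moreover have "0 \<le> vol B" "0 \<le> MV B B (seg w)"
      using mixed_volume_nonneg[OF S B] mixed_volume_rotate(2)[OF B B S] by simp_all
    ultimately have "3 * (real (Suc N))\<^sup>2 * ?b \<le> real (Suc N) * vol (B + seg w)"
      by (smt (verit) mult_nonneg_nonneg of_nat_0_le_iff)
    then have "real (Suc N) * (3 * real (Suc N) * ?b) \<le> real (Suc N) * vol (B + seg w)"
      by (simp add: power2_eq_square algebra_simps)
    then have "3 * real (Suc N) * ?b \<le> vol (B + seg w)" by simp
    moreover have "vol (B + seg w) < 3 * real N * ?b" using N pos by (simp add: field_simps)
    ultimately show False using pos by (simp add: algebra_simps)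
  qed
qed

lemma vol_plus_scaled_seg:
  assumes B: "compact_convex B" and s: "0 \<le> s"
  shows "vol (B + s \<cdot> seg w) = vol B + 3 * s * MV B B (seg w)"
  using vol_plus_scaled[OF B compact_convex_seg s, of 0 w] by (simp add: vol_seg mixed_volume_seg_seg B)

lemma mem_plus_singleton: "k \<in> K + {- a} \<longleftrightarrow> k + a \<in> K" for a :: "real ^ 3"
proof
  assume "k \<in> K + {- a}"
  then show "k + a \<in> K" by (auto simp: set_plus_def)
next
  assume "k + a \<in> K"
  then have "(k + a) + (- a) \<in> K + {- a}" by (intro set_plus_intro) auto
  then show "k \<in> K + {- a}" by simp
qed

text \<open>The sum of B and a long segment contains two disjoint translates of B, so its volume,
  affine in the length, has positive slope.\<close>

lemma mixed_volume_seg_pos: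
  assumes B: "compact_convex B" and v: "0 < vol B" and w: "w \<noteq> 0"
  shows "0 < MV B B (seg w)"
proof -
  obtain R where R: "0 < R" "\<And>b. b \<in> B \<Longrightarrow> norm b \<le> R"
    using compact_convex_norm_bound[OF B] by metis
  \<comment> \<open>A shift of length 3 R exceeds the diameter of B, which is at most 2 R.\<close>
  define s where "s = 3 * R / norm w"
  have s: "0 < s" using R w by (simp add: s_def)
  have disj: "B \<inter> (B + {s *\<^sub>R w}) = {}"
  proof (rule ccontr)
    assume "B \<inter> (B + {s *\<^sub>R w}) \<noteq> {}"
    then obtain b where "b \<in> B" "b + s *\<^sub>R w \<in> B" by (auto simp: set_plus_def)
    then have "norm (b + s *\<^sub>R w) + norm b \<le> R + R" by (intro add_mono R(2))
    then have "norm ((b + s *\<^sub>R w) - b) \<le> R + R"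
      using norm_triangle_ineq4[of "b + s *\<^sub>R w" b] by linarith
    then show False using R w by (simp add: s_def)
  qed
  have T: "compact_convex (B + {s *\<^sub>R w})" "compact_convex (B + s \<cdot> seg w)"
    using B by (auto intro!: compact_convex_intros compact_convex_seg)
  have sub: "B \<union> (B + {s *\<^sub>R w}) \<subseteq> B + s \<cdot> seg w"
  proof -
    have "0 \<in> s \<cdot> seg w" "s *\<^sub>R w \<in> s \<cdot> seg w" using s
      by (auto simp: mem_scaled_seg intro: exI[of _ 0] exI[of _ s])
    then have "{0} \<subseteq> s \<cdot> seg w" "{s *\<^sub>R w} \<subseteq> s \<cdot> seg w" by auto
    then have "B + {0} \<subseteq> B + s \<cdot> seg w" "B + {s *\<^sub>R w} \<subseteq> B + s \<cdot> seg w"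
      using set_plus_mono2[OF order_refl] by blast+
    then show ?thesis by simp
  qed
  have "2 * vol B = vol B + vol (B + {s *\<^sub>R w})" by (simp add: vol_plus_singleton)
  also have "\<dots> = vol (B \<union> (B + {s *\<^sub>R w}))"
    using compact_convexD(6)[OF B] compact_convexD(6)[OF T(1)] disj by (simp add: measure_Un3)
  also have "\<dots> \<le> vol (B + s \<cdot> seg w)"
    using B T sub by (intro measure_mono_fmeasurable) (simp_all add: fmeasurableD compact_convexD(6)
        sets.Un)
  also have "\<dots> = vol B + 3 * s * MV B B (seg w)"
    using vol_plus_scaled_seg[OF B, of s w] s by simp
  finally have "0 < s * MV B B (seg w)" using v by simp
  then show ?thesis using s by (simp add: zero_less_mult_iff)
qed

text \<open>
  The part of \<open>K\<close> near a regular boundary point \<open>q\<close> which is pushed out of \<open>K\<close> by the translation by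
  \<open>\<tau> n\<close> has volume at least linear in \<open>\<tau>\<close>: this translation maps the rest of a short capsule \<open>Q\<close>
  around \<open>q\<close> into \<open>Q \<inter> K\<close> and misses the bottom layer of \<open>Q\<close>.
\<close>

lemma boundary_layer_vol_ge:
  assumes K: "compact_convex K" and q: "regular_at K q n" and "0 < \<omega>"
  obtains c \<tau>0 where "0 < c" "0 < \<tau>0"
    "\<And>\<tau>. 0 < \<tau> \<Longrightarrow> \<tau> \<le> \<tau>0 \<Longrightarrow> c * \<tau> \<le> vol {k \<in> K \<inter> cball q \<omega>. k + \<tau> *\<^sub>R n \<notin> K}"
proof -
  obtain r where r: "0 < r" "cball (q - r *\<^sub>R n) r \<subseteq> K" and n: "norm n = 1" and qf: "n \<bullet> q = supp K n"
    using q by (auto simp: regular_at_def face_def)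
  have nn: "n \<bullet> n = 1" using n by (simp add: dot_square_norm)
  \<comment> \<open>The axis of the capsule \<open>Q\<close> runs from l below q to l above it, and
    its radius is l / 4. The bound by r keeps the bottom layer in the touching ball, the bound by
    \<open>\<omega>\<close> keeps all of \<open>Q\<close> within \<open>\<omega>\<close> of
    q.\<close>
  define l where "l = min (r / 2) (\<omega> / 8)"
  have l: "0 < l" "l \<le> r / 2" "l \<le> \<omega> / 8" using r \<open>0 < \<omega>\<close> by (auto simp: l_def)
  define Y where "Y = cball (q - l *\<^sub>R n) (l / 4)"
  have Y: "compact_convex Y" using l by (simp add: Y_def compact_convex_def)
  have vY: "0 < vol Y"
    using l by (simp add: Y_def content_cball_conv_ball content_ball_pos)
  define c where "c = 3 * MV Y Y (seg n)"
  have c: "0 < c" unfolding c_def using mixed_volume_seg_pos[OF Y vY, of n] n by force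
  define Q where "Q = Y + (2 * l) \<cdot> seg n"
  have Q: "compact_convex Q" unfolding Q_def by (intro compact_convex_intros compact_convex_seg Y)
  have mem_cyl: "x \<in> Y + t \<cdot> seg n \<longleftrightarrow> (\<exists>e u. norm e \<le> l / 4 \<and> 0 \<le> u \<and> u \<le> t \<and> x = q - l *\<^sub>R n + e + u *\<^sub>R n)"
    if t: "0 \<le> t" for x t
  proof
    assume "x \<in> Y + t \<cdot> seg n"
    then obtain y z where "y \<in> Y" "z \<in> t \<cdot> seg n" "x = y + z" by (rule set_plus_elim)
    moreover then obtain u where "0 \<le> u" "u \<le> t" "z = u *\<^sub>R n" using mem_scaled_seg[OF t, of z n] by auto
    ultimately show "\<exists>e u. norm e \<le> l / 4 \<and> 0 \<le> u \<and> u \<le> t \<and> x = q - l *\<^sub>R n + e + u *\<^sub>R n"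
      by (intro exI[of _ "y - (q - l *\<^sub>R n)"] exI[of _ u]) (auto simp: Y_def dist_norm norm_minus_commute)
  next
    assume "\<exists>e u. norm e \<le> l / 4 \<and> 0 \<le> u \<and> u \<le> t \<and> x = q - l *\<^sub>R n + e + u *\<^sub>R n"
    then obtain e u where e: "norm e \<le> l / 4" "0 \<le> u" "u \<le> t" "x = q - l *\<^sub>R n + e + u *\<^sub>R n" by blast
    have "q - l *\<^sub>R n + e \<in> Y" using e by (simp add: Y_def dist_norm)
    moreover have "u *\<^sub>R n \<in> t \<cdot> seg n" using e mem_scaled_seg[OF t] by blast
    ultimately show "x \<in> Y + t \<cdot> seg n" unfolding e(4) by (rule set_plus_intro)
  qed
  \<comment> \<open>The bottom layer of the capsule lies in K, and by \<open>high\<close> K has no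
    point in the column above the capsule.\<close>
  have low: "q - l *\<^sub>R n + e + u *\<^sub>R n \<in> K" if "norm e \<le> l / 4" "0 \<le> u" "u \<le> l / 4" for e u
  proof (rule subsetD[OF r(2)])
    have "norm ((q - l *\<^sub>R n + e + u *\<^sub>R n) - (q - r *\<^sub>R n)) = norm ((r - l + u) *\<^sub>R n + e)"
      by (simp add: algebra_simps)
    also have "\<dots> \<le> norm ((r - l + u) *\<^sub>R n) + norm e" by (rule norm_triangle_ineq)
    also have "\<dots> = \<bar>r - l + u\<bar> + norm e" using n by simp
    also have "\<dots> \<le> r" using that l by (auto simp: abs_if)
    finally show "q - l *\<^sub>R n + e + u *\<^sub>R n \<in> cball (q - r *\<^sub>R n) r"
      unfolding mem_cball dist_norm by (subst norm_minus_commute)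
  qed
  have high: "q - l *\<^sub>R n + e + u *\<^sub>R n \<notin> K" if "norm e \<le> l / 4" "2 * l < u" for e u
  proof
    assume "q - l *\<^sub>R n + e + u *\<^sub>R n \<in> K"
    from supp_ge[OF K this, of n] have "u - l \<le> - (n \<bullet> e)"
      by (simp add: inner_add_right inner_diff_right nn qf)
    also have "\<dots> \<le> norm e" using norm_cauchy_schwarz[of "- n" e] n by simp
    finally show False using that l by simp
  qed
  show thesis
  proof (rule that[OF c])
    show "0 < l / 4" using l by simp
    fix \<tau> :: real assume \<tau>: "0 < \<tau>" "\<tau> \<le> l / 4"
    define T where "T = {k \<in> K \<inter> cball q \<omega>. k + \<tau> *\<^sub>R n \<notin> K}"
    define Q' where "Q' = Q + {\<tau> *\<^sub>R n}"
    define Z where "Z = Q - Q'"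
    \<comment> \<open>The part of \<open>Q \<inter> K\<close> that stays in K when translated; its
      image lies in \<open>Q \<inter> K\<close> and avoids \<open>Z\<close>.\<close>
    define W where "W = Q \<inter> K \<inter> (K + {- (\<tau> *\<^sub>R n)})"
    note mem_K = mem_plus_singleton[of _ K "\<tau> *\<^sub>R n"]
    have Q': "compact_convex Q'" unfolding Q'_def by (intro compact_convex_intros Q)
    have meas: "Z \<in> lmeasurable" "W \<in> lmeasurable" "Q \<inter> K \<in> lmeasurable" "T \<in> lmeasurable"
    proof -
      have Km: "K + {- (\<tau> *\<^sub>R n)} \<in> lmeasurable" "K \<in> lmeasurable" "Q \<in> lmeasurable" "Q' \<in> lmeasurable"
        using K Q Q' by (auto intro!: compact_convexD(6) compact_convex_intros)
      then show "Z \<in> lmeasurable" "W \<in> lmeasurable" "Q \<inter> K \<in> lmeasurable"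
        unfolding Z_def W_def by auto
      have "T = K \<inter> cball q \<omega> - (K + {- (\<tau> *\<^sub>R n)})" by (auto simp: T_def mem_K)
      then show "T \<in> lmeasurable" using Km by (simp add: fmeasurable.Int fmeasurable_Diff fmeasurableD)
    qed
    \<comment> \<open>The volume of Y plus a segment is affine in the length with slope c, and
      lengthening the capsule by \<open>\<tau>\<close> gains at most \<open>Z\<close>, since the
      rest is covered by the translate \<open>Q'\<close>.\<close>
    have c\<tau>: "c * \<tau> \<le> vol Z"
    proof -
      have "Y + (2 * l + \<tau>) \<cdot> seg n \<subseteq> Z \<union> Q'"
      proof
        fix x assume "x \<in> Y + (2 * l + \<tau>) \<cdot> seg n"
        then obtain e u where e: "norm e \<le> l / 4" "0 \<le> u" "u \<le> 2 * l + \<tau>" "x = q - l *\<^sub>R n + e + u *\<^sub>R n"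
          using mem_cyl[of "2 * l + \<tau>" x] l \<tau> by auto
        show "x \<in> Z \<union> Q'"
        proof (cases "u \<le> 2 * l")
          case True
          then have "x \<in> Q" using mem_cyl[of "2 * l" x] l e by (auto simp: Q_def)
          then show ?thesis by (auto simp: Z_def)
        next
          case False
          then have "q - l *\<^sub>R n + e + (u - \<tau>) *\<^sub>R n \<in> Q"
            using mem_cyl[of "2 * l" "q - l *\<^sub>R n + e + (u - \<tau>) *\<^sub>R n"] l e \<tau>
            by (auto simp: Q_def intro!: exI[of _ e] exI[of _ "u - \<tau>"])
          then have "q - l *\<^sub>R n + e + (u - \<tau>) *\<^sub>R n + \<tau> *\<^sub>R n \<in> Q'" unfolding Q'_def
            by (intro set_plus_intro) auto
          then have "x \<in> Q'" by (simp add: e(4) algebra_simps)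
          then show ?thesis by simp
        qed
      qed
      then have "vol (Y + (2 * l + \<tau>) \<cdot> seg n) \<le> vol (Z \<union> Q')"
        using Y Q' meas by (intro measure_mono_fmeasurable)
          (simp_all add: fmeasurableD compact_convexD(6) compact_convex_intros compact_convex_seg
              fmeasurable.Un)
      also have "\<dots> \<le> vol Z + vol Q'"
        using meas Q' by (intro measure_Un_le) (auto intro!: fmeasurableD compact_convexD(6))
      also have "vol Q' = vol Q" by (simp add: Q'_def vol_plus_singleton)
      finally show ?thesis
        using vol_plus_scaled_seg[OF Y, of "2 * l + \<tau>" n] vol_plus_scaled_seg[OF Y, of "2 * l" n] l \<tau>
        by (simp add: Q_def c_def algebra_simps)
    qed
    have 1: "vol (Q \<inter> K) \<le> vol W + vol T"
    proof -
      have "Q \<inter> K \<subseteq> W \<union> T"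
      proof
        fix x assume x: "x \<in> Q \<inter> K"
        then obtain e u where e: "norm e \<le> l / 4" "0 \<le> u" "u \<le> 2 * l" "x = q - l *\<^sub>R n + e + u *\<^sub>R n"
          using mem_cyl[of "2 * l" x] l by (auto simp: Q_def)
        have "norm (x - q) = norm ((u - l) *\<^sub>R n + e)" by (simp add: e(4) algebra_simps)
        also have "\<dots> \<le> norm ((u - l) *\<^sub>R n) + norm e" by (rule norm_triangle_ineq)
        also have "\<dots> \<le> \<omega>" using e l n by (auto simp: abs_if)
        finally have "x \<in> cball q \<omega>" by (simp add: dist_norm norm_minus_commute)
        then show "x \<in> W \<union> T" using x by (auto simp: W_def T_def mem_K)
      qed
      then have "vol (Q \<inter> K) \<le> vol (W \<union> T)"
        using meas by (intro measure_mono_fmeasurable) (auto intro!: fmeasurableD)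
      also have "\<dots> \<le> vol W + vol T" using meas by (intro measure_Un_le) (auto intro!: fmeasurableD)
      finally show ?thesis .
    qed
    have 2: "vol W + vol Z \<le> vol (Q \<inter> K)"
    proof -
      let ?W = "W + {\<tau> *\<^sub>R n}"
      have W': "?W = (+) (\<tau> *\<^sub>R n) ` W" by (auto simp: set_plus_def add.commute)
      have mW: "?W \<in> lmeasurable" unfolding W' using meas by (simp add: measurable_translation)
      have "?W \<subseteq> Q \<inter> K"
      proof
        fix x assume "x \<in> ?W"
        then obtain k where k: "k \<in> W" "x = k + \<tau> *\<^sub>R n" by (auto simp: set_plus_def)
        then have kQ: "k \<in> Q" and xK: "x \<in> K" by (auto simp: W_def mem_K)
        then obtain e u where e: "norm e \<le> l / 4" "0 \<le> u" "u \<le> 2 * l" "k = q - l *\<^sub>R n + e + u *\<^sub>R n"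
          using mem_cyl[of "2 * l" k] l by (auto simp: Q_def)
        have x: "x = q - l *\<^sub>R n + e + (u + \<tau>) *\<^sub>R n" by (simp add: k e(4) algebra_simps)
        then have "u + \<tau> \<le> 2 * l" using high[of e "u + \<tau>"] e xK by force
        then have "x \<in> Q" using mem_cyl[of "2 * l" x] l e x \<tau> unfolding Q_def by force
        then show "x \<in> Q \<inter> K" using xK by simp
      qed
      moreover have "Z \<subseteq> Q \<inter> K"
      proof
        fix x assume x: "x \<in> Z"
        then obtain e u where e: "norm e \<le> l / 4" "0 \<le> u" "u \<le> 2 * l" "x = q - l *\<^sub>R n + e + u *\<^sub>R n"
          using mem_cyl[of "2 * l" x] l by (auto simp: Q_def Z_def)
        have "u < \<tau>"
        proof (rule ccontr)
          assume "\<not> u < \<tau>"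
          then have "q - l *\<^sub>R n + e + (u - \<tau>) *\<^sub>R n \<in> Q"
            using mem_cyl[of "2 * l" "q - l *\<^sub>R n + e + (u - \<tau>) *\<^sub>R n"] l e \<tau>
            by (auto simp: Q_def intro!: exI[of _ e] exI[of _ "u - \<tau>"])
          then have "q - l *\<^sub>R n + e + (u - \<tau>) *\<^sub>R n + \<tau> *\<^sub>R n \<in> Q'" unfolding Q'_def
            by (intro set_plus_intro) auto
          then show False using x by (simp add: e(4) algebra_simps Z_def)
        qed
        then have "x \<in> K" using low[of e u] e \<tau> by simp
        then show "x \<in> Q \<inter> K" using x by (simp add: Z_def)
      qed
      moreover have "?W \<inter> Z = {}"
        unfolding Z_def Q'_def W_def using set_plus_mono2[of W Q "{\<tau> *\<^sub>R n}" "{\<tau> *\<^sub>R n}"]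
          by (auto simp: W_def)
      ultimately have "vol (?W \<union> Z) \<le> vol (Q \<inter> K)" "vol (?W \<union> Z) = vol ?W + vol Z"
        using meas mW measure_mono_fmeasurable[of "?W \<union> Z" "Q \<inter> K" lebesgue] measure_Un3[OF mW meas(1)]
        by (simp_all add: fmeasurableD sets.Un)
      then show ?thesis using vol_plus_singleton by simp
    qed
    show "c * \<tau> \<le> vol {k \<in> K \<inter> cball q \<omega>. k + \<tau> *\<^sub>R n \<notin> K}"
      using c\<tau> 1 2 by (simp add: T_def)
  qed
qed

text \<open>Let p be a highest point of \<open>L'\<close> in direction n. Shifting by s p carries a
  boundary layer of K at q, of width proportional to s, out of \<open>K + s \<cdot> L\<close> but
  not out of \<open>K + s \<cdot> L'\<close>. By \<open>boundary_layer_vol_ge\<close> the gain in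
  volume is at least linear in s.\<close>

lemma mixed_volume_strict_mono:
  assumes K: "compact_convex K" and q: "regular_at K q n"
    and L: "compact_convex L" and L': "compact_convex L'" and sub: "L \<subseteq> L'"
    and lt: "supp L n < supp L' n"
  shows "MV L K K < MV L' K K"
proof -
  have n: "norm n = 1" using q by (auto simp: regular_at_def)
  obtain p where p: "p \<in> L'" "n \<bullet> p = supp L' n" using supp_attained[OF L'] by metis
  \<comment> \<open>Half of the gap at n, so that by continuity a gap \<open>\<eta>\<close> persists
    in all directions near n.\<close>
  define \<eta> where "\<eta> = (n \<bullet> p - supp L n) / 2"
  have \<eta>: "0 < \<eta>" using lt p by (simp add: \<eta>_def)
  have "continuous (at n) (\<lambda>v. v \<bullet> p - supp L v)"
    using continuous_on_supp[OF L, of UNIV]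
    by (intro continuous_intros) (simp add: continuous_on_eq_continuous_at)
  then obtain \<rho> where \<rho>: "0 < \<rho>" "\<And>v. dist v n < \<rho> \<Longrightarrow> dist (v \<bullet> p - supp L v) (n \<bullet> p - supp L n) < \<eta>"
    using \<eta> unfolding continuous_at_eps_delta by metis
  have near: "\<eta> < v \<bullet> p - supp L v" if "norm (v - n) < \<rho>" for v
    using \<rho>(2)[of v] that by (simp add: dist_norm \<eta>_def abs_if split: if_splits)
  obtain \<omega> where \<omega>: "0 < \<omega>" "\<And>v. norm v = 1 \<Longrightarrow> supp K v < v \<bullet> q + \<omega> \<Longrightarrow> norm (v - n) < \<rho>"
    using regular_normal_near[OF K q \<rho>(1)] by metis
  obtain c \<tau>0 where c: "0 < c" "0 < \<tau>0"
    and layer: "\<And>\<tau>. 0 < \<tau> \<Longrightarrow> \<tau> \<le> \<tau>0 \<Longrightarrow> c * \<tau> \<le> vol {k \<in> K \<inter> cball q (\<omega> / 3). k + \<tau> *\<^sub>R n \<notin> K}"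
    using boundary_layer_vol_ge[OF K q, of "\<omega> / 3"] \<omega>(1) by auto
  define s0 where "s0 = min (\<tau>0 / \<eta>) (\<omega> / (3 * \<eta>))"
  have s0: "0 < s0" using c \<omega> \<eta> by (simp add: s0_def)
  have main: "vol (K + s \<cdot> L) + c * \<eta> * s \<le> vol (K + s \<cdot> L')" if s: "0 < s" "s \<le> s0" for s
  proof -
    let ?\<tau> = "s * \<eta>"
    have \<tau>: "0 < ?\<tau>" "?\<tau> \<le> \<tau>0" "?\<tau> \<le> \<omega> / 3"
      using s \<eta> c \<omega> by (auto simp: s0_def field_simps)
    define T where "T = {k \<in> K \<inter> cball q (\<omega> / 3). k + ?\<tau> *\<^sub>R n \<notin> K}"
    have Tm: "T \<in> lmeasurable"
    proof -
      have "T = K \<inter> cball q (\<omega> / 3) - (K + {- (?\<tau> *\<^sub>R n)})"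
        by (auto simp: T_def mem_plus_singleton)
      moreover have "K \<in> lmeasurable" "K + {- (?\<tau> *\<^sub>R n)} \<in> lmeasurable"
        using K by (auto intro!: compact_convexD(6) compact_convex_intros)
      ultimately show ?thesis by (simp add: fmeasurable.Int fmeasurable_Diff fmeasurableD)
    qed
    let ?T = "T + {s *\<^sub>R p}"
    have T': "?T = (+) (s *\<^sub>R p) ` T" by (auto simp: set_plus_def add.commute)
    have T'm: "?T \<in> lmeasurable" unfolding T' using Tm by (simp add: measurable_translation)
    have CL: "compact_convex (K + s \<cdot> L)" "compact_convex (K + s \<cdot> L')"
      using K L L' by (auto intro!: compact_convex_intros)
    have "?T \<subseteq> K + s \<cdot> L'"
      using p by (intro set_plus_mono2) (auto simp: T_def)
    moreover have "K + s \<cdot> L \<subseteq> K + s \<cdot> L'" using sub by (intro set_plus_mono2) auto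
    moreover have "?T \<inter> (K + s \<cdot> L) = {}"
    proof (rule ccontr)
      assume "?T \<inter> (K + s \<cdot> L) \<noteq> {}"
      then obtain k where k: "k \<in> T" "k + s *\<^sub>R p \<in> K + s \<cdot> L" by (auto simp: set_plus_def)
      then have "k + ?\<tau> *\<^sub>R n \<notin> K" by (simp add: T_def)
      \<comment> \<open>The direction separating the shifted point from K almost attains
        \<open>supp K\<close> at q, hence is close to n. There the gap \<open>\<eta>\<close> between
        p and L outweighs the shift by \<open>\<tau>\<close>, so the point cannot lie in
        \<open>K + s \<cdot> L\<close>.\<close>
      then obtain w where w: "supp K w < w \<bullet> (k + ?\<tau> *\<^sub>R n)"
        using mem_iff_supp[OF K] by (meson not_le)
      then have "w \<noteq> 0" using supp_zero[OF K] by auto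
      define v where "v = w /\<^sub>R norm w"
      have v: "norm v = 1" using \<open>w \<noteq> 0\<close> by (simp add: v_def)
      have "supp K v = supp K w / norm w" by (simp add: v_def supp_scaleR[OF K] divide_inverse_commute)
      also have "\<dots> < (w \<bullet> (k + ?\<tau> *\<^sub>R n)) / norm w" using w \<open>w \<noteq> 0\<close> by (simp add: divide_strict_right_mono)
      also have "\<dots> = v \<bullet> (k + ?\<tau> *\<^sub>R n)" by (simp add: v_def divide_inverse_commute)
      finally have sv: "supp K v < v \<bullet> k + ?\<tau> * (v \<bullet> n)" by (simp add: inner_add_right)
      have vn: "v \<bullet> n \<le> 1" using norm_cauchy_schwarz[of v n] v n by simp
      have "?\<tau> * (v \<bullet> n) \<le> ?\<tau> * 1" using vn \<tau>(1) by (intro mult_left_mono) auto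
      then have sv: "supp K v < v \<bullet> k + ?\<tau>" using sv by simp
      have "v \<bullet> (k - q) \<le> \<omega> / 3"
        using norm_cauchy_schwarz[of v "k - q"] v k by (simp add: T_def dist_norm norm_minus_commute)
      then have "supp K v < v \<bullet> q + \<omega>" using sv \<tau>(3) \<omega>(1) by (simp add: inner_diff_right)
      then have "\<eta> < v \<bullet> p - supp L v" using \<omega>(2) near v by blast
      then have "?\<tau> < s * (v \<bullet> p) - s * supp L v" using s by (simp flip: right_diff_distrib)
      moreover have "v \<bullet> (k + s *\<^sub>R p) \<le> supp K v + s * supp L v"
        using supp_ge[OF CL(1) k(2), of v] K L s by (simp add: supp_simps compact_convex_intros)
      ultimately show False using sv by (simp add: inner_add_right)
    qed
    ultimately have "vol ?T + vol (K + s \<cdot> L) \<le> vol (K + s \<cdot> L')"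
      using T'm CL measure_Un3[OF T'm compact_convexD(6)[OF CL(1)]]
        measure_mono_fmeasurable[of "?T \<union> (K + s \<cdot> L)" "K + s \<cdot> L'" lebesgue]
      by (simp add: compact_convexD(6) fmeasurableD sets.Un)
    moreover have "c * ?\<tau> \<le> vol ?T" using layer[OF \<tau>(1,2)] vol_plus_singleton by (simp add: T_def)
    ultimately show ?thesis by (simp add: algebra_simps)
  qed
  have "0 \<le> (3 * (MV K K L' - MV K K L) - c * \<eta>) + (3 * s0 * (MV K L' L' - MV K L L)) * s
      + (s0\<^sup>2 * (vol L' - vol L)) * s\<^sup>2"
    if s: "0 < s" "s \<le> 1" for s
  proof -
    have "0 < s0 * s" "s0 * s \<le> s0" using s s0 by auto
    from main[OF this] have "0 \<le> (s0 * s) * ((3 * (MV K K L' - MV K K L) - c * \<eta>)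
        + (3 * s0 * (MV K L' L' - MV K L L)) * s + (s0\<^sup>2 * (vol L' - vol L)) * s\<^sup>2)"
      using K L L' s s0 by (simp add: vol_plus_scaled) (simp add: algebra_simps power2_eq_square
          power3_eq_cube)
    then show ?thesis using \<open>0 < s0 * s\<close> by (simp add: zero_le_mult_iff)
  qed
  then have "0 \<le> 3 * (MV K K L' - MV K K L) - c * \<eta>" by (rule nonneg_at_0_of_quadratic)
  moreover have "0 < c * \<eta>" using c \<eta> by simp
  ultimately have "MV K K L < MV K K L'" by simp
  then show ?thesis using K L L' by (simp add: mixed_volume_rotate(2)[of K K])
qed

section \<open>Valuation property and disjoint perturbations\<close>

text \<open>
  A point of \<open>U\<close> outside both \<open>P\<close> and \<open>Q\<close> is cut off by vectors \<open>v\<close> and \<open>w\<close>; by convexity of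
  \<open>supp I\<close> every vector between them cuts it off from \<open>P\<close> or from \<open>Q\<close>, and the one at which the two
  support functions agree even from \<open>U\<close>.
\<close>

lemma vol_Un_Int_supp:
  assumes P: "compact_convex P" and Q: "compact_convex Q" and U: "compact_convex U"
    and I: "compact_convex I"
    and max: "\<And>v. supp U v = max (supp P v) (supp Q v)" and min: "\<And>v. supp I v = min (supp P v) (supp Q v)"
  shows "vol P + vol Q = vol U + vol I"
proof -
  have "P \<inter> Q = I"
  proof
    show "P \<inter> Q \<subseteq> I" using mem_iff_supp[OF P] mem_iff_supp[OF Q] mem_iff_supp[OF I] min by auto
    show "I \<subseteq> P \<inter> Q" using subset_iff_supp[OF I P] subset_iff_supp[OF I Q] min by auto
  qed
  moreover have "P \<union> Q = U"
  proof
    show "P \<union> Q \<subseteq> U" using subset_iff_supp[OF P U] subset_iff_supp[OF Q U] max by auto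
    show "U \<subseteq> P \<union> Q"
    proof (rule subsetI, rule ccontr)
      fix z assume z: "z \<in> U" "z \<notin> P \<union> Q"
      obtain v w where v: "supp P v < v \<bullet> z" and w: "supp Q w < w \<bullet> z"
        using z mem_iff_supp[OF P] mem_iff_supp[OF Q] by (auto simp: not_le)
      have zU: "x \<bullet> z \<le> max (supp P x) (supp Q x)" for x
        using mem_iff_supp[OF U] z(1) by (simp add: max)
      have vI: "supp I v < v \<bullet> z" and wI: "supp I w < w \<bullet> z" using v w by (simp_all add: min)
      define x where "x t = (1 - t) *\<^sub>R v + t *\<^sub>R w" for t :: real
      have "\<exists>t. 0 \<le> t \<and> t \<le> 1 \<and> supp P (x t) - supp Q (x t) = 0"
        using v w zU[of v] zU[of w]
        by (intro IVT') (auto simp: x_def intro!: continuous_intros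
            continuous_on_compose2[OF continuous_on_supp[OF P]] continuous_on_compose2[OF
                continuous_on_supp[OF Q]])
      then obtain t where t: "0 \<le> t" "t \<le> 1" and eq: "supp P (x t) = supp Q (x t)" by auto
      have "supp I (x t) \<le> (1 - t) * supp I v + t * supp I w"
        using supp_add_le[OF I, of "(1 - t) *\<^sub>R v" "t *\<^sub>R w"] t by (simp add: x_def supp_scaleR[OF I])
      also have "\<dots> < (1 - t) * (v \<bullet> z) + t * (w \<bullet> z)"
        using t vI wI by (cases "t = 0") (auto intro!: add_le_less_mono mult_left_mono)
      also have "\<dots> = x t \<bullet> z" by (simp add: x_def inner_add_left)
      finally show False using zU[of "x t"] by (simp add: min eq)
    qed
  qed
  ultimately show ?thesis
    using measure_Un3[OF compact_convexD(6)[OF P] compact_convexD(6)[OF Q]] by simp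
qed

text \<open>In every direction one of the two perturbations is invisible, so the support functions
  of B + L and A + M are the maximum and minimum of those of A + B and L + M. The valuation
  property, applied after adding s Y to all four sums, gives the claim as the coefficient of
  s.\<close>

lemma mixed_volume_disjoint:
  assumes A: "compact_convex A" and B: "compact_convex B" and L: "compact_convex L"
    and M: "compact_convex M"
    and Y: "compact_convex Y" and AL: "A \<subseteq> L" and MB: "M \<subseteq> B"
    and disj: "\<And>v. supp A v = supp L v \<or> supp B v = supp M v"
  shows "MV A B Y + MV L M Y = MV A M Y + MV B L Y"
proof -
  have le: "supp A v \<le> supp L v" "supp M v \<le> supp B v" for v
    using AL MB subset_iff_supp A B L M by metis+
  have e: "MV (S + T) (S + T) Y = MV S S Y + 2 * MV S T Y + MV T T Y"
    if "compact_convex S" "compact_convex T" for S T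
    using that Y mixed_volume_commute(1)[of T S Y] by (simp add: mixed_volume_linear compact_convex_plus)
  define f where "f S s = vol S + 3 * s * MV S S Y + 3 * s\<^sup>2 * MV S Y Y + s ^ 3 * vol Y" for S s
  have f: "vol (S + s \<cdot> Y) = f S s" if "compact_convex S" "0 \<le> s" for S s
    using vol_plus_scaled[OF that(1) Y that(2)] by (simp add: f_def)
  have *: "f (A + B) s + f (L + M) s = f (B + L) s + f (A + M) s" if s: "0 \<le> s" for s
  proof -
    have "vol (A + B + s \<cdot> Y) + vol (L + M + s \<cdot> Y) = vol (B + L + s \<cdot> Y) + vol (A + M + s \<cdot> Y)"
    proof (rule vol_Un_Int_supp)
      fix v
      show "supp (B + L + s \<cdot> Y) v = max (supp (A + B + s \<cdot> Y) v) (supp (L + M + s \<cdot> Y) v)"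
        "supp (A + M + s \<cdot> Y) v = min (supp (A + B + s \<cdot> Y) v) (supp (L + M + s \<cdot> Y) v)"
        using A B L M Y s le[of v] disj[of v] by (auto simp: supp_simps compact_convex_intros)
    qed (intro compact_convex_intros A B L M Y)+
    then show ?thesis using A B L M s by (simp add: f compact_convex_plus)
  qed
  \<comment> \<open>The terms cubic in s cancel, so three values determine the remaining
    coefficients.\<close>
  from *[of 0] *[of 1] *[of 2]
  have "MV (A + B) (A + B) Y + MV (L + M) (L + M) Y = MV (B + L) (B + L) Y + MV (A + M) (A + M) Y"
    by (simp add: f_def)
  then show ?thesis using A B L M by (simp add: e)
qed

text \<open>L is K itself or the base of a cone K; \<open>ker\<close> allows it to stand for K.
  Writing a and b for V(A,K,K) and V(B,K,K), disjointness gives V(A,B,K) = a + b - V(K), and the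
  Bezout inequality becomes (V(K) - a) (V(K) - b) \<ge> 0.\<close>

lemma bezout_disjoint:
  assumes bez: "bezout K" and K: "compact_convex K" and L: "compact_convex L"
    and ker: "\<And>X. compact_convex X \<Longrightarrow> MV L X K = MV X K K"
    and A: "compact_convex A" and B: "compact_convex B" and AL: "A \<subseteq> L" and LB: "L \<subseteq> B"
    and disj: "\<And>v. supp A v = supp L v \<or> supp B v = supp L v"
  shows "\<not> (MV A K K < vol K \<and> vol K < MV B K K)"
proof
  assume lt: "MV A K K < vol K \<and> vol K < MV B K K"
  have "MV L L K = vol K" using ker[OF L] ker[OF K] K by (simp add: mixed_volume_diagonal)
  then have "MV A B K = MV A K K + MV B K K - vol K"
    using mixed_volume_disjoint[OF A B L L K AL LB disj] ker[OF A] ker[OF B]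
      mixed_volume_commute(1)[OF A L K] mixed_volume_commute(1)[OF B L K] by simp
  then have "(MV A K K + MV B K K - vol K) * vol K \<le> MV A K K * MV B K K"
    using bezoutD[OF bez A B] by simp
  then have "0 \<le> (vol K - MV A K K) * (vol K - MV B K K)" by (simp add: algebra_simps)
  moreover have "(vol K - MV A K K) * (vol K - MV B K K) < 0" using lt by (intro mult_pos_neg) auto
  ultimately show False by simp
qed

lemma compact_convex_face:
  assumes K: "compact_convex K"
  shows "compact_convex (face K n)"
proof -
  have "face K n = K \<inter> {z. n \<bullet> z = supp K n}" by (auto simp: face_def)
  moreover have "face K n \<noteq> {}" using supp_attained[OF K, of n] by (auto simp: face_def)
  ultimately show ?thesis
    using K closed_hyperplane[of n "supp K n"] convex_hyperplane[of n "supp K n"]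
    by (auto simp: compact_convex_def convex_Int)
qed

lemma compact_convex_cut:
  assumes K: "compact_convex K" and "K \<inter> {z. n \<bullet> z \<le> c} \<noteq> {}"
  shows "compact_convex (K \<inter> {z. n \<bullet> z \<le> c})"
  using assms closed_halfspace_le[of n c] convex_halfspace_le[of n c]
  by (auto simp: compact_convex_def convex_Int)

lemma compact_convex_insert:
  assumes K: "compact_convex K"
  shows "compact_convex (convex hull (insert x K))"
  using K by (auto simp: compact_convex_def compact_convex_hull)

lemma supp_insert:
  assumes K: "compact_convex K"
  shows "supp (convex hull (insert x K)) v = max (supp K v) (v \<bullet> x)"
proof (rule antisym)
  note C = compact_convex_insert[OF K, of x]
  have "convex hull (insert x K) \<subseteq> {z. v \<bullet> z \<le> max (supp K v) (v \<bullet> x)}"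
    using supp_ge[OF K] by (intro hull_minimal convex_halfspace_le) (auto simp: le_max_iff_disj)
  then show "supp (convex hull (insert x K)) v \<le> max (supp K v) (v \<bullet> x)"
    by (intro supp_le[OF C]) auto
  have "K \<subseteq> convex hull (insert x K)" "x \<in> convex hull (insert x K)"
    by (auto simp: hull_inc)
  then show "max (supp K v) (v \<bullet> x) \<le> supp (convex hull (insert x K)) v"
    using subset_iff_supp[OF K C] supp_ge[OF C, of x v] by simp
qed

lemma face_disjoint_cut:
  assumes K: "compact_convex K" and C: "compact C" and disj: "face K n \<inter> C = {}" and CK: "C \<subseteq> K"
  obtains \<epsilon> where "0 < \<epsilon>" "\<And>z. z \<in> C \<Longrightarrow> n \<bullet> z \<le> supp K n - \<epsilon>"
proof (cases "C = {}")
  case True then show ?thesis using that[of 1] by simp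
next
  case False
  have "\<exists>x\<in>C. \<forall>y\<in>C. n \<bullet> y \<le> n \<bullet> x"
    using C False by (intro continuous_attains_sup continuous_intros)
  then obtain x where x: "x \<in> C" "\<And>y. y \<in> C \<Longrightarrow> n \<bullet> y \<le> n \<bullet> x" by blast
  have "n \<bullet> x \<noteq> supp K n" using x(1) disj CK by (auto simp: face_def)
  then have "n \<bullet> x < supp K n" using supp_ge[OF K, of x n] x(1) CK by force
  then show ?thesis using that[of "supp K n - n \<bullet> x"] x(2) by simp
qed

text \<open>Faces are upper semicontinuous: direction n leaves a margin \<open>\<epsilon>\<close> on
  C, and inner products and \<open>supp K\<close> change at most by R times the change of
  direction.\<close>

lemma face_near:
  assumes K: "compact_convex K" and C: "compact C" and disj: "face K n \<inter> C = {}" and CK: "C \<subseteq> K"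
  obtains \<rho> where "0 < \<rho>" "\<And>v. norm (v - n) < \<rho> \<Longrightarrow> face K v \<inter> C = {}"
proof -
  obtain \<epsilon> where \<epsilon>: "0 < \<epsilon>" "\<And>z. z \<in> C \<Longrightarrow> n \<bullet> z \<le> supp K n - \<epsilon>"
    using face_disjoint_cut[OF K C disj CK] by metis
  obtain R where R: "0 < R" "\<And>a. a \<in> K \<Longrightarrow> norm a \<le> R"
    using compact_convex_norm_bound[OF K] by metis
  show ?thesis
  proof (rule that)
    show "0 < \<epsilon> / (2 * R)" using \<epsilon> R by simp
    fix v assume v: "norm (v - n) < \<epsilon> / (2 * R)"
    show "face K v \<inter> C = {}"
    proof (rule ccontr)
      assume "face K v \<inter> C \<noteq> {}"
      then obtain z where z: "z \<in> face K v" "z \<in> C" by blast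
      have "\<bar>(v - n) \<bullet> z\<bar> \<le> norm (v - n) * R"
        using Cauchy_Schwarz_ineq2[of "v - n" z] R(2)[of z] z CK
        by (meson mult_left_mono norm_ge_zero order_trans subsetD)
      moreover have "\<bar>supp K v - supp K n\<bar> \<le> R * norm (v - n)" by (rule supp_diff_le[OF K R(2)])
      moreover have "norm (v - n) * R < \<epsilon> / 2" using v R by (simp add: field_simps)
      moreover have "v \<bullet> z = supp K v" using z by (simp add: face_def)
      ultimately have "supp K n - \<epsilon> < n \<bullet> z" by (simp add: inner_diff_left mult.commute abs_le_iff)
      then show False using \<epsilon>(2)[OF z(2)] by simp
    qed
  qed
qed

lemma supp_eq_if_face:
  assumes "compact_convex A" "compact_convex K" "A \<subseteq> K" "z \<in> A" "z \<in> face K v"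
  shows "supp A v = supp K v"
  using assms subset_iff_supp[of A K] supp_ge[of A z v] by (simp add: face_def antisym)

text \<open>
  If two regular faces are disjoint, cutting \<open>K\<close> near one of them and raising a pyramid over the
  other are disjoint perturbations.
\<close>

lemma regular_faces_meet:
  assumes K: "convex_body K" and bez: "bezout K" and p: "regular_at K p u" and q: "regular_at K q n"
  shows "face K u \<inter> face K n \<noteq> {}"
proof
  assume disj: "face K u \<inter> face K n = {}"
  note K' = convex_body_compact_convex[OF K]
  have qn: "norm n = 1" "q \<in> K" "n \<bullet> q = supp K n" "q \<in> face K n" using q
    by (auto simp: regular_at_def face_def)
  note Fn = compact_convex_face[OF K', of n]
  obtain \<epsilon> where \<epsilon>: "0 < \<epsilon>" "\<And>z. z \<in> face K n \<Longrightarrow> u \<bullet> z \<le> supp K u - \<epsilon>"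
    using face_disjoint_cut[OF K' compact_convexD(2)[OF Fn] disj] by (auto simp: face_def)
  let ?H = "{z. u \<bullet> z \<le> supp K u - \<epsilon> / 2}"
  define C where "C = K \<inter> {z. supp K u - \<epsilon> / 2 \<le> u \<bullet> z}"
  have C: "compact C" "C \<subseteq> K" using compact_convexD(2)[OF K'] closed_halfspace_ge[of "supp K u - \<epsilon> / 2" u]
    by (auto simp: C_def inner_commute)
  have "face K n \<inter> C = {}" using \<epsilon> by (force simp: C_def)
  then obtain \<rho> where \<rho>: "0 < \<rho>" "\<And>v. norm (v - n) < \<rho> \<Longrightarrow> face K v \<inter> C = {}"
    using face_near[OF K' C(1) _ C(2)] by metis
  obtain \<omega> where \<omega>: "0 < \<omega>" "\<And>v. norm v = 1 \<Longrightarrow> supp K v < v \<bullet> q + \<omega> \<Longrightarrow> norm (v - n) < \<rho>"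
    using regular_normal_near[OF K' q \<rho>(1)] by metis
  define A where "A = K \<inter> ?H"
  \<comment> \<open>A unit direction that sees x above K satisfies the bound with
    \<open>\<omega>\<close>, so it is near n and its face of K avoids the cap \<open>C\<close>. The
    set \<open>A\<close>, cut at half the margin, keeps this face and hence the support
    value.\<close>
  define x where "x = q + (\<omega> / 2) *\<^sub>R n"
  define B where "B = convex hull (insert x K)"
  have "q \<in> A" using \<epsilon>(1) \<epsilon>(2)[OF qn(4)] qn(2) by (simp add: A_def)
  then have A: "compact_convex A" unfolding A_def by (intro compact_convex_cut[OF K']) auto
  have B: "compact_convex B" unfolding B_def by (rule compact_convex_insert[OF K'])
  have AK: "A \<subseteq> K" by (simp add: A_def)
  have KB: "K \<subseteq> B" by (auto simp: B_def hull_inc)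
  have unit: "supp A v = supp K v" if v: "norm v = 1" "supp K v < v \<bullet> x" for v
  proof -
    have "v \<bullet> n \<le> 1" using norm_cauchy_schwarz[of v n] v qn by simp
    then have "\<omega> / 2 * (v \<bullet> n) < \<omega>" using \<omega>(1)
      by (smt (verit) mult_left_le half_gt_zero field_sum_of_halves)
    then have "supp K v < v \<bullet> q + \<omega>" using v(2) by (simp add: x_def inner_add_right)
    then have "face K v \<inter> C = {}" using \<omega>(2) \<rho>(2) v by blast
    moreover obtain z where "z \<in> face K v" using compact_convexD(1)[OF compact_convex_face[OF K']] by blast
    ultimately have "z \<in> A" "z \<in> face K v" by (auto simp: A_def C_def face_def)
    then show ?thesis by (rule supp_eq_if_face[OF A K' AK])
  qed
  have "supp A v = supp K v \<or> supp B v = supp K v" for v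
  proof (cases "supp K v < v \<bullet> x")
    case True
    then have v: "v \<noteq> 0" using supp_zero[OF K'] by auto
    let ?v = "inverse (norm v) *\<^sub>R v"
    have "supp K ?v < ?v \<bullet> x" using True v by (simp add: supp_scaleR[OF K'])
    then have "supp A ?v = supp K ?v" using v by (intro unit) auto
    then show ?thesis using v by (simp add: supp_scaleR[OF K'] supp_scaleR[OF A])
  qed (simp add: B_def supp_insert[OF K'])
  then have "\<not> (MV A K K < vol K \<and> vol K < MV B K K)"
    using K' A B AK KB by (intro bezout_disjoint[OF bez K' K']) (auto simp: mixed_volume_commute(1)[of K])
  moreover have "MV A K K < MV K K K"
  proof (rule mixed_volume_strict_mono[OF K' p A K' AK])
    show "supp A u < supp K u" using \<epsilon>(1)
      by (intro le_less_trans[OF supp_le[OF A, of u "supp K u - \<epsilon> / 2"]]) (auto simp: A_def)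
  qed
  moreover have "MV K K K < MV B K K"
  proof (rule mixed_volume_strict_mono[OF K' q K' B KB])
    have "n \<bullet> x = supp K n + \<omega> / 2" using qn by (simp add: x_def inner_add_right dot_square_norm)
    then show "supp K n < supp B n" using \<omega>(1) by (simp add: B_def supp_insert[OF K'])
  qed
  ultimately show False using K' by (simp add: mixed_volume_diagonal)
qed

section \<open>Configurations of regular faces\<close>

lemma mem_if_regular_normals:
  assumes "convex_body K" "\<And>n. n \<in> regular_normals K \<Longrightarrow> n \<bullet> x \<le> supp K n"
  shows "x \<in> K"
proof (rule ccontr)
  assume "x \<notin> K"
  then obtain q n where "regular_at K q n" "supp K n < n \<bullet> x"
    using exists_regular_excluding[OF assms(1)] by metis
  then show False using assms(2)[of n] by (auto simp: regular_normals_def)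
qed

lemma regular_normals_norm: "n \<in> regular_normals K \<Longrightarrow> norm n = 1"
  by (auto simp: regular_normals_def regular_at_def)

lemma regular_face_subset_imp_eq:
  assumes K: "compact_convex K" and n: "n \<in> regular_normals K" and m: "norm m = 1"
    and sub: "face K n \<subseteq> face K m"
  shows "m = n"
proof -
  obtain q where q: "regular_at K q n" using n by (auto simp: regular_normals_def)
  then have "m \<bullet> q = supp K m" using sub by (auto simp: regular_at_def face_def)
  from regular_normal_unique[OF K q this] m show ?thesis by simp
qed

section \<open>Cones over a regular face\<close>

lemma ray_leaves:
  assumes K: "compact_convex K" and w: "w \<noteq> 0"
  shows "\<exists>t\<ge>0. c + t *\<^sub>R w \<notin> K"
proof (rule ccontr)
  assume "\<not> ?thesis"
  then have ray: "c + t *\<^sub>R w \<in> K" if "0 \<le> t" for t using that by blast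
  obtain R where R: "0 < R" "\<And>a. a \<in> K \<Longrightarrow> norm a \<le> R"
    using compact_convex_norm_bound[OF K] by metis
  define t where "t = (R + norm c + 1) / norm w"
  have t: "0 \<le> t" using R by (simp add: t_def)
  have "norm (t *\<^sub>R w) \<le> norm (c + t *\<^sub>R w) + norm c"
    using norm_triangle_ineq4[of "c + t *\<^sub>R w" c] by simp
  then have "t * norm w \<le> R + norm c" using R(2)[OF ray[OF t]] t by simp
  then show False using w by (simp add: t_def)
qed

text \<open>If every regular constraint is tight at c, then K contains all rays from c through its
  points and is unbounded.\<close>

lemma regular_faces_no_common_point:
  assumes K: "convex_body K" and c: "\<And>n. n \<in> regular_normals K \<Longrightarrow> c \<in> face K n"
  shows False
proof -
  note K' = convex_body_compact_convex[OF K]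
  have "K \<noteq> {c}" using convex_body_vol_pos[OF K] by (auto simp: vol_singleton)
  then obtain z where z: "z \<in> K" "z \<noteq> c" using compact_convexD(1)[OF K'] by blast
  have "c + t *\<^sub>R (z - c) \<in> K" if t: "0 \<le> t" for t
  proof (rule mem_if_regular_normals[OF K])
    fix n assume "n \<in> regular_normals K"
    then have "n \<bullet> c = supp K n" using c by (auto simp: face_def)
    moreover have "t * (n \<bullet> z) \<le> t * supp K n" using supp_ge[OF K' z(1)] t by (rule mult_left_mono)
    ultimately show "n \<bullet> (c + t *\<^sub>R (z - c)) \<le> supp K n"
      by (simp add: inner_add_right inner_diff_right algebra_simps)
  qed
  then show False using ray_leaves[OF K', of "z - c" c] z(2) by auto
qed

text \<open>All regular constraints except that of m are tight at c, so a ray from c through a point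
  of K stays in K up to the plane of m, and boundedness forces it to reach that plane.\<close>

lemma cone_over_face:
  assumes K: "convex_body K" and m: "m \<in> regular_normals K" and cK: "c \<in> K"
    and c: "\<And>n. n \<in> regular_normals K \<Longrightarrow> n \<noteq> m \<Longrightarrow> c \<in> face K n"
  shows "c \<notin> face K m" "K = convex hull (insert c (face K m))"
proof -
  note K' = convex_body_compact_convex[OF K]
  show cm: "c \<notin> face K m" using regular_faces_no_common_point[OF K] c by metis
  have pos: "m \<bullet> c < supp K m" using cm cK supp_ge[OF K' cK, of m] by (auto simp: face_def)
  show "K = convex hull (insert c (face K m))"
  proof
    show "convex hull (insert c (face K m)) \<subseteq> K"
      using compact_convexD(3)[OF K'] cK by (intro hull_minimal) (auto simp: face_def)
    show "K \<subseteq> convex hull (insert c (face K m))"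
    proof
      fix z assume z: "z \<in> K"
      have ray: "c + t *\<^sub>R (z - c) \<in> K" if t: "0 \<le> t" and mt: "m \<bullet> (c + t *\<^sub>R (z - c)) \<le> supp K m" for t
      proof (rule mem_if_regular_normals[OF K])
        fix n assume n: "n \<in> regular_normals K"
        show "n \<bullet> (c + t *\<^sub>R (z - c)) \<le> supp K n"
        proof (cases "n = m")
          case False
          then have "n \<bullet> c = supp K n" using c n by (auto simp: face_def)
          moreover have "t * (n \<bullet> z) \<le> t * supp K n" using supp_ge[OF K' z] t by (rule mult_left_mono)
          ultimately show ?thesis by (simp add: inner_add_right inner_diff_right algebra_simps)
        qed (use mt in simp)
      qed
      show "z \<in> convex hull (insert c (face K m))"
      proof (cases "z = c")
        case False
        have grow: "m \<bullet> c < m \<bullet> z"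
        proof (rule ccontr)
          assume le: "\<not> m \<bullet> c < m \<bullet> z"
          have "c + t *\<^sub>R (z - c) \<in> K" if "0 \<le> t" for t
          proof (rule ray[OF that])
            have "t * (m \<bullet> z - m \<bullet> c) \<le> 0" using that le by (simp add: mult_nonneg_nonpos)
            then show "m \<bullet> (c + t *\<^sub>R (z - c)) \<le> supp K m" using pos
              by (simp add: inner_add_right inner_diff_right)
          qed
          then show False using ray_leaves[OF K', of "z - c" c] False by auto
        qed
        define t where "t = (supp K m - m \<bullet> c) / (m \<bullet> z - m \<bullet> c)"
        have t: "1 \<le> t" using supp_ge[OF K' z, of m] grow by (simp add: t_def le_divide_eq)
        have mt: "m \<bullet> (c + t *\<^sub>R (z - c)) = supp K m"
          using grow by (simp add: inner_add_right inner_diff_right t_def)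
        then have y: "c + t *\<^sub>R (z - c) \<in> face K m" using ray[of t] t by (simp add: face_def)
        have "z = (1 - 1 / t) *\<^sub>R c + (1 / t) *\<^sub>R (c + t *\<^sub>R (z - c))"
          using t by (simp add: algebra_simps)
        also have "\<dots> \<in> convex hull (insert c (face K m))"
          using t y by (intro convexD_alt[OF convex_convex_hull] hull_inc) auto
        finally show ?thesis .
      qed (simp add: hull_inc)
    qed
  qed
qed

text \<open>In each direction \<open>supp K\<close> agrees with that of the base or of the apex,
  which is the hypothesis of \<open>mixed_volume_disjoint\<close>; terms containing a point vanish.
  This lets the base stand for K in \<open>bezout_disjoint\<close>.\<close>

lemma cone_kernel:
  assumes Q: "compact_convex Q" and K: "compact_convex K" and eq: "K = convex hull (insert c Q)"
    and X: "compact_convex X"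
  shows "MV Q X K = MV X K K"
proof -
  have C: "compact_convex {c}" by (rule compact_convex_singleton)
  have "Q \<subseteq> K" "{c} \<subseteq> K" unfolding eq by (auto simp: hull_inc)
  moreover have "supp Q v = supp K v \<or> supp K v = supp {c} v" for v
    using supp_insert[OF Q, of c v] by (auto simp: eq supp_singleton max_def)
  ultimately have "MV Q K X + MV K {c} X = MV Q {c} X + MV K K X"
    by (intro mixed_volume_disjoint[OF Q K K C X])
  then show ?thesis
    using Q K X C by (simp add: mixed_volume_commute(1)[of _ "{c}"] mixed_volume_singleton
        mixed_volume_commute(2)[of Q K X] mixed_volume_rotate(2)[of K K X])
qed

text \<open>Both faces contain the apex, so \<open>regular_faces_meet\<close> gives nothing. The cut
  and the raise are made on the base Q, inside its plane, where the faces are assumed disjoint; the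
  base has the same V(Q,K,K) as K.\<close>

lemma cone_regular_faces_meet:
  assumes K: "convex_body K" and bez: "bezout K" and m: "m \<in> regular_normals K" and cK: "c \<in> K"
    and c: "\<And>n. n \<in> regular_normals K \<Longrightarrow> n \<noteq> m \<Longrightarrow> c \<in> face K n"
    and u: "u \<in> regular_normals K" "u \<noteq> m" and n: "n \<in> regular_normals K" "n \<noteq> m" and un: "u \<noteq> n"
  shows "face K u \<inter> face K n \<inter> face K m \<noteq> {}"
proof
  assume disj: "face K u \<inter> face K n \<inter> face K m = {}"
  note K' = convex_body_compact_convex[OF K]
  define Q where "Q = face K m"
  have cQ: "c \<notin> Q" and KQ: "K = convex hull (insert c Q)"
    using cone_over_face[OF K m cK c] by (auto simp: Q_def)
  have Q: "compact_convex Q" unfolding Q_def by (rule compact_convex_face[OF K'])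
  have QK: "Q \<subseteq> K" by (auto simp: Q_def face_def)
  have Qm: "m \<bullet> z = supp K m" if "z \<in> Q" for z using that by (simp add: Q_def face_def)
  have mm: "m \<bullet> m = 1" using regular_normals_norm[OF m] by (simp add: dot_square_norm)
  have mc: "m \<bullet> c < supp K m" using cQ cK supp_ge[OF K' cK, of m] by (auto simp: Q_def face_def)
  have uc: "u \<bullet> c = supp K u" and nc: "n \<bullet> c = supp K n" using c u n by (auto simp: face_def)
  obtain p where p: "regular_at K p u" using u by (auto simp: regular_normals_def)
  obtain q where q: "regular_at K q n" using n by (auto simp: regular_normals_def)
  have qn: "norm n = 1" "q \<in> K" "n \<bullet> q = supp K n" using q by (auto simp: regular_at_def face_def)
  \<comment> \<open>The projection \<open>q'\<close> of q from the apex to the base. It lies in the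
    face of n because t is nonzero: the apex is on two regular faces, so q is not the apex.\<close>
  obtain q' t where q': "q' \<in> Q" and t: "0 \<le> t" "t \<le> 1" and qt: "q = (1 - t) *\<^sub>R c + t *\<^sub>R q'"
  proof -
    have "q \<in> convex hull (insert c Q)" using qn KQ by simp
    then obtain a b where "0 \<le> a" "0 \<le> b" "a + b = 1" "\<exists>y. y \<in> convex hull Q \<and> q = a *\<^sub>R c + b *\<^sub>R y"
      using compact_convexD(1)[OF Q] unfolding convex_hull_insert[OF compact_convexD(1)[OF Q]] by blast
    then show thesis
      using that[of _ b] hull_same[of convex Q] compact_convexD(3)[OF Q] by (auto simp: eq_diff_eq)
  qed
  have "t \<noteq> 0"
  proof
    assume "t = 0"
    then have "u \<bullet> q = supp K u" using uc qt by simp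
    from regular_normal_unique[OF K' q this] regular_normals_norm[OF u(1)] un show False by simp
  qed
  then have nq': "n \<bullet> q' = supp K n"
    using qn(3) nc t unfolding qt by (simp add: inner_add_right algebra_simps)
  \<comment> \<open>The component of n in the plane of the base; normalised to \<open>d1\<close> it
    is the only unit normal of Q at \<open>q'\<close> within that plane.\<close>
  define d where "d = n - (n \<bullet> m) *\<^sub>R m"
  have dm: "d \<bullet> m = 0" by (simp add: d_def inner_diff_left mm)
  have d0: "d \<noteq> 0"
  proof
    assume "d = 0"
    then have nm: "n = (n \<bullet> m) *\<^sub>R m" by (simp add: d_def)
    then have "n \<bullet> c = (n \<bullet> m) * (m \<bullet> c)" "n \<bullet> q' = (n \<bullet> m) * (m \<bullet> q')" by (metis inner_scaleR_left)+
    then have "n \<bullet> m = 0" using nq' nc Qm[OF q'] mc by auto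
    then show False using nm qn(1) by simp
  qed
  define d1 where "d1 = d /\<^sub>R norm d"
  have nd: "n \<bullet> z = norm d * (d1 \<bullet> z) + (n \<bullet> m) * supp K m" if "z \<in> Q" for z
  proof -
    have "norm d * (d1 \<bullet> z) = d \<bullet> z" using d0 by (simp add: d1_def)
    then show ?thesis using Qm[OF that] by (simp add: d_def inner_diff_left)
  qed
  define T where "T = sphere 0 1 \<inter> {v. m \<bullet> v = 0}"
  have T: "closed T" "T \<subseteq> sphere 0 1" unfolding T_def using closed_hyperplane[of m 0]
    by (auto intro: closed_Int)
  \<comment> \<open>Adding a multiple of m makes v constant on the line through c and
    \<open>q'\<close>. The sum supports K at q, so it is a multiple of n, and v is its component in
    the plane.\<close>
  have uniq: "v = d1" if v: "v \<in> T" "v \<bullet> q' = supp Q v" for v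
  proof -
    define \<mu> where "\<mu> = (v \<bullet> c - v \<bullet> q') / (supp K m - m \<bullet> c)"
    define w where "w = v + \<mu> *\<^sub>R m"
    have wc: "w \<bullet> c = w \<bullet> q'"
      using mc Qm[OF q'] by (simp add: w_def inner_add_left \<mu>_def field_simps)
    have "supp Q w \<le> w \<bullet> q'"
    proof (rule supp_le[OF Q])
      fix z assume z: "z \<in> Q"
      then have "v \<bullet> z \<le> v \<bullet> q'" using supp_ge[OF Q z, of v] v(2) by simp
      then show "w \<bullet> z \<le> w \<bullet> q'" using Qm[OF z] Qm[OF q'] by (simp add: w_def inner_add_left)
    qed
    then have "supp K w \<le> w \<bullet> q'" using wc by (simp add: KQ supp_insert[OF Q])
    moreover have "w \<bullet> q = w \<bullet> q'" using wc by (simp add: qt inner_add_right algebra_simps)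
    ultimately have "w \<bullet> q = supp K w" using supp_ge[OF K' qn(2), of w] by simp
    from regular_normal_unique[OF K' q this] have wn: "w = norm w *\<^sub>R n" .
    have "w \<bullet> m = \<mu>" using v(1) by (simp add: w_def T_def inner_add_left mm inner_commute[of v])
    then have "v = w - (w \<bullet> m) *\<^sub>R m" by (simp add: w_def)
    also have "\<dots> = norm w *\<^sub>R d" by (subst (1 2) wn) (simp add: d_def algebra_simps)
    finally have vd: "v = norm w *\<^sub>R d" .
    then have "norm w * norm d = 1" using v(1) by (simp add: T_def)
    then have "norm w = inverse (norm d)" using d0 by (simp add: field_simps)
    then show "v = d1" using vd by (simp add: d1_def)
  qed
  define e where "e = face K n \<inter> Q"
  have e_compact: "compact e" unfolding e_def
    using compact_convexD(2)[OF compact_convex_face[OF K', of n]] compact_convexD(5)[OF Q]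
    by (rule compact_Int_closed)
  have "face K u \<inter> e = {}" "e \<subseteq> K" using disj QK by (auto simp: e_def Q_def)
  then obtain \<epsilon> where \<epsilon>: "0 < \<epsilon>" "\<And>z. z \<in> e \<Longrightarrow> u \<bullet> z \<le> supp K u - \<epsilon>"
    using face_disjoint_cut[OF K' e_compact] by metis
  let ?H = "{z. u \<bullet> z \<le> supp K u - \<epsilon> / 2}"
  define C where "C = Q \<inter> {z. supp K u - \<epsilon> / 2 \<le> u \<bullet> z}"
  have C: "compact C" "C \<subseteq> Q" using compact_convexD(2)[OF Q] closed_halfspace_ge[of "supp K u - \<epsilon> / 2" u]
    by (auto simp: C_def inner_commute)
  have q'e: "q' \<in> e" using q' nq' QK by (auto simp: e_def face_def)
  have "face Q d1 \<subseteq> e"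
  proof
    fix z assume z: "z \<in> face Q d1"
    then have zQ: "z \<in> Q" and "d1 \<bullet> q' \<le> d1 \<bullet> z" using supp_ge[OF Q q', of d1] by (auto simp: face_def)
    then have "n \<bullet> q' \<le> n \<bullet> z" using nd[OF zQ] nd[OF q'] by (simp add: mult_left_mono)
    then have "n \<bullet> z = supp K n" using nq' supp_ge[OF K', of z n] zQ QK by force
    then show "z \<in> e" using zQ QK by (auto simp: e_def face_def)
  qed
  then have "face Q d1 \<inter> C = {}" using \<epsilon> by (force simp: C_def)
  then obtain \<rho> where \<rho>: "0 < \<rho>" "\<And>v. norm (v - d1) < \<rho> \<Longrightarrow> face Q v \<inter> C = {}"
    using face_near[OF Q C(1) _ C(2)] by metis
  obtain \<omega> where \<omega>: "0 < \<omega>" "\<And>v. v \<in> T \<Longrightarrow> supp Q v < v \<bullet> q' + \<omega> \<Longrightarrow> norm (v - d1) < \<rho>"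
    using normal_near[OF Q q' T uniq \<rho>(1)] by metis
  define A where "A = Q \<inter> ?H"
  define x where "x = q' + (\<omega> / 2) *\<^sub>R d1"
  define B where "B = convex hull (insert x Q)"
  have d1: "norm d1 = 1" "d1 \<bullet> m = 0" "m \<bullet> d1 = 0" using d0 dm by (simp_all add: d1_def inner_commute)
  have "q' \<in> A" using \<epsilon>(1) \<epsilon>(2)[OF q'e] q' by (simp add: A_def)
  then have A: "compact_convex A" unfolding A_def by (intro compact_convex_cut[OF Q]) auto
  have B: "compact_convex B" unfolding B_def by (rule compact_convex_insert[OF Q])
  have AQ: "A \<subseteq> Q" by (simp add: A_def)
  have QB: "Q \<subseteq> B" by (auto simp: B_def hull_inc)
  have mx: "m \<bullet> x = supp K m" using Qm[OF q'] d1 by (simp add: x_def inner_add_right)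
  have unit: "supp A v = supp Q v" if v: "v \<in> T" "supp Q v < v \<bullet> x" for v
  proof -
    have "v \<bullet> d1 \<le> 1" using norm_cauchy_schwarz[of v d1] v d1 by (simp add: T_def)
    then have "\<omega> / 2 * (v \<bullet> d1) < \<omega>" using \<omega>(1)
      by (smt (verit) mult_left_le half_gt_zero field_sum_of_halves)
    then have "supp Q v < v \<bullet> q' + \<omega>" using v(2) by (simp add: x_def inner_add_right)
    then have "face Q v \<inter> C = {}" using \<omega>(2) \<rho>(2) v by blast
    moreover obtain z where "z \<in> face Q v" using compact_convexD(1)[OF compact_convex_face[OF Q]] by blast
    ultimately have "z \<in> A" "z \<in> face Q v" by (auto simp: A_def C_def face_def)
    then show ?thesis by (rule supp_eq_if_face[OF A Q AQ])
  qed
  \<comment> \<open>For subsets of the plane of Q the normal component of v only adds a constant, so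
    support functions need comparing in tangential directions alone.\<close>
  have tang: "supp S v = supp S (v - (v \<bullet> m) *\<^sub>R m) + (v \<bullet> m) * supp K m"
    if S: "compact_convex S" "S \<subseteq> Q" for S v
  proof (rule antisym)
    let ?v = "v - (v \<bullet> m) *\<^sub>R m"
    have eq: "v \<bullet> z = ?v \<bullet> z + (v \<bullet> m) * supp K m" if "z \<in> S" for z
      using Qm[of z] that S(2) by (auto simp: inner_diff_left)
    have "v \<bullet> z \<le> supp S ?v + (v \<bullet> m) * supp K m" "?v \<bullet> z \<le> supp S v - (v \<bullet> m) * supp K m" if "z \<in> S" for z
      using supp_ge[OF S(1) that, of v] supp_ge[OF S(1) that, of ?v] eq[OF that] by linarith+
    then have "supp S v \<le> supp S ?v + (v \<bullet> m) * supp K m"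
      and *: "supp S ?v \<le> supp S v - (v \<bullet> m) * supp K m"
      by (auto intro: supp_le[OF S(1)])
    then show "supp S v \<le> supp S ?v + (v \<bullet> m) * supp K m" by simp
    from * show "supp S ?v + (v \<bullet> m) * supp K m \<le> supp S v" by simp
  qed
  have "supp A v = supp Q v \<or> supp B v = supp Q v" for v
  proof (cases "supp Q v < v \<bullet> x")
    case True
    define w where "w = v - (v \<bullet> m) *\<^sub>R m"
    have wx: "supp Q w < w \<bullet> x" using True tang[OF Q order_refl, of v] mx
      by (simp add: w_def inner_diff_left)
    then have w: "w \<noteq> 0" using supp_zero[OF Q] by auto
    let ?w = "inverse (norm w) *\<^sub>R w"
    have "m \<bullet> w = 0" by (simp add: w_def inner_diff_right mm inner_commute)
    then have "?w \<in> T" using w by (simp add: T_def)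
    moreover have "supp Q ?w < ?w \<bullet> x" using wx w by (simp add: supp_scaleR[OF Q])
    ultimately have "supp A ?w = supp Q ?w" by (rule unit)
    then have "supp A w = supp Q w" using w by (simp add: supp_scaleR[OF Q] supp_scaleR[OF A])
    then show ?thesis using tang[OF Q order_refl, of v] tang[OF A AQ, of v] by (simp add: w_def)
  qed (simp add: B_def supp_insert[OF Q])
  then have "\<not> (MV A K K < vol K \<and> vol K < MV B K K)"
    using cone_kernel[OF Q K' KQ] by (intro bezout_disjoint[OF bez K' Q _ A B AQ QB]) auto
  moreover have "MV A K K < MV K K K"
  proof (rule mixed_volume_strict_mono[OF K' p A K'])
    show "A \<subseteq> K" using AQ QK by blast
    show "supp A u < supp K u" using \<epsilon>(1)
      by (intro le_less_trans[OF supp_le[OF A, of u "supp K u - \<epsilon> / 2"]]) (auto simp: A_def)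
  qed
  moreover have "MV Q K K < MV B K K"
  proof (rule mixed_volume_strict_mono[OF K' q Q B QB])
    have "n = d + (n \<bullet> m) *\<^sub>R m" by (simp add: d_def)
    then have "n \<bullet> d = d \<bullet> d" using dm by (metis inner_add_left inner_commute inner_scaleR_left
        mult_zero_right add.right_neutral)
    then have "n \<bullet> d1 = norm d" using d0 by (simp add: d1_def dot_square_norm power2_eq_square)
    then have "n \<bullet> x = supp K n + \<omega> / 2 * norm d" using nq' by (simp add: x_def inner_add_right)
    moreover have "supp Q n \<le> supp K n" using subset_iff_supp[OF Q K'] QK by blast
    moreover have "0 < \<omega> / 2 * norm d" using \<omega>(1) d0 by simp
    ultimately have "supp Q n < n \<bullet> x" by linarith
    then show "supp Q n < supp B n" by (simp add: B_def supp_insert[OF Q])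
  qed
  moreover have "MV Q K K = MV K K K" using cone_kernel[OF Q K' KQ K'] .
  ultimately show False using K' by (simp add: mixed_volume_diagonal)
qed

section \<open>Raising and cutting facets\<close>

lemma mem_plus_scaled_seg:
  assumes "0 \<le> s"
  shows "x \<in> X + s \<cdot> seg n \<longleftrightarrow> (\<exists>y\<in>X. \<exists>t. 0 \<le> t \<and> t \<le> s \<and> x = y + t *\<^sub>R n)"
proof
  assume "x \<in> X + s \<cdot> seg n"
  then obtain y z where y: "y \<in> X" and z: "z \<in> s \<cdot> seg n" and x: "x = y + z" by (rule set_plus_elim)
  obtain t where "0 \<le> t" "t \<le> s" "z = t *\<^sub>R n" using z mem_scaled_seg[OF assms, of z n] by auto
  then show "\<exists>y\<in>X. \<exists>t. 0 \<le> t \<and> t \<le> s \<and> x = y + t *\<^sub>R n" using x y by blast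
next
  assume "\<exists>y\<in>X. \<exists>t. 0 \<le> t \<and> t \<le> s \<and> x = y + t *\<^sub>R n"
  then obtain y t where y: "y \<in> X" "0 \<le> t" "t \<le> s" "x = y + t *\<^sub>R n" by blast
  then have "t *\<^sub>R n \<in> s \<cdot> seg n" using mem_scaled_seg[OF assms, of "t *\<^sub>R n" n] by blast
  with y(1) have "y + t *\<^sub>R n \<in> X + s \<cdot> seg n" by (rule set_plus_intro)
  then show "x \<in> X + s \<cdot> seg n" using y(4) by simp
qed

lemma subset_plus_seg_insert:
  assumes K: "compact_convex K" and q: "q \<in> K" and \<delta>: "0 \<le> \<delta>"
  shows "convex hull (insert (q + \<delta> *\<^sub>R n) K) \<subseteq> K + \<delta> \<cdot> seg n"
proof (rule hull_minimal)
  have C: "compact_convex (K + \<delta> \<cdot> seg n)" using K by (intro compact_convex_intros compact_convex_seg)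
  then show "convex (K + \<delta> \<cdot> seg n)" by (rule compact_convexD)
  have "z \<in> K + \<delta> \<cdot> seg n" if "z \<in> K" for z
    unfolding mem_plus_scaled_seg[OF \<delta>] using that \<delta> by (intro bexI[of _ z] exI[of _ 0]) auto
  moreover have "q + \<delta> *\<^sub>R n \<in> K + \<delta> \<cdot> seg n"
    unfolding mem_plus_scaled_seg[OF \<delta>] using q \<delta> by (intro bexI[of _ q] exI[of _ \<delta>]) auto
  ultimately show "insert (q + \<delta> *\<^sub>R n) K \<subseteq> K + \<delta> \<cdot> seg n" by auto
qed

lemma vol_Un_separated:
  assumes X: "compact_convex X" and Y: "compact_convex Y" and n: "n \<noteq> 0"
    and le: "\<And>z. z \<in> X \<Longrightarrow> n \<bullet> z \<le> c" and ge: "\<And>z. z \<in> Y \<Longrightarrow> c \<le> n \<bullet> z"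
    and Z: "compact_convex Z" and sub: "X \<subseteq> Z" "Y \<subseteq> Z"
  shows "vol X + vol Y \<le> vol Z"
proof -
  have "X \<inter> Y \<subseteq> {z. n \<bullet> z = c}" using le ge by force
  then have "negligible (X \<inter> Y)" using negligible_hyperplane[of n c] n by (auto intro: negligible_subset)
  then have "vol (X \<inter> Y) = 0" by (rule negligible_imp_measure0)
  then have "vol X + vol Y = vol (X \<union> Y)"
    using measure_Un3[OF compact_convexD(6)[OF X] compact_convexD(6)[OF Y]] by simp
  also have "\<dots> \<le> vol Z"
    using X Y Z sub by (intro measure_mono_fmeasurable) (simp_all add: fmeasurableD compact_convexD(6)
        sets.Un)
  finally show ?thesis .
qed

text \<open>For a planar A orthogonal to n, \<open>MV A A (seg n)\<close> is a third of the area.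
  The set \<open>t \<cdot> A + K\<close> contains (t + 1) A at its top in direction n, so raising K
  over q adds a prism of height \<open>\<delta>\<close> over it. Leading terms for r, then for t,
  tending to infinity isolate V(A,B,K).\<close>

lemma mixed_volume_raise_ge:
  assumes K: "compact_convex K" and n: "norm n = 1" and A: "compact_convex A" and AF: "A \<subseteq> face K n"
    and q: "q \<in> A" and \<delta>: "0 < \<delta>"
  shows "\<delta> * MV A A (seg n) \<le> MV A (convex hull (insert (q + \<delta> *\<^sub>R n) K)) K - MV A K K"
proof -
  note I = compact_convex_seg[of 0 n]
  define B where "B = convex hull (insert (q + \<delta> *\<^sub>R n) K)"
  have B: "compact_convex B" unfolding B_def by (rule compact_convex_insert[OF K])
  have AK: "A \<subseteq> K" and qK: "q \<in> K" and An: "\<And>z. z \<in> A \<Longrightarrow> n \<bullet> z = supp K n"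
    using AF q by (auto simp: face_def)
  have KB: "K \<subseteq> B" by (auto simp: B_def hull_inc)
  have nn: "n \<bullet> n = 1" using n by (simp add: dot_square_norm)
  define a where "a = MV A A (seg n)"
  have \<alpha>: "MV B A A - MV K A A \<le> \<delta> * a"
  proof -
    have "MV B A A \<le> MV (K + \<delta> \<cdot> seg n) A A"
      using subset_plus_seg_insert[OF K qK, of \<delta> n] \<delta> K A B I
      by (intro mixed_volume_mono) (auto simp: B_def intro!: compact_convex_intros)
    also have "\<dots> = MV K A A + \<delta> * MV (seg n) A A"
      using K A I \<delta> by (simp add: mixed_volume_linear compact_convex_intros)
    finally show ?thesis using mixed_volume_rotate(2)[OF A A I] by (simp add: a_def)
  qed
  have W: "0 \<le> (MV K K B - vol K - \<delta> * a) + 2 * (MV A B K - MV A K K - \<delta> * a) * t" if t: "0 < t" for t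
  proof -
    define W where "W = t \<cdot> A + K"
    have CW: "compact_convex W" unfolding W_def by (intro compact_convex_intros A K)
    have lead: "0 \<le> (vol B - vol K) + 3 * (MV W B B - MV W K K) * r
        + (3 * (MV W W B - MV W W K) - 3 * (t + 1)\<^sup>2 * \<delta> * a) * r\<^sup>2" if r: "0 < r" for r
    proof -
      define Y where "Y = (r * (t + 1)) \<cdot> A + \<delta> \<cdot> seg n + {q}"
      have Y: "compact_convex Y" unfolding Y_def by (intro compact_convex_intros A I)
      have "vol (r \<cdot> W + K) + vol Y \<le> vol (r \<cdot> W + B)"
      proof (rule vol_Un_separated)
        show "compact_convex (r \<cdot> W + K)" "compact_convex (r \<cdot> W + B)"
          using CW K B by (auto intro!: compact_convex_intros)
        show "n \<noteq> 0" using n by auto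
        show "r \<cdot> W + K \<subseteq> r \<cdot> W + B" using KB by (intro set_plus_mono2) auto
        have sW: "supp W n = (t + 1) * supp K n"
        proof -
          have "supp A n = supp K n" using q AF AK by (intro supp_eq_if_face[OF A K]) auto
          then show ?thesis using A K t by (simp add: W_def supp_simps compact_convex_intros distrib_right)
        qed
        fix z
        { assume "z \<in> r \<cdot> W + K"
          then have "n \<bullet> z \<le> supp (r \<cdot> W + K) n" using CW K by (intro supp_ge compact_convex_intros)
          then show "n \<bullet> z \<le> (r * (t + 1) + 1) * supp K n"
            using CW K r sW by (simp add: supp_simps compact_convex_intros algebra_simps)
        next
          assume "z \<in> Y"
          then obtain y where "y \<in> (r * (t + 1)) \<cdot> A + \<delta> \<cdot> seg n" and zy: "z = y + q"
            unfolding Y_def by (rule set_plus_elim) simp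
          then obtain a' u where "a' \<in> A" "0 \<le> u" "y = (r * (t + 1)) *\<^sub>R a' + u *\<^sub>R n"
            using mem_plus_scaled_seg[of \<delta> y "(r * (t + 1)) \<cdot> A" n] \<delta> by auto
          moreover from this zy have "z = (r * (t + 1)) *\<^sub>R a' + u *\<^sub>R n + q" by simp
          ultimately show "(r * (t + 1) + 1) * supp K n \<le> n \<bullet> z"
            using An[of a'] An[OF q] by (simp add: inner_add_right nn algebra_simps)
        }
      next
        show "Y \<subseteq> r \<cdot> W + B"
        proof -
          have "(t + 1) \<cdot> A \<subseteq> W"
          proof -
            have "t \<cdot> A + 1 \<cdot> A \<subseteq> W" unfolding W_def using AK by (intro set_plus_mono2) auto
            then show ?thesis using scaled_add[OF A, of t 1] t by simp
          qed
          then have 1: "(r * (t + 1)) \<cdot> A \<subseteq> r \<cdot> W" by (auto simp: image_subset_iff simp flip: scaleR_scaleR)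
          have 2: "\<delta> \<cdot> seg n + {q} \<subseteq> B"
          proof
            fix z assume "z \<in> \<delta> \<cdot> seg n + {q}"
            then obtain u where u: "0 \<le> u" "u \<le> \<delta>" "z = u *\<^sub>R n + q"
              using mem_plus_scaled_seg[of \<delta> z "{q}" n] \<delta> by (auto simp: add.commute)
            have "z = (1 - u / \<delta>) *\<^sub>R q + (u / \<delta>) *\<^sub>R (q + \<delta> *\<^sub>R n)"
              using \<delta> u by (simp add: algebra_simps)
            also have "\<dots> \<in> B" unfolding B_def
              using u \<delta> qK by (intro convexD_alt[OF convex_convex_hull] hull_inc) auto
            finally show "z \<in> B" .
          qed
          have "Y = (r * (t + 1)) \<cdot> A + (\<delta> \<cdot> seg n + {q})" by (simp add: Y_def add.assoc)
          then show ?thesis using set_plus_mono2[OF 1 2] by simp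
        qed
      qed (rule Y)
      moreover have "3 * (r * (t + 1))\<^sup>2 * \<delta> * a \<le> vol Y"
      proof -
        have "vol Y = vol ((r * (t + 1)) \<cdot> A) + 3 * \<delta> * MV ((r * (t + 1)) \<cdot> A) ((r * (t + 1)) \<cdot> A) (seg n)"
          unfolding Y_def vol_plus_singleton using A \<delta>
            by (intro vol_plus_scaled_seg compact_convex_intros) auto
        also have "MV ((r * (t + 1)) \<cdot> A) ((r * (t + 1)) \<cdot> A) (seg n) = (r * (t + 1))\<^sup>2 * a"
          using A I r t by (simp add: mixed_volume_linear compact_convex_intros a_def power2_eq_square)
        finally show ?thesis by simp
      qed
      ultimately have "vol (r \<cdot> W + K) + 3 * (r * (t + 1))\<^sup>2 * \<delta> * a \<le> vol (r \<cdot> W + B)" by linarith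
      then show ?thesis
        using CW K B r by (simp add: vol_scaled_plus) (simp add: algebra_simps power2_eq_square)
    qed
    have "0 \<le> 3 * (MV W W B - MV W W K) - 3 * (t + 1)\<^sup>2 * \<delta> * a"
      using lead by (rule nonneg_leading_of_quadratic)
    moreover have "MV W W X = t\<^sup>2 * MV X A A + 2 * t * MV A X K + MV K K X" if X: "compact_convex X" for X
      using X A K t mixed_volume_rotate(2)[OF A A X] mixed_volume_commute(2)[OF A K
          X] mixed_volume_commute(1)[OF K A X]
      by (simp add: W_def mixed_volume_linear compact_convex_intros power2_eq_square algebra_simps)
    ultimately have "0 \<le> t\<^sup>2 * (MV B A A - MV K A A - \<delta> * a) + 2 * t * (MV A B K - MV A K K - \<delta> * a)
        + (MV K K B - vol K - \<delta> * a)"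
      using B K by (simp add: mixed_volume_diagonal algebra_simps power2_eq_square)
    moreover have "t\<^sup>2 * (MV B A A - MV K A A - \<delta> * a) \<le> 0" using \<alpha> by (simp add: mult_nonneg_nonpos)
    ultimately show ?thesis by (simp add: algebra_simps)
  qed
  have "0 \<le> 2 * (MV A B K - MV A K K - \<delta> * a)" using W by (rule nonneg_slope_of_linear)
  then show ?thesis by (simp add: B_def a_def)
qed

definition slab :: "(real ^ 3) set \<Rightarrow> real ^ 3 \<Rightarrow> real \<Rightarrow> (real ^ 3) set" where
  "slab K n \<tau> = K \<inter> {z. supp K n - \<tau> \<le> n \<bullet> z}"

lemma compact_convex_slab:
  assumes K: "compact_convex K" and "0 \<le> \<tau>"
  shows "compact_convex (slab K n \<tau>)"
proof -
  obtain z where "z \<in> K" "n \<bullet> z = supp K n" using supp_attained[OF K] by metis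
  then have "slab K n \<tau> \<noteq> {}" using assms(2) by (auto simp: slab_def)
  then show ?thesis
    using K closed_halfspace_ge[of "supp K n - \<tau>" n] convex_halfspace_ge[of "supp K n - \<tau>" n]
    by (auto simp: slab_def compact_convex_def convex_Int inner_commute)
qed

text \<open>Only directions close to n see a low pyramid over a regular point, so
  \<open>K + s \<cdot> B\<close> exceeds (1 + s) K at most by a layer of height
  \<open>s * \<delta>\<close> over a slab below the face. The slab, needed for positive
  \<open>\<delta>\<close>, shrinks to the face in \<open>vol_face_le\<close>.\<close>

lemma mixed_volume_raise_le:
  assumes K: "compact_convex K" and q: "regular_at K q n" and \<tau>: "0 < \<tau>"
  obtains \<delta> where "0 < \<delta>"
    "MV (convex hull (insert (q + \<delta> *\<^sub>R n) K)) K K - vol K \<le> \<delta> * MV (slab K n \<tau>) (slab K n \<tau>) (seg n)"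
proof -
  have n: "norm n = 1" and qK: "q \<in> K" using q by (auto simp: regular_at_def face_def)
  note I = compact_convex_seg[of 0 n]
  obtain R where R: "0 < R" "\<And>a. a \<in> K \<Longrightarrow> norm a \<le> R"
    using compact_convex_norm_bound[OF K] by metis
  \<comment> \<open>Replacing v by n costs \<open>\<tau> / 4\<close> in the support function and
    \<open>\<tau> / 4\<close> in the inner product; with \<open>\<delta> \<le> \<tau> / 2\<close>
    this adds up to the slab depth.\<close>
  define \<rho> where "\<rho> = \<tau> / (4 * R)"
  have \<rho>: "0 < \<rho>" "R * \<rho> = \<tau> / 4" using \<tau> R by (simp_all add: \<rho>_def)
  obtain \<omega> where \<omega>: "0 < \<omega>" "\<And>v. norm v = 1 \<Longrightarrow> supp K v < v \<bullet> q + \<omega> \<Longrightarrow> norm (v - n) < \<rho>"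
    using regular_normal_near[OF K q \<rho>(1)] by metis
  define \<delta> where "\<delta> = min \<omega> (\<tau> / 2)"
  have \<delta>: "0 < \<delta>" "\<delta> \<le> \<omega>" "\<delta> \<le> \<tau> / 2" using \<omega> \<tau> by (auto simp: \<delta>_def)
  define B where "B = convex hull (insert (q + \<delta> *\<^sub>R n) K)"
  have B: "compact_convex B" unfolding B_def by (rule compact_convex_insert[OF K])
  define D where "D = slab K n \<tau>"
  have D: "compact_convex D" using compact_convex_slab[OF K] \<tau> by (simp add: D_def)
  have sub: "K + s \<cdot> B \<subseteq> (1 + s) \<cdot> K \<union> ((1 + s) \<cdot> D + (s * \<delta>) \<cdot> seg n)" if s: "0 < s" for s
  proof
    fix z assume "z \<in> K + s \<cdot> B"
    then obtain k b where k: "k \<in> K" and b: "b \<in> B" and z: "z = k + s *\<^sub>R b" by (auto elim!: set_plus_elim)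
    have "b \<in> K + \<delta> \<cdot> seg n" using subset_plus_seg_insert[OF K qK, of \<delta> n] \<delta> b by (auto simp: B_def)
    then obtain b0 \<theta> where b0: "b0 \<in> K" and \<theta>: "0 \<le> \<theta>" "\<theta> \<le> \<delta>" and bb: "b = b0 + \<theta> *\<^sub>R n"
      using mem_plus_scaled_seg[of \<delta> b K n] \<delta> by auto
    have "k + s *\<^sub>R b0 \<in> 1 \<cdot> K + s \<cdot> K" using k b0 by (intro set_plus_intro) auto
    then obtain y where y: "y \<in> K" "k + s *\<^sub>R b0 = (1 + s) *\<^sub>R y" using scaled_add[OF K, of 1 s] s by auto
    have zy: "z = (1 + s) *\<^sub>R y + (s * \<theta>) *\<^sub>R n" using y(2) by (simp add: z bb algebra_simps)
    show "z \<in> (1 + s) \<cdot> K \<union> ((1 + s) \<cdot> D + (s * \<delta>) \<cdot> seg n)"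
    proof (cases "z \<in> (1 + s) \<cdot> K")
      case False
      have CK: "compact_convex ((1 + s) \<cdot> K)" by (intro compact_convex_intros K)
      obtain w where w: "(1 + s) * supp K w < w \<bullet> z"
        using False mem_iff_supp[OF CK, of z] K s by (auto simp: supp_scaled not_le)
      then have w0: "w \<noteq> 0" using supp_zero[OF K] by auto
      define v where "v = inverse (norm w) *\<^sub>R w"
      have v: "norm v = 1" using w0 by (simp add: v_def)
      have "inverse (norm w) * ((1 + s) * supp K w) < inverse (norm w) * (w \<bullet> z)"
        using w w0 by (intro mult_strict_left_mono) auto
      then have vz: "(1 + s) * supp K v < v \<bullet> z" using supp_scaleR[OF K, of "inverse (norm w)" w]
        by (simp add: v_def algebra_simps)
      have vn: "v \<bullet> n \<le> 1" using norm_cauchy_schwarz[of v n] v n by simp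
      have "s * supp K v < s * (v \<bullet> b)" using vz supp_ge[OF K k, of v]
        by (simp add: z inner_add_right algebra_simps)
      then have "supp K v < v \<bullet> b" using s by simp
      also have "\<dots> \<le> max (supp K v) (v \<bullet> (q + \<delta> *\<^sub>R n))" using supp_ge[OF B b, of v]
        by (simp add: B_def supp_insert[OF K])
      finally have "supp K v < v \<bullet> q + \<delta> * (v \<bullet> n)" by (auto simp: inner_add_right max_def split: if_splits)
      moreover have "\<delta> * (v \<bullet> n) \<le> \<delta>" using vn \<delta>(1) by simp
      ultimately have near: "norm (v - n) < \<rho>" using \<omega>(2)[OF v] \<delta>(2) by linarith
      have "s * \<theta> * (v \<bullet> n) \<le> s * \<theta> * 1" using vn s \<theta> by (intro mult_left_mono) auto
      moreover have "s * \<theta> \<le> s * \<delta>" using s \<theta> by simp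
      moreover have "s * \<delta> \<le> (1 + s) * \<delta>" using \<delta>(1) by simp
      ultimately have "(1 + s) * supp K v < (1 + s) * (v \<bullet> y) + (1 + s) * \<delta>"
        using vz by (simp add: zy inner_add_right)
      then have "(1 + s) * supp K v < (1 + s) * (v \<bullet> y + \<delta>)" by (simp add: distrib_left)
      then have vy: "supp K v < v \<bullet> y + \<delta>" using s by simp
      have "\<bar>(v - n) \<bullet> y\<bar> \<le> norm (v - n) * R"
        using Cauchy_Schwarz_ineq2[of "v - n" y] R(2)[OF y(1)]
        by (meson mult_left_mono norm_ge_zero order_trans)
      moreover have "\<bar>supp K v - supp K n\<bar> \<le> R * norm (v - n)" by (rule supp_diff_le[OF K R(2)])
      moreover have "R * norm (v - n) \<le> \<tau> / 4" using mult_left_mono[OF less_imp_le[OF near], of R] R \<rho>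
        by simp
      ultimately have "supp K n - \<tau> \<le> n \<bullet> y"
        using vy \<delta>(3) by (simp add: inner_diff_left mult.commute abs_le_iff)
      then have "y \<in> D" using y by (simp add: D_def slab_def)
      moreover have "(s * \<theta>) *\<^sub>R n \<in> (s * \<delta>) \<cdot> seg n" using s \<theta>
        by (subst mem_scaled_seg) (auto intro!: exI[of _ "s * \<theta>"])
      ultimately show ?thesis unfolding zy by (auto intro!: set_plus_intro)
    qed simp
  qed
  define d where "d = MV D D (seg n)"
  have "0 \<le> 3 * (vol K + \<delta> * d - MV K K B) + (3 * vol K + 6 * \<delta> * d - 3 * MV K B B) * s
      + (vol K + 3 * \<delta> * d - vol B) * s\<^sup>2"
    if s: "0 < s" "s \<le> 1" for s
  proof -
    let ?X = "(1 + s) \<cdot> K" and ?D = "(1 + s) \<cdot> D"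
    let ?Y = "?D + (s * \<delta>) \<cdot> seg n"
    have C: "compact_convex ?X" "compact_convex ?Y" "compact_convex ?D" "compact_convex (K + s \<cdot> B)"
      using K D I B by (auto intro!: compact_convex_intros)
    \<comment> \<open>The scaled slab lies in both sets; subtracting it leaves only the layer of
      height \<open>s * \<delta>\<close>.\<close>
    have "?D \<subseteq> ?X \<inter> ?Y"
    proof -
      have "{0} \<subseteq> (s * \<delta>) \<cdot> seg n" using s \<delta> by (auto simp: mem_scaled_seg intro: exI[of _ 0])
      from set_plus_mono2[OF order_refl this, of ?D] show ?thesis by (auto simp: D_def slab_def)
    qed
    then have "vol ?D \<le> vol (?X \<inter> ?Y)"
      using C by (intro measure_mono_fmeasurable) (simp_all add: fmeasurableD compact_convexD(6)
          fmeasurable.Int)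
    moreover have "vol (K + s \<cdot> B) \<le> vol (?X \<union> ?Y)"
      using C sub[OF s(1)] by (intro measure_mono_fmeasurable) (simp_all add: fmeasurableD
          compact_convexD(6) fmeasurable.Un)
    moreover have "vol (?X \<union> ?Y) = vol ?X + vol ?Y - vol (?X \<inter> ?Y)"
      using C by (intro measure_Un3 compact_convexD(6))
    moreover have "vol ?Y = vol ?D + 3 * (s * \<delta>) * ((1 + s)\<^sup>2 * d)"
      using vol_plus_scaled_seg[OF C(3), of "s * \<delta>" n] D I s \<delta>
      by (simp add: mixed_volume_linear compact_convex_intros d_def power2_eq_square)
    ultimately have "vol (K + s \<cdot> B) \<le> vol ?X + 3 * (s * \<delta>) * ((1 + s)\<^sup>2 * d)" by linarith
    then have "0 \<le> s * (3 * (vol K + \<delta> * d - MV K K B) + (3 * vol K + 6 * \<delta> * d - 3 * MV K B B) * s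
        + (vol K + 3 * \<delta> * d - vol B) * s\<^sup>2)"
      using K B s by (simp add: vol_plus_scaled vol_scaled) (simp add: algebra_simps power2_eq_square
          power3_eq_cube)
    then show ?thesis using s by (simp add: zero_le_mult_iff)
  qed
  then have "0 \<le> 3 * (vol K + \<delta> * d - MV K K B)" by (rule nonneg_at_0_of_quadratic)
  then show thesis
    using that[OF \<delta>(1)] mixed_volume_rotate(2)[OF K K B] by (simp add: B_def d_def D_def)
qed

text \<open>The compact sums of slabs with \<open>seg n\<close> decrease into the sum for the face,
  so the bound survives by continuity of the measure from above.\<close>

lemma vol_face_le:
  assumes K: "compact_convex K" and n: "norm n = 1" and c: "\<And>\<tau>. 0 < \<tau> \<Longrightarrow> c \<le> vol (slab K n \<tau> + seg n)"
  shows "c \<le> vol (face K n + seg n)"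
proof -
  define D where "D k = slab K n (1 / real (Suc k)) + seg n" for k
  have D: "compact_convex (D k)" for k
    unfolding D_def by (intro compact_convex_intros compact_convex_slab compact_convex_seg K) simp
  have nn: "n \<bullet> n = 1" using n by (simp add: dot_square_norm)
  have "decseq D"
  proof (rule decseq_SucI)
    fix k
    have "1 / real (Suc (Suc k)) \<le> 1 / real (Suc k)" by (simp add: divide_simps)
    then have "slab K n (1 / real (Suc (Suc k))) \<subseteq> slab K n (1 / real (Suc k))" by (auto simp: slab_def)
    then show "D (Suc k) \<subseteq> D k" unfolding D_def by (intro set_plus_mono2) auto
  qed
  moreover have "range D \<subseteq> sets lebesgue" using compact_convexD(6)[OF D] by (auto simp: fmeasurableD)
  moreover have "emeasure lebesgue (D k) \<noteq> \<infinity>" for k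
    using fmeasurableD2[OF compact_convexD(6)[OF D]] by simp
  ultimately have lim: "(\<lambda>k. vol (D k)) \<longlonglongrightarrow> vol (\<Inter>k. D k)" by (intro Lim_measure_decseq)
  have "(\<Inter>k. D k) \<subseteq> face K n + seg n"
  proof
    fix z assume z: "z \<in> (\<Inter>k. D k)"
    have "\<exists>t. 0 \<le> t \<and> t \<le> 1 \<and> z - t *\<^sub>R n \<in> slab K n (1 / real (Suc k))" for k
    proof -
      have "z \<in> slab K n (1 / real (Suc k)) + 1 \<cdot> seg n" using z by (auto simp: D_def)
      then obtain a b where "a \<in> slab K n (1 / real (Suc k))" "b \<in> 1 \<cdot> seg n" "z = a + b"
        by (rule set_plus_elim)
      then show ?thesis using mem_scaled_seg[of 1 b n] by auto
    qed
    then obtain t where t: "\<And>k. 0 \<le> t k" "\<And>k. t k \<le> 1" "\<And>k. z - t k *\<^sub>R n \<in> slab K n (1 / real (Suc k))"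
      by metis
    define t0 where "t0 = n \<bullet> z - supp K n"
    have b: "t0 \<le> t k" "t k \<le> t0 + 1 / real (Suc k)" for k
      using t(3)[of k] supp_ge[OF K, of "z - t k *\<^sub>R n" n]
      by (auto simp: slab_def t0_def inner_diff_right nn)
    have "(\<lambda>k. t0 + 1 / real (Suc k)) \<longlonglongrightarrow> t0 + 0" by (intro tendsto_intros LIMSEQ_Suc lim_1_over_n)
    then have tl: "t \<longlonglongrightarrow> t0" using b by (intro tendsto_sandwich[of "\<lambda>k. t0" t sequentially
        "\<lambda>k. t0 + 1 / real (Suc k)" t0]) auto
    then have "(\<lambda>k. z - t k *\<^sub>R n) \<longlonglongrightarrow> z - t0 *\<^sub>R n" by (intro tendsto_intros)
    moreover have "z - t k *\<^sub>R n \<in> K" for k using t(3) by (auto simp: slab_def)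
    ultimately have zK: "z - t0 *\<^sub>R n \<in> K"
      using closed_sequentially[OF compact_convexD(5)[OF K], of "\<lambda>k. z - t k *\<^sub>R n"] by simp
    have "0 \<le> t0" "t0 \<le> 1" using tl t(1,2) by (auto intro: LIMSEQ_le_const LIMSEQ_le_const2)
    then have "t0 *\<^sub>R n \<in> seg n" using mem_scaled_seg[of 1 "t0 *\<^sub>R n" n] by auto
    moreover have "z - t0 *\<^sub>R n \<in> face K n" using zK by (simp add: face_def t0_def inner_diff_right nn)
    ultimately have "(z - t0 *\<^sub>R n) + t0 *\<^sub>R n \<in> face K n + seg n" by (intro set_plus_intro)
    then show "z \<in> face K n + seg n" by simp
  qed
  then have "vol (\<Inter>k. D k) \<le> vol (face K n + seg n)"
    using compact_convexD(6)[OF D] K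
    by (intro measure_mono_fmeasurable) (auto intro!: compact_convexD(6) compact_convex_intros
        compact_convex_face compact_convex_seg sets.countable_INT fmeasurableD)
  moreover have "c \<le> vol (\<Inter>k. D k)"
    using lim by (rule LIMSEQ_le_const) (auto simp: D_def intro!: c)
  ultimately show ?thesis by simp
qed

lemma vol_subset_face:
  assumes "A \<subseteq> face K n" "norm n = 1"
  shows "vol A = 0"
proof -
  have "A \<subseteq> {z. n \<bullet> z = supp K n}" using assms by (auto simp: face_def)
  moreover have "n \<noteq> 0" using assms by auto
  ultimately have "negligible A" using negligible_hyperplane[of n "supp K n"]
    by (auto intro: negligible_subset)
  then show ?thesis by (rule negligible_imp_measure0)
qed

text \<open>The Bezout inequality for A and a low pyramid over K at q: the lower bound for V(A,B,K)
  and the upper bound for V(B,K,K) are linear in \<open>\<delta>\<close>, which cancels. As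
  \<open>vol (X + seg n)\<close> is the area of a planar X, the area of A relative to the face is
  bounded by V(A,K,K) / V(K).\<close>

lemma bezout_facet:
  assumes K: "compact_convex K" and bez: "bezout K" and q: "regular_at K q n"
    and A: "compact_convex A" and AF: "A \<subseteq> face K n" and qA: "q \<in> A"
  shows "vol (A + seg n) * vol K \<le> MV A K K * vol (face K n + seg n)"
proof -
  have n: "norm n = 1" using q by (auto simp: regular_at_def)
  note I = compact_convex_seg[of 0 n]
  have plus_seg: "vol (X + seg n) = vol X + 3 * MV X X (seg n)" if "compact_convex X" for X
    using vol_plus_scaled_seg[OF that, of 1 n] by simp
  have a: "vol (A + seg n) = 3 * MV A A (seg n)" using plus_seg[OF A] vol_subset_face[OF AF n] by simp
  have ineq: "vol (A + seg n) * vol K \<le> MV A K K * vol (slab K n \<tau> + seg n)" if \<tau>: "0 < \<tau>" for \<tau>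
  proof -
    let ?D = "slab K n \<tau>"
    have D: "compact_convex ?D" using compact_convex_slab[OF K] \<tau> by simp
    obtain \<delta> where \<delta>: "0 < \<delta>" and \<gamma>: "MV (convex hull (insert (q + \<delta> *\<^sub>R n) K)) K K - vol K
        \<le> \<delta> * MV ?D ?D (seg n)"
      using mixed_volume_raise_le[OF K q \<tau>] by metis
    define B where "B = convex hull (insert (q + \<delta> *\<^sub>R n) K)"
    have B: "compact_convex B" unfolding B_def by (rule compact_convex_insert[OF K])
    have "\<delta> * MV A A (seg n) \<le> MV A B K - MV A K K"
      unfolding B_def by (rule mixed_volume_raise_ge[OF K n A AF qA \<delta>])
    then have "(\<delta> * MV A A (seg n) + MV A K K) * vol K \<le> MV A B K * vol K"
      by (intro mult_right_mono) auto
    also have "\<dots> \<le> MV A K K * MV B K K" by (rule bezoutD[OF bez A B])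
    also have "\<dots> \<le> MV A K K * (vol K + \<delta> * MV ?D ?D (seg n))"
      using \<gamma> mixed_volume_nonneg[OF A K] by (intro mult_left_mono) (auto simp: B_def)
    finally have "\<delta> * (MV A A (seg n) * vol K) \<le> \<delta> * (MV A K K * MV ?D ?D (seg n))"
      by (simp add: algebra_simps)
    then have "MV A A (seg n) * vol K \<le> MV A K K * MV ?D ?D (seg n)" using \<delta> by simp
    also have "\<dots> \<le> MV A K K * (vol (?D + seg n) / 3)"
      using plus_seg[OF D] mixed_volume_nonneg[OF A K] by (intro mult_left_mono) auto
    finally show ?thesis using a by simp
  qed
  show ?thesis
  proof (cases "MV A K K = 0")
    case True then show ?thesis using ineq[of 1] by simp
  next
    case False
    then have pos: "0 < MV A K K" using mixed_volume_nonneg[OF A K] by simp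
    have "vol (A + seg n) * vol K / MV A K K \<le> vol (face K n + seg n)"
      using ineq pos by (intro vol_face_le[OF K n]) (simp add: divide_le_eq mult.commute)
    then show ?thesis using pos by (simp add: divide_le_eq mult.commute)
  qed
qed

text \<open>(1 + s) K has room for a prism of height \<open>s * \<epsilon>\<close> over the face
  beside \<open>K + s \<cdot> A\<close>: A stays \<open>\<epsilon>\<close> below the plane of m, and
  the touching ball keeps the prism inside.\<close>

lemma mixed_volume_facet_cut_le:
  assumes K: "compact_convex K" and p: "regular_at K p m"
  obtains \<epsilon>0 where "0 < \<epsilon>0"
    "\<And>A \<epsilon>. compact_convex A \<Longrightarrow> A \<subseteq> K \<Longrightarrow> 0 < \<epsilon> \<Longrightarrow> \<epsilon> \<le> \<epsilon>0 \<Longrightarrow> (\<And>z. z \<in> A \<Longrightarrow> m \<bullet> z \<le> supp K m - \<epsilon>) \<Longrightarrow>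
      MV A K K + \<epsilon> * MV (face K m) (face K m) (seg m) \<le> vol K"
proof -
  obtain r where r: "0 < r" "cball (p - r *\<^sub>R m) r \<subseteq> K" and m: "norm m = 1" and mp: "m \<bullet> p = supp K m"
    using p by (auto simp: regular_at_def face_def)
  have mm: "m \<bullet> m = 1" using m by (simp add: dot_square_norm)
  define c where "c = p - r *\<^sub>R m"
  define H where "H = face K m"
  have H: "compact_convex H" unfolding H_def by (rule compact_convex_face[OF K])
  have HK: "H \<subseteq> K" by (auto simp: H_def face_def)
  note I = compact_convex_seg[of 0 m]
  define d where "d = MV H H (seg m)"
  have d: "0 \<le> d" using mixed_volume_nonneg[OF I H] mixed_volume_rotate(2)[OF H H I] by (simp add: d_def)
  show thesis
  proof (rule that[OF r(1)])
    fix A \<epsilon> assume A: "compact_convex A" and AK: "A \<subseteq> K" and \<epsilon>: "0 < \<epsilon>" "\<epsilon> \<le> r"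
      and cut: "\<And>z. z \<in> A \<Longrightarrow> m \<bullet> z \<le> supp K m - \<epsilon>"
    have "0 \<le> 3 * (vol K - MV K K A - \<epsilon> * d) + 3 * (vol K - MV K A A) * s + (vol K - vol A) * s\<^sup>2"
      if s: "0 < s" "s \<le> 1" for s
    proof -
      \<comment> \<open>The weight given to the ball: from its centre to the plane of m the height
        is r, so \<open>\<kappa> * r\<close> is the height of the prism. The face gets the remaining
        weight g.\<close>
      define \<kappa> where "\<kappa> = s * \<epsilon> / r"
      have \<kappa>: "0 < \<kappa>" "\<kappa> \<le> s" "\<kappa> * r = s * \<epsilon>" using s \<epsilon> r by (auto simp: \<kappa>_def divide_le_eq mult_left_mono)
      define g where "g = 1 + s - \<kappa>"
      have g: "1 \<le> g" using \<kappa> by (simp add: g_def)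
      define Y where "Y = g \<cdot> H + (s * \<epsilon>) \<cdot> seg m + {\<kappa> *\<^sub>R c}"
      have Y: "compact_convex Y" unfolding Y_def by (intro compact_convex_intros H I)
      have mem_Y: "\<exists>y\<in>H. \<exists>u. 0 \<le> u \<and> u \<le> s * \<epsilon> \<and> z = g *\<^sub>R y + u *\<^sub>R m + \<kappa> *\<^sub>R c" if "z \<in> Y" for z
      proof -
        obtain y where "y \<in> g \<cdot> H + (s * \<epsilon>) \<cdot> seg m" and z: "z = y + \<kappa> *\<^sub>R c"
          using \<open>z \<in> Y\<close> unfolding Y_def by (rule set_plus_elim) simp
        then obtain h u where "h \<in> H" "0 \<le> u" "u \<le> s * \<epsilon>" "y = g *\<^sub>R h + u *\<^sub>R m"
          using mem_plus_scaled_seg[of "s * \<epsilon>" y "g \<cdot> H" m] s \<epsilon> by auto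
        then show ?thesis using z by blast
      qed
      have "vol (K + s \<cdot> A) + vol Y \<le> vol ((1 + s) \<cdot> K)"
      proof (rule vol_Un_separated)
        show "compact_convex (K + s \<cdot> A)" "compact_convex ((1 + s) \<cdot> K)"
          using K A by (auto intro!: compact_convex_intros)
        show "m \<noteq> 0" using m by auto
        have "K + s \<cdot> A \<subseteq> 1 \<cdot> K + s \<cdot> K" using AK by (intro set_plus_mono2) auto
        then show "K + s \<cdot> A \<subseteq> (1 + s) \<cdot> K" using scaled_add[OF K, of 1 s] s by simp
        show "Y \<subseteq> (1 + s) \<cdot> K"
        proof
          fix z assume "z \<in> Y"
          then obtain y u where y: "y \<in> H" "0 \<le> u" "u \<le> s * \<epsilon>" "z = g *\<^sub>R y + u *\<^sub>R m + \<kappa> *\<^sub>R c"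
            using mem_Y by blast
          have "u / \<kappa> \<le> r" using y(3) \<kappa> by (simp add: divide_le_eq mult.commute)
          then have "c + (u / \<kappa>) *\<^sub>R m \<in> K"
            using r(2) m y(2) \<kappa> by (intro subsetD[OF r(2)]) (simp add: c_def dist_norm)
          then have "g *\<^sub>R y + \<kappa> *\<^sub>R (c + (u / \<kappa>) *\<^sub>R m) \<in> g \<cdot> K + \<kappa> \<cdot> K" using y(1) HK
            by (intro set_plus_intro) auto
          moreover have "g *\<^sub>R y + \<kappa> *\<^sub>R (c + (u / \<kappa>) *\<^sub>R m) = z" using \<kappa> y(4)
            by (simp add: scaleR_add_right)
          ultimately show "z \<in> (1 + s) \<cdot> K" using scaled_add[OF K, of g \<kappa>] g \<kappa> by (simp add: g_def)
        qed
        fix z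
        { assume "z \<in> K + s \<cdot> A"
          then obtain k a where "k \<in> K" "a \<in> A" "z = k + s *\<^sub>R a" by (auto elim!: set_plus_elim)
          then show "m \<bullet> z \<le> (1 + s) * supp K m - s * \<epsilon>"
            using supp_ge[OF K, of k m] mult_left_mono[OF cut[of a], of s] s
            by (simp add: inner_add_right algebra_simps)
        next
          assume "z \<in> Y"
          then obtain y u where y: "y \<in> H" "0 \<le> u" "z = g *\<^sub>R y + u *\<^sub>R m + \<kappa> *\<^sub>R c" using mem_Y by blast
          have "m \<bullet> z = g * supp K m + u + (\<kappa> * supp K m - \<kappa> * r)"
            using y by (simp add: inner_add_right inner_diff_right mm mp c_def H_def face_def
                right_diff_distrib)
          also have "\<dots> = (1 + s) * supp K m - s * \<epsilon> + u" using \<kappa>(3) by (simp add: g_def algebra_simps)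
          finally show "(1 + s) * supp K m - s * \<epsilon> \<le> m \<bullet> z" using y(2) by simp
        }
      qed (rule Y)
      moreover have "3 * (s * \<epsilon>) * d \<le> vol Y"
      proof -
        have "vol Y = vol (g \<cdot> H) + 3 * (s * \<epsilon>) * MV (g \<cdot> H) (g \<cdot> H) (seg m)"
          unfolding Y_def vol_plus_singleton using H s \<epsilon>
            by (intro vol_plus_scaled_seg compact_convex_intros) auto
        also have "MV (g \<cdot> H) (g \<cdot> H) (seg m) = g\<^sup>2 * d"
          using H I g by (simp add: mixed_volume_linear compact_convex_intros d_def power2_eq_square)
        finally have "vol Y = vol (g \<cdot> H) + 3 * (s * \<epsilon>) * (g\<^sup>2 * d)" .
        moreover have "1 * d \<le> g\<^sup>2 * d" using g d by (intro mult_right_mono) (auto simp: one_le_power)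
        then have "3 * (s * \<epsilon>) * d \<le> 3 * (s * \<epsilon>) * (g\<^sup>2 * d)" using s \<epsilon> by (intro mult_left_mono) auto
        ultimately show ?thesis by (smt (verit) measure_nonneg)
      qed
      ultimately have "vol (K + s \<cdot> A) + 3 * (s * \<epsilon>) * d \<le> vol ((1 + s) \<cdot> K)" by linarith
      then have "0 \<le> s * (3 * (vol K - MV K K A - \<epsilon> * d) + 3 * (vol K - MV K A A) * s
          + (vol K - vol A) * s\<^sup>2)"
        using K A s by (simp add: vol_plus_scaled vol_scaled) (simp add: algebra_simps power2_eq_square
            power3_eq_cube)
      then show ?thesis using s by (simp add: zero_le_mult_iff)
    qed
    then have "0 \<le> 3 * (vol K - MV K K A - \<epsilon> * d)" by (rule nonneg_at_0_of_quadratic)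
    then show "MV A K K + \<epsilon> * MV (face K m) (face K m) (seg m) \<le> vol K"
      using mixed_volume_rotate(2)[OF K K A] by (simp add: d_def H_def)
  qed
qed

text \<open>
  If two facets had a single common point \<open>y\<close>, then cutting the first facet at depth \<open>\<epsilon>\<close> below the
  plane of the second would change its area by \<open>o(\<epsilon>)\<close>, but its mixed volume with \<open>K\<close> linearly in \<open>\<epsilon>\<close>.
\<close>

lemma facets_meet_not_singleton:
  assumes K: "convex_body K" and bez: "bezout K" and n: "n \<in> regular_normals K"
    and m: "m \<in> regular_normals K"
    and nm: "n \<noteq> m" and Fn: "0 < vol (face K n + seg n)" and Fm: "0 < vol (face K m + seg m)"
  shows "face K n \<inter> face K m \<noteq> {y}"
proof
  assume single: "face K n \<inter> face K m = {y}"
  note K' = convex_body_compact_convex[OF K]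
  note I = compact_convex_seg[of 0 n]
  define G where "G = face K n"
  have G: "compact_convex G" unfolding G_def by (rule compact_convex_face[OF K'])
  have GK: "G \<subseteq> K" by (auto simp: G_def face_def)
  have Gn: "n \<bullet> z = supp K n" if "z \<in> G" for z using that by (simp add: G_def face_def)
  have yG: "y \<in> G" and ym: "m \<bullet> y = supp K m" using single by (auto simp: G_def face_def)
  have n1: "norm n = 1" and m1: "norm m = 1" using n m regular_normals_norm by auto
  have nn: "n \<bullet> n = 1" using n1 by (simp add: dot_square_norm)
  obtain q where q: "regular_at K q n" using n by (auto simp: regular_normals_def)
  obtain p where p: "regular_at K p m" using m by (auto simp: regular_normals_def)
  have qG: "q \<in> G" using q by (simp add: regular_at_def G_def)
  have qm: "m \<bullet> q < supp K m"
  proof -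
    have "m \<bullet> q \<noteq> supp K m" using regular_normal_unique[OF K' q, of m] nm m1 by auto
    then show ?thesis using supp_ge[OF K', of q m] qG GK by force
  qed
  define d where "d = MV (face K m) (face K m) (seg m)"
  have d: "0 < d"
    using Fm vol_plus_scaled_seg[OF compact_convex_face[OF K'], of 1 m m] vol_subset_face[OF order_refl m1]
    by (simp add: d_def)
  obtain \<epsilon>0 where \<epsilon>0: "0 < \<epsilon>0" and loss: "\<And>A \<epsilon>. compact_convex A \<Longrightarrow> A \<subseteq> K \<Longrightarrow> 0 < \<epsilon> \<Longrightarrow> \<epsilon> \<le> \<epsilon>0 \<Longrightarrow>
      (\<And>z. z \<in> A \<Longrightarrow> m \<bullet> z \<le> supp K m - \<epsilon>) \<Longrightarrow> MV A K K + \<epsilon> * d \<le> vol K"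
    using mixed_volume_facet_cut_le[OF K' p] unfolding d_def by metis
  \<comment> \<open>With \<open>b\<close> below, \<open>m'\<close>, \<open>b\<close> and n are
    orthogonal; inside the face of n the cut by m is a cut orthogonal to \<open>m'\<close>.\<close>
  define m' where "m' = m - (m \<bullet> n) *\<^sub>R n"
  have m'n: "m' \<bullet> n = 0" by (simp add: m'_def inner_diff_left nn)
  have m'0: "m' \<noteq> 0"
  proof
    assume "m' = 0"
    then have "m = (m \<bullet> n) *\<^sub>R n" by (simp add: m'_def)
    then have "m \<bullet> q = (m \<bullet> n) * (n \<bullet> q)" "m \<bullet> y = (m \<bullet> n) * (n \<bullet> y)" by (metis inner_scaleR_left)+
    then show False using qm ym Gn[OF qG] Gn[OF yG] by simp
  qed
  define b where "b = cross3 n m'"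
  have bn: "b \<bullet> n = 0" by (simp add: b_def dot_cross_self inner_commute)
  define M :: "real ^ 3 ^ 3" where "M = vector [m', b, n]"
  have M: "(M *v z) $ 1 = m' \<bullet> z" "(M *v z) $ 2 = b \<bullet> z" "(M *v z) $ 3 = n \<bullet> z" for z
    by (simp_all add: matrix_vector_mul_component M_def)
  have "cross3 b n = m'"
  proof -
    have "cross3 b n = - cross3 n (cross3 n m')" by (simp add: b_def cross_skew[of _ n])
    also have "\<dots> = m'" using m'n by (simp add: Lagrange nn inner_commute)
    finally show ?thesis .
  qed
  then have det: "det M = m' \<bullet> m'" by (simp add: M_def flip: dot_cross_det)
  then have D: "0 < det M" using m'0 by simp
  define V where "V = vol K"
  have V: "0 < V" unfolding V_def by (rule convex_body_vol_pos[OF K])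
  define a where "a = vol (G + seg n)"
  have a: "0 < a" using Fn by (simp add: a_def G_def)
  \<comment> \<open>Small enough for the final chain to bound \<open>d * a * det M\<close> by half
    of itself.\<close>
  define \<eta> where "\<eta> = d * a * det M / (16 * V * (norm b + 1))"
  have nb: "0 < norm b + 1" by (simp add: add_nonneg_pos)
  have \<eta>: "0 < \<eta>" unfolding \<eta>_def using d a D V nb by (intro divide_pos_pos mult_pos_pos) auto
  have "compact (G - ball y \<eta>)" using compact_convexD(2)[OF G] by (intro compact_diff) auto
  moreover have "face K m \<inter> (G - ball y \<eta>) = {}"
  proof -
    have "z \<in> ball y \<eta>" if "z \<in> face K m" "z \<in> G" for z
    proof -
      have "z \<in> face K n \<inter> face K m" using that by (simp add: G_def)
      then have "z = y" using single by simp
      then show ?thesis using \<eta> by simp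
    qed
    then show ?thesis by auto
  qed
  ultimately obtain \<epsilon>1 where \<epsilon>1: "0 < \<epsilon>1" "\<And>z. z \<in> G - ball y \<eta> \<Longrightarrow> m \<bullet> z \<le> supp K m - \<epsilon>1"
    using face_disjoint_cut[OF K', of "G - ball y \<eta>" m] GK by blast
  \<comment> \<open>Below \<open>\<epsilon>1\<close> the piece cut off lies within
    \<open>\<eta>\<close> of y; the other bounds make \<open>loss\<close> applicable and keep q in
    \<open>A\<close>.\<close>
  define \<epsilon> where "\<epsilon> = min (\<epsilon>1 / 2) (min \<epsilon>0 (supp K m - m \<bullet> q))"
  have \<epsilon>: "0 < \<epsilon>" "\<epsilon> < \<epsilon>1" "\<epsilon> \<le> \<epsilon>0" "m \<bullet> q \<le> supp K m - \<epsilon>"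
    using \<epsilon>1 \<epsilon>0 qm by (auto simp: \<epsilon>_def)
  define A where "A = G \<inter> {z. m \<bullet> z \<le> supp K m - \<epsilon>}"
  have A: "compact_convex A" unfolding A_def using qG \<epsilon> by (intro compact_convex_cut[OF G]) auto
  have AF: "A \<subseteq> face K n" and qA: "q \<in> A" using qG \<epsilon> by (auto simp: A_def G_def)
  \<comment> \<open>The piece cut off: its extent is of order \<open>\<epsilon>\<close> along
    \<open>m'\<close> and \<open>\<eta>\<close> along \<open>b\<close>, so its area is at most of
    order \<open>\<epsilon> * \<eta>\<close>.\<close>
  define E where "E = G \<inter> {z. (- m) \<bullet> z \<le> - (supp K m - \<epsilon>)}"
  have E: "compact_convex E" unfolding E_def using yG ym \<epsilon> by (intro compact_convex_cut[OF G]) auto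
  have C: "compact_convex (A + seg n)" "compact_convex (E + seg n)" "compact_convex (G + seg n)"
    using A E G I by (auto intro!: compact_convex_intros)
  have "vol (A + seg n) * V \<le> MV A K K * a"
    using bezout_facet[OF K' bez q A AF qA] by (simp add: V_def a_def G_def)
  also have "\<dots> \<le> (V - \<epsilon> * d) * a"
  proof (rule mult_right_mono)
    have "A \<subseteq> K" "\<And>z. z \<in> A \<Longrightarrow> m \<bullet> z \<le> supp K m - \<epsilon>" using GK by (auto simp: A_def)
    then show "MV A K K \<le> V - \<epsilon> * d" using loss[OF A _ \<epsilon>(1,3)] by (simp add: V_def le_diff_eq)
  qed (use a in simp)
  finally have up: "vol (A + seg n) * V \<le> (V - \<epsilon> * d) * a" .
  have "a \<le> vol ((A + seg n) \<union> (E + seg n))"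
  proof -
    have "G \<subseteq> A \<union> E" by (auto simp: A_def E_def)
    then have "G + seg n \<subseteq> (A + seg n) \<union> (E + seg n)" by (auto simp: set_plus_def)
    then show ?thesis unfolding a_def
      using C by (intro measure_mono_fmeasurable) (simp_all add: fmeasurableD compact_convexD(6)
          fmeasurable.Un)
  qed
  also have "\<dots> \<le> vol (A + seg n) + vol (E + seg n)"
    using C by (intro measure_Un_le) (simp_all add: fmeasurableD compact_convexD(6))
  finally have "(a - vol (E + seg n)) * V \<le> vol (A + seg n) * V" using V by (intro mult_right_mono) auto
  with up have "\<epsilon> * d * a \<le> V * vol (E + seg n)" by (simp add: algebra_simps)
  then have low: "(\<epsilon> * d * a) * det M \<le> V * (det M * vol (E + seg n))"
    using mult_right_mono[of "\<epsilon> * d * a" "V * vol (E + seg n)" "det M"] D by (simp add: algebra_simps)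
  define r :: "real ^ 3" where "r = vector [\<epsilon>, norm b * \<eta>, 1]"
  have r: "r $ 1 = \<epsilon>" "r $ 2 = norm b * \<eta>" "r $ 3 = 1" by (simp_all add: r_def)
  have "\<bar>det M\<bar> * vol (E + seg n) \<le> 8 * (r $ 1 * r $ 2 * r $ 3)"
  proof (rule vol_parallelepiped_le[OF compact_convexD(6)[OF C(2)]])
    show "0 \<le> r $ i" for i using exhaust_3[of i] \<epsilon> \<eta> r by auto
    fix z i assume "z \<in> E + seg n"
    then have "z \<in> E + 1 \<cdot> seg n" by simp
    then obtain g t where g: "g \<in> E" and t: "0 \<le> t" "t \<le> 1" and z: "z = g + t *\<^sub>R n"
      using mem_plus_scaled_seg[of 1 z E n] by auto
    have gG: "g \<in> G" and gm: "supp K m - \<epsilon> \<le> m \<bullet> g" using g by (auto simp: E_def)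
    have "g \<in> ball y \<eta>" using \<epsilon>1(2)[of g] gG gm \<epsilon>(2) by force
    then have "norm b * norm (g - y) \<le> norm b * \<eta>"
      by (intro mult_left_mono) (auto simp: dist_norm norm_minus_commute)
    then have 2: "\<bar>b \<bullet> z - b \<bullet> y\<bar> \<le> norm b * \<eta>"
      using Cauchy_Schwarz_ineq2[of b "g - y"] by (simp add: z inner_add_right inner_diff_right bn)
    have "m' \<bullet> z = m \<bullet> g - (m \<bullet> n) * supp K n" "m \<bullet> g \<le> supp K m"
      using m'n Gn[OF gG] supp_ge[OF K', of g m] gG GK
      by (auto simp: z inner_add_right m'_def inner_diff_left)
    then have 1: "\<bar>m' \<bullet> z - (supp K m - (m \<bullet> n) * supp K n)\<bar> \<le> \<epsilon>" using gm by (simp add: abs_le_iff)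
    have 3: "\<bar>n \<bullet> z - supp K n\<bar> \<le> 1" using t Gn[OF gG] by (simp add: z inner_add_right nn)
    show "\<bar>(M *v z) $ i - vector [supp K m - (m \<bullet> n) * supp K n, b \<bullet> y, supp K n] $ i\<bar> \<le> r $ i"
      using exhaust_3[of i] 1 2 3 M[of z] r by (elim disjE) simp_all
  qed
  then have "det M * vol (E + seg n) \<le> 8 * (\<epsilon> * (norm b * \<eta>))" using D r by simp
  then have "V * (det M * vol (E + seg n)) \<le> V * (8 * (\<epsilon> * (norm b * \<eta>)))" using V
    by (intro mult_left_mono) auto
  with low have "\<epsilon> * (d * a * det M) \<le> \<epsilon> * (8 * V * norm b * \<eta>)" by (simp add: algebra_simps)
  then have "d * a * det M \<le> 8 * V * norm b * \<eta>" using \<epsilon>(1) by simp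
  also have "\<dots> \<le> 8 * V * (norm b + 1) * \<eta>" using V \<eta> by (intro mult_right_mono mult_left_mono) auto
  also have "\<dots> = d * a * det M / 2"
  proof -
    have "8 * V * c * (e / (16 * V * c)) = e / 2" if "0 < c" for c e :: real using V that by simp
    from this[OF nb] show ?thesis by (simp add: \<eta>_def)
  qed
  finally show False using d a D by (simp add: mult_le_cancel_right1 mult_pos_pos not_le)
qed

text \<open>\<open>F + seg n\<close> has empty interior and lies in a plane with normal w. It
  contains f and f + n, so w is orthogonal to n, and F lies in two planes that meet in a line along
  \<open>cross3 w n\<close>.\<close>

lemma collinear_if_vol_plus_seg_0:
  assumes F: "compact_convex F" and n: "norm n = 1" and flat: "\<And>z. z \<in> F \<Longrightarrow> n \<bullet> z = h"
    and v: "vol (F + seg n) = 0"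
  shows "collinear F"
proof -
  have C: "compact_convex (F + seg n)" using F by (intro compact_convex_intros compact_convex_seg)
  have "interior (F + seg n) = {}"
  proof (rule ccontr)
    assume "interior (F + seg n) \<noteq> {}"
    then have "convex_body (F + seg n)" using C by (simp add: convex_body_def compact_convex_def)
    then show False using convex_body_vol_pos v by force
  qed
  then obtain w k where w: "w \<noteq> 0" "F + seg n \<subseteq> {x. w \<bullet> x = k}"
    using empty_interior_subset_hyperplane[OF compact_convexD(3)[OF C]] by metis
  obtain f where f: "f \<in> F" using compact_convexD(1)[OF F] by blast
  have Fw: "w \<bullet> z = k" if "z \<in> F" for z
    using set_plus_intro[OF that, of 0 "seg n"] w(2) by auto
  have "f + n \<in> F + seg n" using f by (intro set_plus_intro) auto
  then have wn: "w \<bullet> n = 0" using w(2) Fw[OF f] by (auto simp: inner_add_right)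
  have nn: "n \<bullet> n = 1" using n by (simp add: dot_square_norm)
  define u where "u = cross3 w n"
  have u0: "u \<noteq> 0"
  proof
    assume "u = 0"
    then have "cross3 n (cross3 w n) = 0" by (simp add: u_def cross_zero_right)
    then show False using w(1) wn by (simp add: Lagrange nn inner_commute)
  qed
  show ?thesis unfolding collinear_def
  proof (intro exI[of _ u] ballI)
    fix x z assume xz: "x \<in> F" "z \<in> F"
    have "w \<bullet> (x - z) = 0" "n \<bullet> (x - z) = 0" using Fw flat xz by (simp_all add: inner_diff_right)
    then have "cross3 (x - z) u = 0" by (simp add: u_def Lagrange inner_commute)
    then have "collinear {0, u, x - z}" by (metis cross_eq_0 cross_skew neg_equal_0_iff_equal)
    then show "\<exists>c. x - z = c *\<^sub>R u" using u0 unfolding collinear_lemma by (auto intro: exI[of _ 0])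
  qed
qed

section \<open>Combinatorics of the regular faces\<close>

text \<open>By pigeonhole some k coefficients share a sign and therefore vanish. Exchanging one of
  them for s keeps the sign constant, so \<open>u s\<close> vanishes too.\<close>

lemma vanish_if_sign_constant_subsets_vanish:
  fixes u :: "'a \<Rightarrow> real"
  assumes S: "finite S" and k: "1 \<le> k" "2 * k \<le> Suc (card S)"
    and van: "\<And>T. T \<subseteq> S \<Longrightarrow> card T = k \<Longrightarrow> (\<forall>t\<in>T. 0 \<le> u t) \<or> (\<forall>t\<in>T. u t \<le> 0) \<Longrightarrow> \<forall>t\<in>T. u t = 0"
    and s: "s \<in> S"
  shows "u s = 0"
proof -
  define P where "P = {t \<in> S. 0 \<le> u t}"
  define N where "N = {t \<in> S. u t \<le> 0}"
  have fin: "finite P" "finite N" using S by (auto simp: P_def N_def)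
  have "S \<subseteq> P \<union> N" by (auto simp: P_def N_def)
  then have "card S \<le> card P + card N"
    using fin card_Un_le[of P N] card_mono[of "P \<union> N" S] by simp
  then have "k \<le> card P \<or> k \<le> card N" using k by linarith
  then obtain T where T: "T \<subseteq> P \<or> T \<subseteq> N" "card T = k"
    using obtain_subset_with_card_n[of k P] obtain_subset_with_card_n[of k N] by metis
  then have TS: "T \<subseteq> S" by (auto simp: P_def N_def)
  have zero: "\<forall>t\<in>T. u t = 0" using T by (intro van[OF TS]) (auto simp: P_def N_def)
  show ?thesis
  proof (cases "s \<in> T")
    case False
    have finT: "finite T" using TS S finite_subset by blast
    obtain t0 where t0: "t0 \<in> T" using T(2) k(1) by (metis card.empty ex_in_conv not_one_le_zero)
    let ?T = "insert s (T - {t0})"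
    have "card ?T = k" using False finT t0 T(2) k(1) by simp
    moreover have "(\<forall>t\<in>?T. 0 \<le> u t) \<or> (\<forall>t\<in>?T. u t \<le> 0)" using zero by (cases "0 \<le> u s") auto
    ultimately have "\<forall>t\<in>?T. u t = 0" using TS s by (intro van) auto
    then show ?thesis by simp
  qed (use zero in blast)
qed

lemma interior_gap:
  assumes K: "convex_body K"
  obtains c where "\<And>n. norm n = 1 \<Longrightarrow> n \<bullet> c < supp K n"
proof -
  note K' = convex_body_compact_convex[OF K]
  obtain c \<rho> where \<rho>: "0 < \<rho>" "cball c \<rho> \<subseteq> K"
    using K by (auto simp: convex_body_def mem_interior_cball)
  show thesis
  proof (rule that)
    fix n :: "real ^ 3" assume n: "norm n = 1"
    then have "c + \<rho> *\<^sub>R n \<in> K" using \<rho> by (intro subsetD[OF \<rho>(2)]) (simp add: dist_norm)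
    from supp_ge[OF K' this, of n] n \<rho> show "n \<bullet> c < supp K n"
      by (simp add: inner_add_right dot_square_norm)
  qed
qed

text \<open>
  Three normals orthogonal to a common edge are linearly dependent, and the sign pattern of the
  dependency makes one of the three faces a subset of another one.
\<close>

lemma three_regular_faces:
  assumes K: "convex_body K" and S: "S \<subseteq> regular_normals K" "card S = 3"
    and ab: "a \<noteq> b" "\<And>n. n \<in> S \<Longrightarrow> a \<in> face K n" "\<And>n. n \<in> S \<Longrightarrow> b \<in> face K n"
  shows False
proof -
  note K' = convex_body_compact_convex[OF K]
  have finS: "finite S" using S(2) by (simp add: card_ge_0_finite)
  have orth: "orthogonal (a - b) n" if "n \<in> S" for n
    using ab(2,3)[OF that] by (simp add: face_def orthogonal_def inner_commute[of _ n] inner_diff_right)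
  have "dependent S"
  proof (rule ccontr)
    assume "\<not> dependent S"
    then have "UNIV \<subseteq> span S" using S(2) by (intro card_ge_dim_independent) auto
    then have "orthogonal (a - b) (a - b)" using orth orthogonal_to_span[of "a - b" S "a - b"] by blast
    then show False using ab(1) by (simp add: orthogonal_self)
  qed
  then obtain u where u: "\<exists>v\<in>S. u v \<noteq> 0" "(\<Sum>v\<in>S. u v *\<^sub>R v) = 0" using dependent_finite[OF finS] by auto
  define f where "f n z = supp K n - n \<bullet> z" for n z
  have rel: "(\<Sum>v\<in>S. u v * f v z) = 0" for z
  proof -
    have "f v z = v \<bullet> (a - z)" if "v \<in> S" for v using ab(2)[OF that]
      by (simp add: f_def face_def inner_diff_right)
    then have "(\<Sum>v\<in>S. u v * f v z) = (\<Sum>v\<in>S. (u v *\<^sub>R v) \<bullet> (a - z))" by simp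
    also have "\<dots> = (\<Sum>v\<in>S. u v *\<^sub>R v) \<bullet> (a - z)" by (simp only: inner_sum_left)
    finally show ?thesis by (simp add: u(2))
  qed
  obtain c where c: "\<And>n. norm n = 1 \<Longrightarrow> n \<bullet> c < supp K n" using interior_gap[OF K] by metis
  have fc: "0 < f v c" if "v \<in> S" for v
    using c[OF regular_normals_norm[of v K]] S(1) that by (auto simp: f_def)
  have core: False
    if u: "\<exists>v\<in>S. u v \<noteq> 0" and rel: "\<And>z. (\<Sum>v\<in>S. u v * f v z) = 0"
        and v0: "v0 \<in> S" "\<forall>v\<in>S - {v0}. 0 \<le> u v" for u v0
  proof (cases "0 \<le> u v0")
    case True
    then have "\<forall>v\<in>S. 0 \<le> u v" using v0(2) by blast
    then have "\<forall>v\<in>S. 0 \<le> u v * f v c" using fc by (simp add: less_imp_le)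
    then have "\<forall>v\<in>S. u v * f v c = 0" using rel[of c] sum_nonneg_eq_0_iff[OF finS, of "\<lambda>v. u v * f v c"]
      by auto
    then show False using u fc by force
  next
    case False
    have split: "u v0 * f v0 z + (\<Sum>v\<in>S - {v0}. u v * f v z) = 0" for z
      using rel[of z] sum.remove[OF finS v0(1), of "\<lambda>v. u v * f v z"] by simp
    have "0 < (\<Sum>v\<in>S - {v0}. u v * f v c)"
      using split[of c] mult_neg_pos[of "u v0" "f v0 c"] False fc[OF v0(1)] by linarith
    then obtain v1 where v1: "v1 \<in> S - {v0}" "0 < u v1"
      using v0(2) by (metis (no_types, lifting) less_eq_real_def less_irrefl mult_zero_left sum.neutral)
    have "face K v0 \<subseteq> face K v1"
    proof
      fix z assume z: "z \<in> face K v0"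
      then have zK: "z \<in> K" and "f v0 z = 0" by (auto simp: face_def f_def)
      then have "(\<Sum>v\<in>S - {v0}. u v * f v z) = 0" using split[of z] by simp
      moreover have "\<forall>v\<in>S - {v0}. 0 \<le> u v * f v z" using v0(2) supp_ge[OF K' zK] by (simp add: f_def)
      ultimately have "u v1 * f v1 z = 0"
        using sum_nonneg_eq_0_iff[of "S - {v0}" "\<lambda>v. u v * f v z"] finS v1(1) by auto
      then show "z \<in> face K v1" using v1(2) zK by (simp add: f_def face_def)
    qed
    then have "v1 = v0"
      using S(1) v0(1) v1(1) by (intro regular_face_subset_imp_eq[OF K']) (auto intro: regular_normals_norm)
    then show False using v1(1) by simp
  qed
  obtain n1 n2 n3 where S3: "S = {n1, n2, n3}" using S(2) by (auto simp: card_3_iff)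
  have "(\<exists>v0\<in>S. \<forall>v\<in>S - {v0}. 0 \<le> u v) \<or> (\<exists>v0\<in>S. \<forall>v\<in>S - {v0}. 0 \<le> - u v)"
    \<comment> \<open>Of three coefficients two share a sign, so up to a global sign at most one is
      negative.\<close>
    unfolding S3 by (cases "0 \<le> u n1"; cases "0 \<le> u n2"; cases "0 \<le> u n3") auto
  then show False
  proof
    assume "\<exists>v0\<in>S. \<forall>v\<in>S - {v0}. 0 \<le> u v"
    then show False using core[OF u(1) rel] by blast
  next
    assume "\<exists>v0\<in>S. \<forall>v\<in>S - {v0}. 0 \<le> - u v"
    then show False using core[of "\<lambda>v. - u v"] u(1) rel by (auto simp: sum_negf)
  qed
qed

text \<open>Outside a set T of k faces two faces remain. At the midpoint of a segment common to them
  their functions vanish, while those of T are positive, as by \<open>three_regular_faces\<close> no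
  third face contains both end points. So coefficients of constant sign on T vanish. Used with k = 3
  for five facets and k = 2 for four lateral faces of a cone.\<close>

lemma regular_faces_share_edges_independent:
  assumes K: "convex_body K" and S: "S \<subseteq> regular_normals K" "finite S" "card S = k + 2"
    and k: "1 \<le> k" "k \<le> 3"
    and edges: "\<And>i j. i \<in> S \<Longrightarrow> j \<in> S \<Longrightarrow> i \<noteq> j \<Longrightarrow> \<exists>a b. a \<noteq> b \<and> a \<in> face K i \<inter> face K j
        \<and> b \<in> face K i \<inter> face K j"
    and rel: "\<And>z. (\<Sum>n\<in>S. u n * (supp K n - n \<bullet> z)) = 0" and s: "s \<in> S"
  shows "u s = 0"
proof (rule vanish_if_sign_constant_subsets_vanish[OF S(2) k(1) _ _ s])
  note K' = convex_body_compact_convex[OF K]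
  show "2 * k \<le> Suc (card S)" using S(3) k by simp
  fix T assume T: "T \<subseteq> S" "card T = k" and sign: "(\<forall>t\<in>T. 0 \<le> u t) \<or> (\<forall>t\<in>T. u t \<le> 0)"
  have finT: "finite T" using T S(2) finite_subset by blast
  have "card (S - T) = 2" using T S card_Diff_subset[OF finT T(1)] by simp
  then obtain i j where ij: "S - T = {i, j}" "i \<noteq> j" by (auto simp: card_2_iff)
  then have ijS: "i \<in> S" "j \<in> S" "i \<notin> T" "j \<notin> T" by auto
  obtain a b where ab: "a \<noteq> b" "a \<in> face K i \<inter> face K j" "b \<in> face K i \<inter> face K j"
    using edges[OF ijS(1,2) ij(2)] by blast
  define p where "p = (1 / 2) *\<^sub>R (a + b)"
  have pos: "0 < supp K t - t \<bullet> p" if t: "t \<in> T" for t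
  proof -
    have le: "t \<bullet> a \<le> supp K t" "t \<bullet> b \<le> supp K t" using ab supp_ge[OF K'] by (auto simp: face_def)
    have tp: "t \<bullet> p = (t \<bullet> a + t \<bullet> b) / 2" by (simp add: p_def inner_add_right)
    have "\<not> (t \<bullet> a = supp K t \<and> t \<bullet> b = supp K t)"
    proof
      assume "t \<bullet> a = supp K t \<and> t \<bullet> b = supp K t"
      then have "a \<in> face K t" "b \<in> face K t" using ab by (auto simp: face_def)
      moreover have "card {t, i, j} = 3" using t ij(2) ijS by (subst card_3_iff) blast
      moreover have "{t, i, j} \<subseteq> regular_normals K" using t T(1) ijS S(1) by auto
      ultimately show False using three_regular_faces[OF K, of "{t, i, j}" a b] ab by auto
    qed
    then show ?thesis using le tp by argo
  qed
  have ijp: "supp K i - i \<bullet> p = 0" "supp K j - j \<bullet> p = 0"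
    using ab by (simp_all add: p_def inner_add_right face_def)
  have "(\<Sum>n\<in>S. u n * (supp K n - n \<bullet> p)) = (\<Sum>n\<in>T. u n * (supp K n - n \<bullet> p))"
    using T(1) S(2) ij(1) ijp by (intro sum.mono_neutral_right) auto
  then have sum0: "(\<Sum>n\<in>T. u n * (supp K n - n \<bullet> p)) = 0" using rel by simp
  have "\<forall>n\<in>T. u n * (supp K n - n \<bullet> p) = 0"
    using sign
  proof
    assume "\<forall>t\<in>T. 0 \<le> u t"
    then have "\<forall>n\<in>T. 0 \<le> u n * (supp K n - n \<bullet> p)" using pos by (simp add: less_imp_le)
    then show ?thesis using sum0 sum_nonneg_eq_0_iff[OF finT, of "\<lambda>n. u n * (supp K n - n \<bullet> p)"] by simp
  next
    assume "\<forall>t\<in>T. u t \<le> 0"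
    then have "\<forall>n\<in>T. u n * (supp K n - n \<bullet> p) \<le> 0" using pos by (simp add: less_imp_le mult_nonpos_nonneg)
    then show ?thesis using sum0 sum_nonneg_eq_0_iff[OF finT, of "\<lambda>n. - (u n * (supp K n - n \<bullet> p))"]
      by (simp add: sum_negf)
  qed
  then show "\<forall>t\<in>T. u t = 0" using pos by force
qed

lemma no_five_regular_faces_sharing_edges:
  assumes K: "convex_body K" and S: "S \<subseteq> regular_normals K" "card S = 5"
    and edges: "\<And>i j. i \<in> S \<Longrightarrow> j \<in> S \<Longrightarrow> i \<noteq> j \<Longrightarrow> \<exists>a b. a \<noteq> b \<and> a \<in> face K i \<inter> face K j
        \<and> b \<in> face K i \<inter> face K j"
  shows False
proof -
  have finS: "finite S" using S(2) by (simp add: card_ge_0_finite)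
  \<comment> \<open>The affine function of a face as a vector of a 4-dimensional space, where any
    five vectors are dependent.\<close>
  define g where "g n = (n, supp K n)" for n
  have inj: "inj_on g S" by (auto simp: inj_on_def g_def)
  have "card (g ` S) = 5" using card_image[OF inj] S(2) by simp
  then have "dependent (g ` S)" by (intro dependent_biggerset) simp
  then obtain w where w: "\<exists>v\<in>g ` S. w v \<noteq> 0" "(\<Sum>v\<in>g ` S. w v *\<^sub>R v) = 0"
    using dependent_finite[of "g ` S"] finS by auto
  define u where "u n = w (g n)" for n
  have sum0: "(\<Sum>n\<in>S. u n *\<^sub>R g n) = 0" using w(2) by (simp add: sum.reindex[OF inj] u_def)
  have "(\<Sum>n\<in>S. u n * (supp K n - n \<bullet> z)) = 0" for z
  proof -
    have "(\<Sum>n\<in>S. u n *\<^sub>R n) = fst (\<Sum>n\<in>S. u n *\<^sub>R g n)" "(\<Sum>n\<in>S. u n * supp K n) = snd (\<Sum>n\<in>S. u n *\<^sub>R g n)"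
      by (simp_all add: fst_sum snd_sum g_def)
    then have 1: "(\<Sum>n\<in>S. u n *\<^sub>R n) = 0" "(\<Sum>n\<in>S. u n * supp K n) = 0" using sum0 by simp_all
    have "(\<Sum>n\<in>S. u n * (supp K n - n \<bullet> z)) = (\<Sum>n\<in>S. u n * supp K n) - (\<Sum>n\<in>S. (u n *\<^sub>R n) \<bullet> z)"
      by (simp add: right_diff_distrib sum_subtractf)
    also have "(\<Sum>n\<in>S. (u n *\<^sub>R n) \<bullet> z) = (\<Sum>n\<in>S. u n *\<^sub>R n) \<bullet> z" by (simp only: inner_sum_left)
    finally show ?thesis by (simp add: 1)
  qed
  then have "u s = 0" if "s \<in> S" for s
    using regular_faces_share_edges_independent[OF K S(1) finS, of 3 u s] S(2) edges that by simp
  then show False using w(1) by (auto simp: u_def)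
qed

text \<open>All lateral planes contain c, so a linear dependency of four normals is already a
  relation between the affine functions. The common edge of two lateral faces joins c to a point of
  the base.\<close>

lemma regular_normals_card_le_if_cone:
  assumes K: "convex_body K" and bez: "bezout K" and m: "m \<in> regular_normals K" and cK: "c \<in> K"
    and c: "\<And>n. n \<in> regular_normals K \<Longrightarrow> n \<noteq> m \<Longrightarrow> c \<in> face K n"
  shows "finite (regular_normals K) \<and> card (regular_normals K) \<le> 4"
proof (rule ccontr)
  assume neg: "\<not> ?thesis"
  let ?L = "regular_normals K - {m}"
  have "\<exists>S\<subseteq>?L. card S = 4"
  proof (cases "finite (regular_normals K)")
    case True
    then have "4 \<le> card ?L" using neg m by simp
    then show ?thesis by (rule obtain_subset_with_card_n) blast
  next
    case False
    then show ?thesis using infinite_arbitrarily_large[of ?L 4] by auto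
  qed
  then obtain S where S: "S \<subseteq> ?L" "card S = 4" by blast
  have finS: "finite S" using S(2) by (simp add: card_ge_0_finite)
  have "dependent S" using S(2) by (intro dependent_biggerset) simp
  then obtain u where u: "\<exists>v\<in>S. u v \<noteq> 0" "(\<Sum>v\<in>S. u v *\<^sub>R v) = 0" using dependent_finite[OF finS] by auto
  have "(\<Sum>n\<in>S. u n * (supp K n - n \<bullet> z)) = 0" for z
  proof -
    have "supp K n - n \<bullet> z = n \<bullet> (c - z)" if "n \<in> S" for n
    proof -
      have "c \<in> face K n" using S(1) that by (intro c) auto
      then show ?thesis by (simp add: face_def inner_diff_right)
    qed
    then have "(\<Sum>n\<in>S. u n * (supp K n - n \<bullet> z)) = (\<Sum>n\<in>S. (u n *\<^sub>R n) \<bullet> (c - z))" by simp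
    also have "\<dots> = (\<Sum>n\<in>S. u n *\<^sub>R n) \<bullet> (c - z)" by (simp only: inner_sum_left)
    finally show ?thesis by (simp add: u(2))
  qed
  moreover have "\<exists>a b. a \<noteq> b \<and> a \<in> face K i \<inter> face K j \<and> b \<in> face K i \<inter> face K j"
    if ij: "i \<in> S" "j \<in> S" "i \<noteq> j" for i j
  proof -
    have ij': "i \<in> regular_normals K" "i \<noteq> m" "j \<in> regular_normals K" "j \<noteq> m" using ij S(1) by auto
    then obtain p where p: "p \<in> face K i \<inter> face K j \<inter> face K m"
      using cone_regular_faces_meet[OF K bez m cK c ij'(1,2,3,4) ij(3)] by blast
    moreover have "c \<notin> face K m" by (rule cone_over_face(1)[OF K m cK c])
    ultimately show ?thesis using c ij' by (intro exI[of _ c] exI[of _ p]) auto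
  qed
  moreover have "S \<subseteq> regular_normals K" using S(1) by blast
  ultimately have "u s = 0" if "s \<in> S" for s
    using regular_faces_share_edges_independent[OF K _ finS, of 2 u s] S(2) that by simp
  then show False using u(1) by blast
qed

section \<open>A body with at most four regular faces is a simplex\<close>

text \<open>If the normals at e do not span the space, some w is orthogonal to all of them. Moving
  along w both ways keeps the tight constraints, and the finitely many slack ones tolerate a short
  step, so e is not extreme.\<close>

lemma extreme_point_regular_faces:
  assumes K: "convex_body K" and fin: "finite (regular_normals K)" and e: "e extreme_point_of K"
  shows "3 \<le> card {n \<in> regular_normals K. e \<in> face K n}"
proof (rule ccontr)
  note K' = convex_body_compact_convex[OF K]
  let ?A = "{n \<in> regular_normals K. e \<in> face K n}"
  assume "\<not> 3 \<le> card ?A"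
  then have "dim ?A < 3" using dim_le_card'[of ?A] fin by simp
  then obtain w where w: "w \<noteq> 0" "\<And>n. n \<in> span ?A \<Longrightarrow> orthogonal w n"
    using orthogonal_to_subspace_exists[of ?A] by auto
  have eK: "e \<in> K" using e by (simp add: extreme_point_of_def)
  have "\<exists>t>0. \<forall>n\<in>regular_normals K. \<bar>t * (n \<bullet> w)\<bar> \<le> supp K n - n \<bullet> e"
  proof -
    have 1: "\<exists>t0>0. \<forall>t. 0 < t \<and> t \<le> t0 \<longrightarrow> \<bar>t * (n \<bullet> w)\<bar> \<le> supp K n - n \<bullet> e" if n: "n \<in> regular_normals K"
        for n
    proof (cases "e \<in> face K n")
      case True
      then have "n \<bullet> w = 0" using w(2)[OF span_base, of n] n by (simp add: orthogonal_def inner_commute)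
      then show ?thesis using supp_ge[OF K' eK, of n] by (intro exI[of _ 1]) simp
    next
      case False
      then have pos: "0 < supp K n - n \<bullet> e" using supp_ge[OF K' eK, of n] eK by (simp add: face_def)
      let ?t = "(supp K n - n \<bullet> e) / (\<bar>n \<bullet> w\<bar> + 1)"
      have "\<bar>t * (n \<bullet> w)\<bar> \<le> supp K n - n \<bullet> e" if "0 < t" "t \<le> ?t" for t
      proof -
        have "\<bar>t * (n \<bullet> w)\<bar> \<le> t * (\<bar>n \<bullet> w\<bar> + 1)" using that by (simp add: abs_mult)
        also have "\<dots> \<le> supp K n - n \<bullet> e" using that(2) by (simp add: le_divide_eq add_pos_nonneg)
        finally show ?thesis .
      qed
      then show ?thesis using pos by (intro exI[of _ ?t]) (simp add: add_pos_nonneg)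
    qed
    then obtain t0 where t0: "\<And>n. n \<in> regular_normals K \<Longrightarrow> 0 < t0 n"
      "\<And>n t. n \<in> regular_normals K \<Longrightarrow> 0 < t \<Longrightarrow> t \<le> t0 n \<Longrightarrow> \<bar>t * (n \<bullet> w)\<bar> \<le> supp K n - n \<bullet> e"
      by metis
    define t where "t = Min (insert 1 (t0 ` regular_normals K))"
    have "0 < t" unfolding t_def using fin t0(1) by (subst Min_gr_iff) auto
    moreover have "t \<le> t0 n" if "n \<in> regular_normals K" for n unfolding t_def using fin that
      by (intro Min_le) auto
    ultimately show ?thesis using t0(2) by blast
  qed
  then obtain t where t: "0 < t" "\<And>n. n \<in> regular_normals K \<Longrightarrow> \<bar>t * (n \<bullet> w)\<bar> \<le> supp K n - n \<bullet> e" by blast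
  have "e + t *\<^sub>R w \<in> K" "e - t *\<^sub>R w \<in> K"
  proof -
    have "n \<bullet> (e + t *\<^sub>R w) \<le> supp K n" "n \<bullet> (e - t *\<^sub>R w) \<le> supp K n" if "n \<in> regular_normals K" for n
      using t(2)[OF that] by (simp_all add: inner_add_right inner_diff_right abs_le_iff)
    then show "e + t *\<^sub>R w \<in> K" "e - t *\<^sub>R w \<in> K" using mem_if_regular_normals[OF K] by blast+
  qed
  moreover have "e \<in> open_segment (e - t *\<^sub>R w) (e + t *\<^sub>R w)"
  proof -
    have "e = (1 - 1 / 2) *\<^sub>R (e - t *\<^sub>R w) + (1 / 2) *\<^sub>R (e + t *\<^sub>R w)"
      by (simp add: algebra_simps flip: scaleR_add_left)
    moreover have "e - t *\<^sub>R w \<noteq> e + t *\<^sub>R w"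
    proof
      assume "e - t *\<^sub>R w = e + t *\<^sub>R w"
      then have "(2 * t) *\<^sub>R w = 0" by (simp add: algebra_simps flip: scaleR_2)
      then show False using t(1) w(1) by simp
    qed
    ultimately show ?thesis unfolding in_segment by (intro conjI exI[of _ "1 / 2"]) auto
  qed
  ultimately show False using e by (auto simp: extreme_point_of_def)
qed

text \<open>By \<open>three_regular_faces\<close> an extreme point is determined by three regular
  faces through it, so there are at most 4 choose 3 = 4 of them. Dimension 3 requires at least four
  points, and exactly four spanning it are affinely independent.\<close>

lemma simplex_if_regular_normals_card_le:
  assumes K: "convex_body K" and R: "finite (regular_normals K)" "card (regular_normals K) \<le> 4"
  shows "3 simplex K"
proof -
  note K' = convex_body_compact_convex[OF K]
  define E where "E = {e. e extreme_point_of K}"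
  have KE: "K = convex hull E" unfolding E_def
    using compact_convexD[OF K'] by (intro Krein_Milman_Minkowski)
  define \<T> where "\<T> = {T. T \<subseteq> regular_normals K \<and> card T = 3}"
  have "\<exists>T\<in>\<T>. \<forall>n\<in>T. e \<in> face K n" if "e \<in> E" for e
  proof -
    have "3 \<le> card {n \<in> regular_normals K. e \<in> face K n}"
      using that by (intro extreme_point_regular_faces[OF K R(1)]) (simp add: E_def)
    then obtain T where "T \<subseteq> {n \<in> regular_normals K. e \<in> face K n}" "card T = 3"
      by (rule obtain_subset_with_card_n)
    then show ?thesis by (intro bexI[of _ T]) (auto simp: \<T>_def subset_iff)
  qed
  then obtain F where F: "\<And>e. e \<in> E \<Longrightarrow> F e \<in> \<T>" "\<And>e n. e \<in> E \<Longrightarrow> n \<in> F e \<Longrightarrow> e \<in> face K n" by metis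
  have "inj_on F E"
  proof (rule inj_onI, rule ccontr)
    fix a b assume "a \<in> E" "b \<in> E" "F a = F b" "a \<noteq> b"
    then show False using three_regular_faces[OF K, of "F a" a b] F by (auto simp: \<T>_def)
  qed
  moreover have "F ` E \<subseteq> \<T>" using F(1) by blast
  moreover have "finite \<T>" "card \<T> = card (regular_normals K) choose 3"
    using R(1) by (auto simp: \<T>_def n_subsets)
  ultimately have E: "finite E" "card E \<le> card (regular_normals K) choose 3"
    using inj_on_finite card_inj_on_le by metis+
  have "card (regular_normals K) = 0 \<or> card (regular_normals K) = 1 \<or> card (regular_normals K) = 2
      \<or> card (regular_normals K) = 3 \<or> card (regular_normals K) = 4" using R(2) by linarith
  then have "card (regular_normals K) choose 3 \<le> 4" by (elim disjE) (simp_all add: numeral_eq_Suc)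
  with E have cardE: "card E \<le> 4" by simp
  have "aff_dim K = 3" using K aff_dim_nonempty_interior[of K] by (simp add: convex_body_def)
  then have dimE: "aff_dim E = 3" using KE aff_dim_convex_hull[of E] by simp
  then have "int (card E) = 4" using aff_dim_le_card[OF E(1)] cardE by simp
  moreover from this have "\<not> affine_dependent E" using E(1) dimE by (simp add: affine_independent_iff_card)
  ultimately show ?thesis unfolding simplex_def using KE by auto
qed

section \<open>Flat regular faces\<close>

lemma dependent_if_orthogonal:
  fixes a b c w :: "real ^ 3"
  assumes w: "w \<noteq> 0" and orth: "a \<bullet> w = 0" "b \<bullet> w = 0" "c \<bullet> w = 0"
  obtains x y z where "x \<noteq> 0 \<or> y \<noteq> 0 \<or> z \<noteq> (0::real)" "x *\<^sub>R a + y *\<^sub>R b + z *\<^sub>R c = 0"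
proof -
  define M :: "real ^ 3 ^ 3" where "M = vector [a, b, c]"
  have "(M *v w) $ i = 0" for i
    using exhaust_3[of i] orth by (auto simp: M_def matrix_vector_mul_component)
  then have "M *v w = 0" by (simp add: vec_eq_iff)
  then have "det M = 0"
    using w by (metis invertible_det_nz matrix_left_invertible_ker invertible_left_inverse)
  then have "det (transpose M) = 0" by (simp add: det_transpose)
  then obtain v where v: "v \<noteq> 0" "transpose M *v v = 0"
    by (metis invertible_det_nz matrix_left_invertible_ker invertible_left_inverse)
  have "v $ 1 *\<^sub>R a + v $ 2 *\<^sub>R b + v $ 3 *\<^sub>R c = transpose M *v v"
    by (simp add: vec_eq_iff matrix_vector_mult_def transpose_def M_def sum_3 mult.commute)
  then have "v $ 1 *\<^sub>R a + v $ 2 *\<^sub>R b + v $ 3 *\<^sub>R c = 0" using v(2) by simp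
  moreover have "v $ 1 \<noteq> 0 \<or> v $ 2 \<noteq> 0 \<or> v $ 3 \<noteq> 0" using v(1) by (auto simp: vec_eq_iff forall_3)
  ultimately show thesis using that by blast
qed

text \<open>
  Normalised, the affine functions of the faces \<open>x, x'\<close> differ by a function \<open>p\<close> that vanishes on the
  line through \<open>y1\<close> and \<open>y2\<close>, and so do those of \<open>y, y'\<close> by \<open>q\<close>; the affine function \<open>d\<close> of the face
  \<open>m\<close> vanishes there as well. Hence \<open>p, q, d\<close> are linearly dependent, while the four common points
  realise all combinations of signs of \<open>p\<close> and \<open>q\<close> in the open half space \<open>d > 0\<close>.
\<close>

lemma four_faces_common_point:
  fixes K :: "(real ^ 3) set"
  assumes K: "compact_convex K" and y12: "y1 \<in> K" "y2 \<in> K" "y1 \<noteq> y2"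
    and m: "m \<bullet> y1 = supp K m" "m \<bullet> y2 = supp K m"
    and x: "y1 \<in> face K x" "y2 \<notin> face K x" "norm x = 1"
        and x': "y1 \<in> face K x'" "y2 \<notin> face K x'" "norm x' = 1"
    and y: "y2 \<in> face K y" "y1 \<notin> face K y" "norm y = 1"
        and y': "y2 \<in> face K y'" "y1 \<notin> face K y'" "norm y' = 1"
    and ne: "x \<noteq> x'" "y \<noteq> y'"
    and meet: "\<And>i j. i \<in> {x, x'} \<Longrightarrow> j \<in> {y, y'} \<Longrightarrow> \<exists>c \<in> face K i \<inter> face K j. m \<bullet> c < supp K m"
  shows "\<exists>c. c \<in> face K x \<and> c \<in> face K x' \<and> c \<in> face K y \<and> c \<in> face K y'"
proof -
  define f where "f n z = supp K n - n \<bullet> z" for n z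
  have f0: "0 \<le> f n z" if "z \<in> K" for n z using supp_ge[OF K that, of n] by (simp add: f_def)
  have face_f: "z \<in> face K n \<longleftrightarrow> z \<in> K \<and> f n z = 0" for n z by (auto simp: face_def f_def)
  \<comment> \<open>Normalised to be 1 at \<open>y2\<close>, so that \<open>a x\<close> and
    \<open>a x'\<close> agree at both \<open>y1\<close> and \<open>y2\<close>.\<close>
  define a where "a n z = f n z / f n y2" for n z
  define b where "b n z = f n z / f n y1" for n z
  have pos: "0 < f x y2" "0 < f x' y2" "0 < f y y1" "0 < f y' y1"
    using x(2) x'(2) y(2) y'(2) y12 f0 by (auto simp: face_f less_le)
  have a0: "0 \<le> a x z" "0 \<le> a x' z" "0 \<le> b y z" "0 \<le> b y' z" if "z \<in> K" for z
    using f0[OF that] pos by (simp_all add: a_def b_def)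
  define P where "P = (1 / f x y2) *\<^sub>R x - (1 / f x' y2) *\<^sub>R x'"
  define Q where "Q = (1 / f y y1) *\<^sub>R y - (1 / f y' y1) *\<^sub>R y'"
  have fy: "f x y1 = 0" "f x' y1 = 0" "f y y2 = 0" "f y' y2 = 0" using x x' y y' by (auto simp: face_f)
  have p: "a x z - a x' z = - (P \<bullet> (z - y1))" for z
  proof -
    have "f x z = - (x \<bullet> (z - y1))" "f x' z = - (x' \<bullet> (z - y1))"
      using fy by (simp_all add: f_def inner_diff_right)
    then show ?thesis by (simp add: a_def P_def inner_diff_left)
  qed
  have q2: "b y z - b y' z = - (Q \<bullet> (z - y2))" for z
  proof -
    have "f y z = - (y \<bullet> (z - y2))" "f y' z = - (y' \<bullet> (z - y2))"
      using fy by (simp_all add: f_def inner_diff_right)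
    then show ?thesis by (simp add: b_def Q_def inner_diff_left)
  qed
  have Pw: "P \<bullet> (y2 - y1) = 0" using p[of y2] pos by (simp add: a_def)
  have Qw: "Q \<bullet> (y2 - y1) = 0" using q2[of y1] pos by (simp add: b_def inner_diff_right)
  have q: "b y z - b y' z = - (Q \<bullet> (z - y1))" for z
    using q2[of z] Qw by (simp add: inner_diff_right)
  have mw: "m \<bullet> (y2 - y1) = 0" using m by (simp add: inner_diff_right)
  have d: "f m z = - (m \<bullet> (z - y1))" for z using m by (simp add: f_def inner_diff_right)
  obtain \<alpha> \<beta> \<gamma> where nz: "\<alpha> \<noteq> 0 \<or> \<beta> \<noteq> 0 \<or> \<gamma> \<noteq> (0::real)" and dep: "\<alpha> *\<^sub>R P + \<beta> *\<^sub>R Q + \<gamma> *\<^sub>R m = 0"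
    using dependent_if_orthogonal[of "y2 - y1" P Q m] Pw Qw mw y12(3) by auto
  have rel: "\<alpha> * (a x z - a x' z) + \<beta> * (b y z - b y' z) + \<gamma> * f m z = 0" for z
  proof -
    have "\<alpha> * (a x z - a x' z) + \<beta> * (b y z - b y' z) + \<gamma> * f m z
        = - ((\<alpha> *\<^sub>R P + \<beta> *\<^sub>R Q + \<gamma> *\<^sub>R m) \<bullet> (z - y1))"
      unfolding p q d by (simp add: inner_add_left)
    then show ?thesis by (simp add: dep)
  qed
  obtain c11 c12 c21 c22 where c: "c11 \<in> face K x" "c11 \<in> face K y" "0 < f m c11"
    "c12 \<in> face K x" "c12 \<in> face K y'" "0 < f m c12" "c21 \<in> face K x'" "c21 \<in> face K y" "0 < f m c21"
    "c22 \<in> face K x'" "c22 \<in> face K y'" "0 < f m c22"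
    using meet[of x y] meet[of x y'] meet[of x' y] meet[of x' y'] by (auto simp: f_def)
  have v: "a x c11 = 0" "b y c11 = 0" "a x c12 = 0" "b y' c12 = 0" "a x' c21 = 0" "b y c21 = 0"
      "a x' c22 = 0" "b y' c22 = 0"
    and cK: "c11 \<in> K" "c12 \<in> K" "c21 \<in> K" "c22 \<in> K"
    using c by (simp_all add: face_f a_def b_def)
  have distinct: "u = u'" if "(1 / s) *\<^sub>R u - (1 / t) *\<^sub>R u' = 0" "norm u = 1" "norm u' = 1" "0 < s"
      "0 < t" for u u' :: "real ^ 3" and s t :: real
  proof -
    have eq: "(1 / s) *\<^sub>R u = (1 / t) *\<^sub>R u'" using that(1) by simp
    then have "norm ((1 / s) *\<^sub>R u) = norm ((1 / t) *\<^sub>R u')" by simp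
    then have "1 / s = 1 / t" using that by simp
    then show ?thesis using eq that by simp
  qed
  have P0: "P \<noteq> 0" using distinct[of "f x y2" x "f x' y2" x'] pos x(3) x'(3) ne(1) by (auto simp: P_def)
  have Q0: "Q \<noteq> 0" using distinct[of "f y y1" y "f y' y1" y'] pos y(3) y'(3) ne(2) by (auto simp: Q_def)
  \<comment> \<open>Otherwise d = l p + k q, and for any signs of l and k one of the four common
    points makes the right side nonpositive.\<close>
  have "\<gamma> = 0"
  proof (rule ccontr)
    assume g: "\<gamma> \<noteq> 0"
    define l where "l = - \<alpha> / \<gamma>"
    define k where "k = - \<beta> / \<gamma>"
    have "f m z = l * (a x z - a x' z) + k * (b y z - b y' z)" for z
    proof -
      have "\<gamma> * f m z = - \<alpha> * (a x z - a x' z) - \<beta> * (b y z - b y' z)" using rel[of z] by linarith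
      then have "f m z = (- \<alpha> * (a x z - a x' z) - \<beta> * (b y z - b y' z)) / \<gamma>"
        using g by (simp add: nonzero_eq_divide_eq mult.commute)
      then show ?thesis by (simp add: l_def k_def diff_divide_distrib)
    qed
    then have "0 < l * (- a x' c11) + k * (- b y' c11)" "0 < l * a x c22 + k * b y c22"
      "0 < l * (- a x' c12) + k * b y c12" "0 < l * a x c21 + k * (- b y' c21)"
      using c v by simp_all
    moreover have "l \<le> 0 \<or> 0 \<le> l" "k \<le> 0 \<or> 0 \<le> k" by auto
    ultimately show False using a0[OF cK(1)] a0[OF cK(2)] a0[OF cK(3)] a0[OF cK(4)]
      by (smt (verit) mult_nonneg_nonneg mult_nonpos_nonneg mult_minus_right)
  qed
  then have rel: "\<alpha> * (a x z - a x' z) + \<beta> * (b y z - b y' z) = 0" and dep: "\<alpha> *\<^sub>R P + \<beta> *\<^sub>R Q = 0" for z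
    using rel[of z] dep by simp_all
  have ab0: "\<alpha> \<noteq> 0" "\<beta> \<noteq> 0" using dep nz \<open>\<gamma> = 0\<close> P0 Q0 by auto
  have fin: "z \<in> face K x'" if "a x' z = 0" "z \<in> K" for z using that pos by (simp add: a_def face_f)
  have fin': "z \<in> face K y" if "b y z = 0" "z \<in> K" for z using that pos by (simp add: b_def face_f)
  have fin'': "z \<in> face K y'" if "b y' z = 0" "z \<in> K" for z using that pos by (simp add: b_def face_f)
  show ?thesis
  \<comment> \<open>In this case the relation gives p and q the same sign, but at \<open>c12\<close>
    their signs are opposite, so both vanish and \<open>c12\<close> is on all four faces. In the
    other case the same happens at \<open>c11\<close>.\<close>
  proof (cases "\<alpha> * \<beta> < 0")
    case True
    have "\<alpha> * a x' c12 = \<beta> * b y c12" using rel[of c12] v by simp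
    then have "\<alpha> * \<alpha> * a x' c12 = \<alpha> * \<beta> * b y c12" by simp
    moreover have "0 \<le> \<alpha> * \<alpha> * a x' c12" "\<alpha> * \<beta> * b y c12 \<le> 0"
      using a0[OF cK(2)] True by (auto simp: mult_nonpos_nonneg)
    ultimately have "\<alpha> * \<alpha> * a x' c12 = 0" "\<alpha> * \<beta> * b y c12 = 0" by linarith+
    then have "a x' c12 = 0" "b y c12 = 0" using ab0 by auto
    then show ?thesis using c fin fin' cK by (intro exI[of _ c12]) auto
  next
    case False
    then have pos': "0 < \<alpha> * \<beta>" using ab0 by (simp add: less_le mult_eq_0_iff not_less)
    have "\<alpha> * a x' c11 = - (\<beta> * b y' c11)" using rel[of c11] v by simp
    then have "\<alpha> * \<alpha> * a x' c11 = - (\<alpha> * \<beta> * b y' c11)" by (simp add: mult.assoc)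
    moreover have "0 \<le> \<alpha> * \<alpha> * a x' c11" "0 \<le> \<alpha> * \<beta> * b y' c11"
      using a0[OF cK(1)] pos' by auto
    ultimately have "\<alpha> * \<alpha> * a x' c11 = 0" "\<alpha> * \<beta> * b y' c11 = 0" by linarith+
    then have "a x' c11 = 0" "b y' c11 = 0" using ab0 by auto
    then show ?thesis using c fin fin'' cK by (intro exI[of _ c11]) auto
  qed
qed

text \<open>The flat face is a segment, and every other regular face contains exactly one of its
  ends. If one end has a single such face, the opposite end lies on all the others. Otherwise two
  faces at each end share a point by \<open>four_faces_common_point\<close>, and this point turns
  out to lie on all faces except m. Either way K is a cone.\<close>

lemma simplex_if_flat_regular_face:
  assumes K: "convex_body K" and bez: "bezout K" and m: "m \<in> regular_normals K"
    and v: "vol (face K m + seg m) = 0"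
  shows "3 simplex K"
proof -
  note K' = convex_body_compact_convex[OF K]
  have cone: ?thesis if "c \<in> K" "\<And>n. n \<in> regular_normals K \<Longrightarrow> n \<noteq> m' \<Longrightarrow> c \<in> face K n"
      "m' \<in> regular_normals K" for m' c
    using regular_normals_card_le_if_cone[OF K bez that(3,1,2)] simplex_if_regular_normals_card_le[OF K]
    by blast
  have faceK: "face K n \<subseteq> K" for n by (auto simp: face_def)
  have meet: "face K i \<inter> face K j \<noteq> {}" if "i \<in> regular_normals K" "j \<in> regular_normals K" for i j
    using that regular_faces_meet[OF K bez] unfolding regular_normals_def by blast
  have F: "compact_convex (face K m)" by (rule compact_convex_face[OF K'])
  have "collinear (face K m)"
    by (rule collinear_if_vol_plus_seg_0[OF F regular_normals_norm[OF m] _ v]) (simp add: face_def)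
  then obtain y1 y2 where seg: "face K m = closed_segment y1 y2"
    using compact_convex_collinear_segment compact_convexD[OF F] by metis
  have yK: "y1 \<in> K" "y2 \<in> K" using seg faceK[of m] by auto
  \<comment> \<open>A nonnegative affine function that vanishes somewhere on a segment vanishes at
    an end.\<close>
  have y_one: "y1 \<in> face K n \<or> y2 \<in> face K n" if n: "n \<in> regular_normals K" for n
  proof -
    obtain z where z: "z \<in> face K n" "z \<in> closed_segment y1 y2" using meet[OF n m] seg by blast
    obtain t where t: "0 \<le> t" "t \<le> 1" "z = (1 - t) *\<^sub>R y1 + t *\<^sub>R y2" using z(2) by (auto simp: in_segment)
    have nz: "n \<bullet> z = supp K n" using z(1) by (simp add: face_def)
    have "(1 - t) * (supp K n - n \<bullet> y1) + t * (supp K n - n \<bullet> y2) = 0"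
      using nz by (simp add: t(3) inner_add_right algebra_simps)
    moreover have "0 \<le> (1 - t) * (supp K n - n \<bullet> y1)" "0 \<le> t * (supp K n - n \<bullet> y2)"
      using t supp_ge[OF K'] yK by simp_all
    ultimately have "(1 - t) * (supp K n - n \<bullet> y1) = 0" "t * (supp K n - n \<bullet> y2) = 0" by linarith+
    then show ?thesis using yK by (auto simp: face_def)
  qed
  have not_both: "\<not> (y1 \<in> face K n \<and> y2 \<in> face K n)" if n: "n \<in> regular_normals K" "n \<noteq> m" for n
  proof
    assume "y1 \<in> face K n \<and> y2 \<in> face K n"
    then have "face K m \<subseteq> face K n" unfolding seg
      using compact_convexD(3)[OF compact_convex_face[OF K', of n]] by (intro closed_segment_subset) auto
    then show False using regular_face_subset_imp_eq[OF K' m regular_normals_norm[OF n(1)]] n(2) by blast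
  qed
  define C where "C y = {n \<in> regular_normals K. n \<noteq> m \<and> y \<in> face K n}" for y
  have CC: "n \<in> C y1 \<or> n \<in> C y2" if "n \<in> regular_normals K" "n \<noteq> m" for n
    using y_one[OF that(1)] that by (auto simp: C_def)
  have ym: "y1 \<in> face K m" "y2 \<in> face K m" using seg by auto
  have ncommon: "\<exists>n\<in>regular_normals K. y \<notin> face K n" for y using regular_faces_no_common_point[OF K]
    by blast
  \<comment> \<open>Were the face a single point, all regular faces would contain it.\<close>
  have y12: "y1 \<noteq> y2" using ncommon[of y1] y_one by blast
  have ne: "C y1 \<noteq> {}" "C y2 \<noteq> {}"
    using ncommon[of y1] ncommon[of y2] CC ym by (fastforce simp: C_def)+
  show ?thesis
  proof (cases "is_singleton (C y1) \<or> is_singleton (C y2)")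
    case True
    then obtain x where x: "C y1 = {x} \<or> C y2 = {x}" by (auto simp: is_singleton_def)
    then have xR: "x \<in> regular_normals K" by (auto simp: C_def)
    from x show ?thesis
    proof
      assume x1: "C y1 = {x}"
      have "y2 \<in> face K n" if "n \<in> regular_normals K" "n \<noteq> x" for n
        using CC[OF that(1)] that x1 ym by (cases "n = m") (auto simp: C_def)
      then show ?thesis using cone[of y2 x] xR yK by blast
    next
      assume x2: "C y2 = {x}"
      have "y1 \<in> face K n" if "n \<in> regular_normals K" "n \<noteq> x" for n
        using CC[OF that(1)] that x2 ym by (cases "n = m") (auto simp: C_def)
      then show ?thesis using cone[of y1 x] xR yK by blast
    qed
  next
    case False
    have four: "\<exists>c. c \<in> face K x \<and> c \<in> face K x' \<and> c \<in> face K y \<and> c \<in> face K y'"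
      if x: "x \<in> C y1" "x' \<in> C y1" "x \<noteq> x'" and y: "y \<in> C y2" "y' \<in> C y2" "y \<noteq> y'" for x x' y y'
    proof (rule four_faces_common_point[OF K' yK y12])
      show "m \<bullet> y1 = supp K m" "m \<bullet> y2 = supp K m" using ym by (simp_all add: face_def)
      show "y1 \<in> face K x" "y1 \<in> face K x'" "y2 \<in> face K y" "y2 \<in> face K y'" using x y
        by (simp_all add: C_def)
      show "y2 \<notin> face K x" "y2 \<notin> face K x'" "y1 \<notin> face K y" "y1 \<notin> face K y'"
        using x y not_both by (auto simp: C_def)
      show "norm x = 1" "norm x' = 1" "norm y = 1" "norm y' = 1"
        using x y regular_normals_norm by (auto simp: C_def)
      show "x \<noteq> x'" "y \<noteq> y'" by fact+
      fix i j assume "i \<in> {x, x'}" "j \<in> {y, y'}"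
      then have i: "i \<in> C y1" and j: "j \<in> C y2" using x y by auto
      then obtain c where c: "c \<in> face K i" "c \<in> face K j" using meet[of i j] by (auto simp: C_def)
      have iK: "i \<in> regular_normals K" "i \<noteq> m" "y1 \<in> face K i"
          and jK: "j \<in> regular_normals K" "j \<noteq> m" "y2 \<in> face K j"
        using i j by (auto simp: C_def)
      have "m \<bullet> c \<noteq> supp K m"
      proof
        assume "m \<bullet> c = supp K m"
        then have "c \<in> closed_segment y1 y2" using c(1) by (simp add: face_def flip: seg)
        then obtain t where t: "0 \<le> t" "t \<le> 1" "c = (1 - t) *\<^sub>R y1 + t *\<^sub>R y2" by (auto simp: in_segment)
        have "i \<bullet> c = (1 - t) * (i \<bullet> y1) + t * (i \<bullet> y2)" "j \<bullet> c = (1 - t) * (j \<bullet> y1) + t * (j \<bullet> y2)"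
          by (simp_all add: t(3) inner_add_right)
        moreover have "i \<bullet> c = supp K i" "i \<bullet> y1 = supp K i" "j \<bullet> c = supp K j" "j \<bullet> y2 = supp K j"
          using c iK jK by (simp_all add: face_def)
        ultimately have "t * (supp K i - i \<bullet> y2) = 0" "(1 - t) * (supp K j - j \<bullet> y1) = 0" by algebra+
        moreover have "supp K i - i \<bullet> y2 \<noteq> 0" "supp K j - j \<bullet> y1 \<noteq> 0"
          using not_both[OF iK(1,2)] not_both[OF jK(1,2)] iK jK yK by (auto simp: face_def)
        ultimately show False by simp
      qed
      then have "m \<bullet> c < supp K m" using supp_ge[OF K', of c m] c(1) by (simp add: face_def less_le)
      then show "\<exists>c\<in>face K i \<inter> face K j. m \<bullet> c < supp K m" using c by blast
    qed
    obtain x x' where x: "x \<in> C y1" "x' \<in> C y1" "x \<noteq> x'" using False ne(1)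
      by (metis is_singletonI' ex_in_conv)
    obtain y y' where y: "y \<in> C y2" "y' \<in> C y2" "y \<noteq> y'" using False ne(2)
      by (metis is_singletonI' ex_in_conv)
    obtain c where c: "c \<in> face K x" "c \<in> face K x'" "c \<in> face K y" "c \<in> face K y'" using four[OF x y]
      by blast
    have disj: "i \<noteq> j" if "i \<in> C y1" "j \<in> C y2" for i j using that not_both by (auto simp: C_def)
    \<comment> \<open>Two quadruples of faces sharing three faces have the same common point, so a
      face can be exchanged for another one without moving c.\<close>
    have three: "c' = c" if "card {i, j, k} = 3" "{i, j, k} \<subseteq> regular_normals K"
      "c \<in> face K i" "c \<in> face K j" "c \<in> face K k" "c' \<in> face K i" "c' \<in> face K j" "c' \<in> face K k"
          for i j k c'
      using three_regular_faces[OF K that(2,1), of c' c] that by auto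
    have RC: "i \<in> regular_normals K" if "i \<in> C y1 \<or> i \<in> C y2" for i using that by (auto simp: C_def)
    have "c \<in> face K n" if n: "n \<in> regular_normals K" "n \<noteq> m" for n
    proof (cases "n = x \<or> n = y")
      case True
      then show ?thesis using c by auto
    next
      case False
      from CC[OF n] show ?thesis
      proof
        assume n1: "n \<in> C y1"
        obtain c' where c': "c' \<in> face K x" "c' \<in> face K n" "c' \<in> face K y" "c' \<in> face K y'"
          using four[OF x(1) n1 _ y] False by blast
        have "c' = c"
          using disj[OF x(1) y(1)] disj[OF x(1) y(2)] y RC x(1) c c' by (intro three[of x y y']) auto
        then show ?thesis using c'(2) by simp
      next
        assume n2: "n \<in> C y2"
        obtain c' where c': "c' \<in> face K x" "c' \<in> face K x'" "c' \<in> face K y" "c' \<in> face K n"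
          using four[OF x y(1) n2] False by blast
        have "c' = c"
          using disj[OF x(1) y(1)] disj[OF x(2) y(1)] x RC y(1) c c' by (intro three[of x x' y]) auto
        then show ?thesis using c'(4) by simp
      qed
    qed
    then show ?thesis using cone[of c m] m c(1) faceK by blast
  qed
qed

theorem corollary1:
  fixes K :: "(real ^ 3) set"
  assumes "is_arg_min b2 convex_body K"
  shows "3 simplex K"
proof -
  let ?R = "regular_normals K"
  have K: "convex_body K" using assms by (simp add: is_arg_min_def)
  have bez: "bezout K" by (rule bezout_if_minimal[OF assms])
  show ?thesis
  proof (cases "\<exists>m\<in>?R. vol (face K m + seg m) = 0")
    case True
    then show ?thesis using simplex_if_flat_regular_face[OF K bez] by blast
  next
    case False
    then have pos: "0 < vol (face K n + seg n)" if "n \<in> ?R" for n using that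
      by (simp add: zero_less_measure_iff)
    have edges: "\<exists>a b. a \<noteq> b \<and> a \<in> face K i \<inter> face K j \<and> b \<in> face K i \<inter> face K j"
      if ij: "i \<in> ?R" "j \<in> ?R" "i \<noteq> j" for i j
    proof -
      have "face K i \<inter> face K j \<noteq> {}"
        using ij(1,2) regular_faces_meet[OF K bez] unfolding regular_normals_def by blast
      then obtain a where a: "a \<in> face K i \<inter> face K j" by blast
      moreover have "face K i \<inter> face K j \<noteq> {a}" using ij pos by (intro facets_meet_not_singleton[OF K bez])
      ultimately show ?thesis by blast
    qed
    have "finite ?R \<and> card ?R \<le> 4"
    proof (rule ccontr)
      assume neg: "\<not> ?thesis"
      have "\<exists>S\<subseteq>?R. card S = 5"
      proof (cases "finite ?R")
        case True
        then have "5 \<le> card ?R" using neg by simp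
        then show ?thesis by (rule obtain_subset_with_card_n) blast
      next
        case False
        then show ?thesis using infinite_arbitrarily_large[of ?R 5] by auto
      qed
      then obtain S where S: "S \<subseteq> ?R" "card S = 5" by blast
      show False
        by (rule no_five_regular_faces_sharing_edges[OF K S]) (use S(1) edges in blast)
    qed
    then show ?thesis using simplex_if_regular_normals_card_le[OF K] by blast
  qed
qed

end
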